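(* Let $V(x)=\sup_{\tau\in\mathcal{S}}E\left[\int_0^{\tau}e^{-rs}\Pi(X(s))\,ds\,\middle|\,X(0)=x\right]$, where $\Pi(x)=\frac{\gamma^2x^2}{4}-K$, be the value function of the optimal stopping problem for the geometric Brownian motion $X$ described in the context. Then, for every $x\ge 0$, $$V(x)=\begin{cases} v_\infty(x), & x\ge x^*_\infty,\\ 0, & x<x^*_\infty,\end{cases}$$ where $$v_\infty(x)=A_1^\infty x^{D_1}+A_2^\infty x^{D_2}+\frac{\gamma^2}{4(r-2\alpha-\sigma^2)}x^2-\frac{K}{r},$$ $D_1$ and $D_2$ are respectively the positive and the negative root of $-\frac12\sigma^2D^2+\left(\frac12\sigma^2-\alpha\right)D+r=0$, and $$A_1^\infty=0,\qquad x^*_\infty=\left(-\frac{D_2}{2-D_2}\cdot\frac{K}{r}\cdot\frac{4(r-2\alpha-\sigma^2)}{\gamma^2}\right)^{1/2},\qquad A_2^\infty=\frac{2}{2-D_2}\cdot\frac{K}{r}\cdot (x^*_\infty)^{-D_2}.$$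
   Context: Parameters: $\alpha\in\mathbb{R}$, $\sigma>0$, $\gamma>0$, $r>0$ (constant interest rate), $K>0$ (fixed cost), with the standing assumption $r>\sigma^2+2\alpha$. On a complete filtered probability space $(\Omega,\{\mathcal{F}_t\}_{t\ge0},\mathcal{P})$ let $W$ be a Brownian motion and let $X=\{X(t),t\ge 0\}$ (the demand) be the geometric Brownian motion $dX(t)=\alpha X(t)\,dt+\sigma X(t)\,dW(t)$, $X(0)=x\ge 0$. $\mathcal{S}$ denotes the set of all Markov (stopping) times $\tau$ with respect to $\{\mathcal{F}_t\}$ with values in $[0,+\infty]$. *)

theory Defs
  imports "HOL-Probability.Probability"
begin

section \<open>Complete filtered probability spaces and Brownian motion\<close>

text \<open>
  The library's \<open>stopping_time\<close> takes its values in the index set of the filtration. To obtain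
  stopping times with values in \<open>[0, \<infinity>]\<close>, a filtration \<open>(F t)\<close>, \<open>t \<ge> 0\<close>, is indexed by
  \<^typ>\<open>ennreal\<close>. This is no restriction: a filtration over \<open>[0, \<infinity>)\<close> can be extended by
  \<open>F \<infinity> = M\<close>, and the index \<open>\<infinity>\<close> imposes no condition in \<open>stopping_time\<close>.
  Complete means that \<open>M\<close> is complete and that \<open>F 0\<close> contains all null sets; right-continuity is
  not required.
\<close>

locale complete_filtered_prob_space =
  prob_space M + complete_measure M + filtration "space M" F
  for M :: "'a measure" and F :: "ennreal \<Rightarrow> 'a measure" +
  assumes subalgebra_F: "\<And>t. subalgebra M (F t)"
    and null_sets_F: "null_sets M \<subseteq> sets (F 0)"

locale brownian_motion = complete_filtered_prob_space M F
  for M :: "'a measure" and F :: "ennreal \<Rightarrow> 'a measure" +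
  fixes W :: "real \<Rightarrow> 'a \<Rightarrow> real"
  assumes W_adapted: "\<And>t. 0 \<le> t \<Longrightarrow> W t \<in> borel_measurable (F (ennreal t))"
    and W_continuous: "\<And>\<omega>. \<omega> \<in> space M \<Longrightarrow> continuous_on {0..} (\<lambda>t. W t \<omega>)"
    and W_0: "AE \<omega> in M. W 0 \<omega> = 0"
    and W_increment_normal: "\<And>s t. 0 \<le> s \<Longrightarrow> s < t \<Longrightarrow>
      distributed M lborel (\<lambda>\<omega>. W t \<omega> - W s \<omega>) (normal_density 0 (sqrt (t - s)))"
    and W_increment_indep: "\<And>s t. 0 \<le> s \<Longrightarrow> s < t \<Longrightarrow>
      indep_set (sets (F (ennreal s)))
        (sets (vimage_algebra (space M) (\<lambda>\<omega>. W t \<omega> - W s \<omega>) borel))"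

section \<open>The Ito integral\<close>

text \<open>
  A simple process is given by a partition \<open>0 \<le> p 0 < \<dots> < p n\<close> and bounded coefficients
  \<open>e j\<close>, \<open>j < n\<close>, measurable at the left end points; it is the process
  \<open>\<Sum>j<n. e j * indicator {p j<..p (j + 1)}\<close>.
\<close>

definition simple_process ::
  "(ennreal \<Rightarrow> 'a measure) \<Rightarrow> nat \<Rightarrow> (nat \<Rightarrow> real) \<Rightarrow> (nat \<Rightarrow> 'a \<Rightarrow> real) \<Rightarrow> bool" where
  "simple_process F n p e \<longleftrightarrow>
     0 \<le> p 0 \<and> (\<forall>j<n. p j < p (Suc j)) \<and>
     (\<forall>j<n. e j \<in> borel_measurable (F (ennreal (p j)))) \<and>
     (\<exists>C. \<forall>j<n. \<forall>\<omega>\<in>space (F 0). \<bar>e j \<omega>\<bar> \<le> C)"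

definition simple_value ::
  "nat \<Rightarrow> (nat \<Rightarrow> real) \<Rightarrow> (nat \<Rightarrow> 'a \<Rightarrow> real) \<Rightarrow> real \<Rightarrow> 'a \<Rightarrow> real" where
  "simple_value n p e s \<omega> = (\<Sum>j<n. e j \<omega> * indicator {p j<..p (Suc j)} s)"

definition simple_integral ::
  "(real \<Rightarrow> 'a \<Rightarrow> real) \<Rightarrow> nat \<Rightarrow> (nat \<Rightarrow> real) \<Rightarrow> (nat \<Rightarrow> 'a \<Rightarrow> real) \<Rightarrow> real \<Rightarrow> 'a \<Rightarrow> real" where
  "simple_integral W n p e t \<omega> =
     (\<Sum>j<n. e j \<omega> * (W (min (p (Suc j)) t) \<omega> - W (min (p j) t) \<omega>))"

definition tendsto_zero_in_prob :: "'a measure \<Rightarrow> (nat \<Rightarrow> 'a \<Rightarrow> ennreal) \<Rightarrow> bool" where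
  "tendsto_zero_in_prob M Y \<longleftrightarrow>
     (\<forall>\<epsilon>::real. 0 < \<epsilon> \<longrightarrow> (\<lambda>k. measure M {\<omega> \<in> space M. ennreal \<epsilon> < Y k \<omega>}) \<longlonglongrightarrow> 0)"

definition progressively_measurable ::
  "(ennreal \<Rightarrow> 'a measure) \<Rightarrow> (real \<Rightarrow> 'a \<Rightarrow> real) \<Rightarrow> bool" where
  "progressively_measurable F H \<longleftrightarrow>
     (\<forall>t\<ge>0. (\<lambda>(s, \<omega>). H s \<omega>) \<in>
        borel_measurable (restrict_space borel {0..t} \<Otimes>\<^sub>M F (ennreal t)))"

text \<open>
  \<open>I t\<close> is the integral of \<open>H\<close> with respect to \<open>W\<close> over \<open>[0, t]\<close>, for all \<open>t \<ge> 0\<close>: the integrand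
  is progressively measurable with almost surely locally square integrable paths, and \<open>I t\<close> is the
  limit in probability of the integrals of simple processes approximating \<open>H\<close>. As usual,
  \<open>I t\<close> is determined up to null sets only.
\<close>

definition has_ito_integral ::
  "'a measure \<Rightarrow> (ennreal \<Rightarrow> 'a measure) \<Rightarrow> (real \<Rightarrow> 'a \<Rightarrow> real) \<Rightarrow>
   (real \<Rightarrow> 'a \<Rightarrow> real) \<Rightarrow> (real \<Rightarrow> 'a \<Rightarrow> real) \<Rightarrow> bool" where
  "has_ito_integral M F W H I \<longleftrightarrow>
     progressively_measurable F H \<and>
     (\<forall>t\<ge>0. AE \<omega> in M. (\<integral>\<^sup>+s\<in>{0..t}. ennreal ((H s \<omega>)\<^sup>2) \<partial>lborel) < \<infinity>) \<and>
     (\<forall>t\<ge>0. I t \<in> borel_measurable (F (ennreal t))) \<and>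
     (\<exists>n p e. (\<forall>k. simple_process F (n k) (p k) (e k)) \<and>
       (\<forall>t\<ge>0.
         tendsto_zero_in_prob M (\<lambda>k \<omega>.
           \<integral>\<^sup>+s\<in>{0..t}. ennreal ((simple_value (n k) (p k) (e k) s \<omega> - H s \<omega>)\<^sup>2) \<partial>lborel) \<and>
         tendsto_zero_in_prob M (\<lambda>k \<omega>.
           ennreal \<bar>simple_integral W (n k) (p k) (e k) t \<omega> - I t \<omega>\<bar>)))"

section \<open>Geometric Brownian motion\<close>

text \<open>\<open>X\<close> is a solution of \<open>dX = \<alpha> X dt + \<sigma> X dW\<close>, \<open>X 0 = x\<close>.\<close>

locale geometric_brownian_motion = brownian_motion M F W
  for M :: "'a measure" and F :: "ennreal \<Rightarrow> 'a measure" and W :: "real \<Rightarrow> 'a \<Rightarrow> real" +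
  fixes \<alpha> \<sigma> x :: real and X :: "real \<Rightarrow> 'a \<Rightarrow> real"
  assumes X_adapted: "\<And>t. 0 \<le> t \<Longrightarrow> X t \<in> borel_measurable (F (ennreal t))"
    and X_continuous: "\<And>\<omega>. \<omega> \<in> space M \<Longrightarrow> continuous_on {0..} (\<lambda>t. X t \<omega>)"
    and X_0: "AE \<omega> in M. X 0 \<omega> = x"
    and X_sde: "\<exists>I. has_ito_integral M F W (\<lambda>s \<omega>. \<sigma> * X s \<omega>) I \<and>
      (\<forall>t\<ge>0. AE \<omega> in M. X t \<omega> = x + (LBINT s:{0..t}. \<alpha> * X s \<omega>) + I t \<omega>)"

section \<open>The optimal stopping problem\<close>

definition profit :: "real \<Rightarrow> real \<Rightarrow> real \<Rightarrow> real" where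
  "profit \<gamma> K x = \<gamma>\<^sup>2 * x\<^sup>2 / 4 - K"

definition stopped_payoff ::
  "real \<Rightarrow> real \<Rightarrow> real \<Rightarrow> (real \<Rightarrow> 'a \<Rightarrow> real) \<Rightarrow> ('a \<Rightarrow> ennreal) \<Rightarrow> 'a \<Rightarrow> real" where
  "stopped_payoff r \<gamma> K X \<tau> \<omega> =
     (LBINT s:{s. 0 \<le> s \<and> ennreal s \<le> \<tau> \<omega>}. exp (- r * s) * profit \<gamma> K (X s \<omega>))"

text \<open>
  The supremum is taken in the extended reals, so that no boundedness is presupposed.
\<close>

definition value_function ::
  "'a measure \<Rightarrow> (ennreal \<Rightarrow> 'a measure) \<Rightarrow> real \<Rightarrow> real \<Rightarrow> real \<Rightarrow> (real \<Rightarrow> 'a \<Rightarrow> real) \<Rightarrow> ereal" where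
  "value_function M F r \<gamma> K X =
     (SUP \<tau>\<in>{\<tau>. stopping_time F \<tau>}. ereal (integral\<^sup>L M (stopped_payoff r \<gamma> K X \<tau>)))"

section \<open>The candidate solution\<close>

definition threshold :: "real \<Rightarrow> real \<Rightarrow> real \<Rightarrow> real \<Rightarrow> real \<Rightarrow> real \<Rightarrow> real" where
  "threshold \<alpha> \<sigma> \<gamma> r K D2 =
     sqrt (- D2 / (2 - D2) * (K / r) * (4 * (r - 2 * \<alpha> - \<sigma>\<^sup>2) / \<gamma>\<^sup>2))"

definition coeff1 :: real where
  "coeff1 = 0"

definition coeff2 :: "real \<Rightarrow> real \<Rightarrow> real \<Rightarrow> real \<Rightarrow> real \<Rightarrow> real \<Rightarrow> real" where
  "coeff2 \<alpha> \<sigma> \<gamma> r K D2 =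
     2 / (2 - D2) * (K / r) * threshold \<alpha> \<sigma> \<gamma> r K D2 powr (- D2)"

definition v_inf :: "real \<Rightarrow> real \<Rightarrow> real \<Rightarrow> real \<Rightarrow> real \<Rightarrow> real \<Rightarrow> real \<Rightarrow> real \<Rightarrow> real" where
  "v_inf \<alpha> \<sigma> \<gamma> r K D1 D2 x =
     coeff1 * x powr D1 + coeff2 \<alpha> \<sigma> \<gamma> r K D2 * x powr D2
     + \<gamma>\<^sup>2 / (4 * (r - 2 * \<alpha> - \<sigma>\<^sup>2)) * x\<^sup>2 - K / r"

end

theory Submission
  imports Defs
begin

text \<open>
  Put \<open>c = \<gamma>\<^sup>2 / (4 (r - 2 \<alpha> - \<sigma>\<^sup>2))\<close>. Never stopping earns \<open>G x = c x\<^sup>2 - K / r\<close> in expectation, and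
  stopping at \<open>\<tau>\<close> forgoes the value \<open>G (X \<tau>)\<close> discounted by \<open>exp (- r \<tau>)\<close>. Hence the expected profit of
  \<open>\<tau>\<close> is \<open>G x + E (exp (- r \<tau>) g (X \<tau>))\<close> with \<open>g y = K / r - c y\<^sup>2\<close>, and the problem is a perpetual
  put option on \<open>X\<^sup>2\<close>.

  The equation for \<open>D1\<close> and \<open>D2\<close> says that \<open>exp (- r t) (X t) powr D\<close> is a martingale for \<open>D = D1\<close>
  and \<open>D = D2\<close>. So every function \<open>h y = p y powr D1 + q y powr D2\<close> with \<open>h \<ge> g\<close> bounds the
  expectation of \<open>exp (- r \<tau>) g (X \<tau>)\<close> by \<open>h x\<close>. The best such \<open>h\<close> is tangent to \<open>g\<close>: for \<open>x\<close> below
  the threshold \<open>b\<close> at \<open>x\<close> itself, which gives \<open>G x + g x = 0\<close>; for \<open>x \<ge> b\<close> at \<open>b\<close> with \<open>p = 0\<close>, which gives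
  \<open>v_inf\<close>. The threshold is the point up to which the tangent has \<open>p \<ge> 0\<close>. Tangency at one
  point gives \<open>h \<ge> g\<close> everywhere because \<open>h - g\<close> is a sum of exponentials, hence convex, in the
  variable \<open>ln y\<close> (\<open>exponential_sum_tangent\<close>); this yields the upper bound
  \<open>expectation_payoff_le\<close>. For \<open>x \<ge> b\<close> the first time at which \<open>X \<le> b\<close> turns the inequality into an
  equality, since \<open>h\<close> and \<open>g\<close> agree at \<open>b\<close> (\<open>expectation_payoff_hitting_time_ge\<close>); for \<open>x < b\<close> stopping at once
  earns \<open>0\<close>. If \<open>x = 0\<close>, then \<open>X\<close> stays at \<open>0\<close> and running only costs.

  The martingales and the expected profit are computed for the explicit process
  \<open>x exp ((\<alpha> - \<sigma>\<^sup>2 / 2) t + \<sigma> W t)\<close>, so \<open>X\<close> has to be identified with it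
  (\<open>AE_X_eq_geometric_path\<close>). The Ito integral of a continuous adapted process is the limit of its left-point
  sums (\<open>ito_integral_left_sums\<close>). Both processes therefore satisfy, in the limit of fine grids, the same
  Euler relation \<open>V t - V 0 = \<Sum>i. V (t i) (\<alpha> (t (i + 1) - t i) + \<sigma> (W (t (i + 1)) - W (t i)))\<close>, and a Gronwall
  argument carried out on these sums shows that their difference vanishes (\<open>linear_sde_unique\<close>). All second
  moments rest on one fact: sums of past-measurable coefficients times centred functions of the
  increments are orthogonal (\<open>orthogonal_increment_sum\<close>).

  Optional stopping at bounded stopping times (\<open>exp_martingale_optional_stopping\<close>) follows from grid-valued times
  by a limit; the mass cannot escape because the square of an exponential martingale is again one, up to a factor that
  is bounded on bounded time intervals. Unbounded stopping times are reached by truncation at \<open>n\<close> and dominated convergence on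
  time times probability space.
\<close>

section \<open>Gaussian increments of Brownian motion\<close>

text \<open>
  Completing the square: an exponential weight turns a centred normal density into a shifted one,
  so that exponential moments reduce to the moments of the shifted density.
\<close>

lemma normal_density_tilt:
  assumes "s > 0"
  shows "normal_density 0 s y * exp (a * y) = exp (a\<^sup>2 * s\<^sup>2 / 2) * normal_density (a * s\<^sup>2) s y"
proof -
  have "- y\<^sup>2 / (2 * s\<^sup>2) + a * y = a\<^sup>2 * s\<^sup>2 / 2 + - (y - a * s\<^sup>2)\<^sup>2 / (2 * s\<^sup>2)"
    using assms by (simp add: field_simps power2_eq_square)
  then have "exp (- y\<^sup>2 / (2 * s\<^sup>2)) * exp (a * y)
      = exp (a\<^sup>2 * s\<^sup>2 / 2) * exp (- (y - a * s\<^sup>2)\<^sup>2 / (2 * s\<^sup>2))"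
    by (simp add: exp_add[symmetric])
  then show ?thesis
    by (simp add: normal_density_def)
qed

context
  fixes s :: real
  assumes s: "s > 0"
begin

lemma has_bochner_integral_normal_exp:
  "has_bochner_integral lborel (\<lambda>y. normal_density 0 s y * exp (a * y)) (exp (a\<^sup>2 * s\<^sup>2 / 2))"
  unfolding normal_density_tilt[OF s] using s
  by (intro has_bochner_integral_iff[THEN iffD2]) simp

lemma has_bochner_integral_normal_id_exp:
  "has_bochner_integral lborel (\<lambda>y. normal_density 0 s y * (y * exp (a * y)))
     (a * s\<^sup>2 * exp (a\<^sup>2 * s\<^sup>2 / 2))"
proof -
  have "has_bochner_integral lborel
      (\<lambda>y. exp (a\<^sup>2 * s\<^sup>2 / 2) * (normal_density (a * s\<^sup>2) s y * y)) (exp (a\<^sup>2 * s\<^sup>2 / 2) * (a * s\<^sup>2))"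
    by (intro has_bochner_integral_mult_right normal_moment_nz_1 s)
  moreover have "normal_density 0 s y * (y * exp (a * y))
      = exp (a\<^sup>2 * s\<^sup>2 / 2) * (normal_density (a * s\<^sup>2) s y * y)" for y
    using normal_density_tilt[OF s, of y a] by (simp add: mult.assoc[symmetric] mult.commute[of y])
  ultimately show ?thesis by (simp only: mult.commute[of "exp (a\<^sup>2 * s\<^sup>2 / 2)"])
qed

lemma has_bochner_integral_normal_id:
  "has_bochner_integral lborel (\<lambda>y. normal_density 0 s y * y) 0"
  using normal_moment_nz_1[OF s, of 0] .

lemma has_bochner_integral_normal_square:
  "has_bochner_integral lborel (\<lambda>y. normal_density 0 s y * y\<^sup>2) (s\<^sup>2)"
  using normal_moment_even[OF s, of 0 1] by simp

end

context brownian_motion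
begin

lemma measurable_F: "f \<in> borel_measurable (F s) \<Longrightarrow> f \<in> borel_measurable M"
  using measurable_from_subalg[OF subalgebra_F] .

lemma measurable_F_mono:
  assumes "f \<in> borel_measurable (F s)" "s \<le> t"
  shows "f \<in> borel_measurable (F t)"
  using measurable_mono[OF order_refl refl sets_F_mono[OF assms(2)]] assms(1) space_F by blast

lemma W_measurable_F: "0 \<le> s \<Longrightarrow> s \<le> t \<Longrightarrow> W s \<in> borel_measurable (F (ennreal t))"
  using measurable_F_mono[OF W_adapted[of s], of "ennreal t"] by (simp add: ennreal_leI)

lemma W_measurable: "0 \<le> s \<Longrightarrow> W s \<in> borel_measurable M"
  using measurable_F[OF W_adapted] .

text \<open>
  The Brownian motion axioms state independence for \<open>\<sigma>\<close>-algebras; moments of products need it for random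
  variables.
\<close>

lemma indep_var_past_increment:
  fixes Y :: "'a \<Rightarrow> real" and f :: "real \<Rightarrow> real"
  assumes st: "0 \<le> s" "s < t" and Y: "Y \<in> borel_measurable (F (ennreal s))"
    and f: "f \<in> borel_measurable borel"
  shows "indep_var borel Y borel (\<lambda>\<omega>. f (W t \<omega> - W s \<omega>))"
proof -
  let ?D = "\<lambda>\<omega>. W t \<omega> - W s \<omega>"
  have D: "?D \<in> borel_measurable M"
    using st W_measurable by auto
  have sets_D: "sets (vimage_algebra (space M) ?D borel) = {?D -` A \<inter> space M | A. A \<in> sets borel}"
    by (rule sets_vimage_algebra2) simp
  have alg: "sigma_algebra (space M) {?D -` A \<inter> space M | A. A \<in> sets borel}"
    using sets.sigma_algebra_axioms[of "vimage_algebra (space M) ?D borel"] sets_D by simp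
  have "indep_var borel Y borel ?D"
    unfolding indep_var_eq
  proof (intro conjI)
    show "random_variable borel Y" using measurable_F[OF Y] .
    show "random_variable borel ?D" by (rule D)
    have 1: "sigma_sets (space M) {Y -` A \<inter> space M |A. A \<in> sets borel} \<subseteq> sets (F (ennreal s))"
    proof (rule sets.sigma_sets_subset[of _ "F (ennreal s)", unfolded space_F])
      show "{Y -` A \<inter> space M |A. A \<in> sets borel} \<subseteq> sets (F (ennreal s))"
        using measurable_sets[OF Y] space_F by auto
    qed
    have 2: "sigma_sets (space M) {?D -` A \<inter> space M |A. A \<in> sets borel}
        = sets (vimage_algebra (space M) ?D borel)"
      using sigma_algebra.sigma_sets_eq[OF alg] sets_D by simp
    show "indep_set (sigma_sets (space M) {Y -` A \<inter> space M |A. A \<in> sets borel})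
       (sigma_sets (space M) {?D -` A \<inter> space M |A. A \<in> sets borel})"
      unfolding 2 using W_increment_indep[OF st] 1 unfolding indep_sets2_eq by blast
  qed
  from indep_var_compose[OF this measurable_ident f] show ?thesis
    by (simp add: comp_def id_def)
qed

lemma has_bochner_integral_increment:
  assumes st: "0 \<le> s" "s < t" and f: "f \<in> borel_measurable borel"
    and I: "has_bochner_integral lborel (\<lambda>y. normal_density 0 (sqrt (t - s)) y * f y) c"
  shows "has_bochner_integral M (\<lambda>\<omega>. f (W t \<omega> - W s \<omega>)) c"
  using I distributed_integral[OF W_increment_normal[OF st], of f]
    distributed_integrable[OF W_increment_normal[OF st], of f] f
  by (auto simp: has_bochner_integral_iff)

lemma has_bochner_integral_past_increment:
  assumes st: "0 \<le> s" "s < t" and Y: "Y \<in> borel_measurable (F (ennreal s))" "integrable M Y"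
    and f: "f \<in> borel_measurable borel"
    and I: "has_bochner_integral lborel (\<lambda>y. normal_density 0 (sqrt (t - s)) y * f y) c"
  shows "has_bochner_integral M (\<lambda>\<omega>. Y \<omega> * f (W t \<omega> - W s \<omega>)) (integral\<^sup>L M Y * c)"
  using indep_var_lebesgue_integral[OF indep_var_past_increment[OF st Y(1) f] Y(2)]
    indep_var_integrable[OF indep_var_past_increment[OF st Y(1) f] Y(2)]
    has_bochner_integral_increment[OF st f I]
  by (auto simp: has_bochner_integral_iff)

end

definition increment :: "(real \<Rightarrow> 'a \<Rightarrow> real) \<Rightarrow> real \<Rightarrow> nat \<Rightarrow> 'a \<Rightarrow> real" where
  "increment W h i \<omega> = W (real (Suc i) * h) \<omega> - W (real i * h) \<omega>"

lemma integrable_mult_L2: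
  fixes f g :: "'a \<Rightarrow> real"
  assumes [measurable]: "f \<in> borel_measurable M" "g \<in> borel_measurable M"
    and "integrable M (\<lambda>x. (f x)\<^sup>2)" "integrable M (\<lambda>x. (g x)\<^sup>2)"
  shows "integrable M (\<lambda>x. f x * g x)"
proof (rule Bochner_Integration.integrable_bound)
  show "integrable M (\<lambda>x. (f x)\<^sup>2 + (g x)\<^sup>2)" using assms by simp
  show "AE x in M. norm (f x * g x) \<le> norm ((f x)\<^sup>2 + (g x)\<^sup>2)"
  proof (rule AE_I2)
    fix x
    have "2 * (\<bar>f x\<bar> * \<bar>g x\<bar>) \<le> (f x)\<^sup>2 + (g x)\<^sup>2"
      using sum_squares_bound[of "\<bar>f x\<bar>" "\<bar>g x\<bar>"] by simp
    moreover have "0 \<le> \<bar>f x\<bar> * \<bar>g x\<bar>" by simp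
    ultimately have "\<bar>f x\<bar> * \<bar>g x\<bar> \<le> (f x)\<^sup>2 + (g x)\<^sup>2" by linarith
    then show "norm (f x * g x) \<le> norm ((f x)\<^sup>2 + (g x)\<^sup>2)"
      by (simp add: abs_mult)
  qed
qed simp

context brownian_motion
begin

lemma increment_measurable_F:
  assumes "0 \<le> h" "Suc i \<le> n"
  shows "increment W h i \<in> borel_measurable (F (ennreal (real n * h)))"
proof -
  have "real i * h \<le> real n * h" "real (Suc i) * h \<le> real n * h"
    using assms by (auto intro!: mult_right_mono simp del: of_nat_Suc)
  then have "W (real i * h) \<in> borel_measurable (F (ennreal (real n * h)))"
    "W (real (Suc i) * h) \<in> borel_measurable (F (ennreal (real n * h)))"
    using assms by (intro W_measurable_F; simp)+
  then show ?thesis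
    unfolding increment_def by measurable
qed

lemma increment_measurable: "0 \<le> h \<Longrightarrow> increment W h i \<in> borel_measurable M"
  using measurable_F[OF increment_measurable_F[of h i "Suc i"]] by simp

text \<open>
  In the expansion of the square every mixed term contains a last increment that is independent of the
  other factors and whose function \<open>f\<close> is centred. Besides \<open>f y = y\<close>, which gives the Ito isometry for step
  processes, the defect of one Euler step of the exponential is used for \<open>f\<close>.
\<close>

lemma orthogonal_increment_sum:
  assumes h: "0 < h"
    and Y: "\<And>i. i < n \<Longrightarrow> Y i \<in> borel_measurable (F (ennreal (real i * h)))"
    and Y2: "\<And>i. i < n \<Longrightarrow> integrable M (\<lambda>\<omega>. (Y i \<omega>)\<^sup>2)"
    and f: "f \<in> borel_measurable borel"
    and f0: "has_bochner_integral lborel (\<lambda>y. normal_density 0 (sqrt h) y * f y) 0"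
    and f2: "has_bochner_integral lborel (\<lambda>y. normal_density 0 (sqrt h) y * (f y)\<^sup>2) v"
  shows "has_bochner_integral M (\<lambda>\<omega>. (\<Sum>i<n. Y i \<omega> * f (increment W h i \<omega>))\<^sup>2)
     (v * (\<Sum>i<n. \<integral>\<omega>. (Y i \<omega>)\<^sup>2 \<partial>M))"
  using Y Y2
proof (induction n)
  case (Suc n)
  let ?s = "real n * h" and ?t = "real (Suc n) * h"
  let ?S = "\<lambda>\<omega>. \<Sum>i<n. Y i \<omega> * f (increment W h i \<omega>)"
  let ?f = "\<lambda>\<omega>. f (increment W h n \<omega>)"
  have st: "0 \<le> ?s" "?s < ?t" and ts: "?t - ?s = h" using h by (auto simp: algebra_simps)
  have Yi: "Y i \<in> borel_measurable (F (ennreal ?s))" if "i < n" for i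
    using that h by (intro measurable_F_mono[OF Suc.prems(1)[of i]]) (auto intro!: ennreal_leI)
  have fi: "(\<lambda>\<omega>. f (increment W h i \<omega>)) \<in> borel_measurable (F (ennreal ?s))" if "i < n" for i
    using increment_measurable_F[of h i n] that h by (intro measurable_compose[OF _ f]) auto
  have S: "?S \<in> borel_measurable (F (ennreal ?s))"
    using Yi fi by (intro borel_measurable_sum borel_measurable_times) auto
  have Yn: "Y n \<in> borel_measurable (F (ennreal ?s))" using Suc.prems(1)[of n] by simp
  have IH: "has_bochner_integral M (\<lambda>\<omega>. (?S \<omega>)\<^sup>2) (v * (\<Sum>i<n. \<integral>\<omega>. (Y i \<omega>)\<^sup>2 \<partial>M))"
    using Suc by simp
  have SY: "integrable M (\<lambda>\<omega>. ?S \<omega> * Y n \<omega>)"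
    using measurable_F[OF S] measurable_F[OF Yn] IH Suc.prems(2)[of n]
    by (intro integrable_mult_L2) (auto simp: has_bochner_integral_iff)
  have 1: "has_bochner_integral M (\<lambda>\<omega>. (?S \<omega> * Y n \<omega>) * ?f \<omega>) (integral\<^sup>L M (\<lambda>\<omega>. ?S \<omega> * Y n \<omega>) * 0)"
    unfolding increment_def[of W h n] 
    by (rule has_bochner_integral_past_increment[OF st _ SY f]) (use S Yn f0 ts in auto)
  have 2: "has_bochner_integral M (\<lambda>\<omega>. (Y n \<omega>)\<^sup>2 * (?f \<omega>)\<^sup>2) (integral\<^sup>L M (\<lambda>\<omega>. (Y n \<omega>)\<^sup>2) * v)"
    unfolding increment_def[of W h n]
    by (rule has_bochner_integral_past_increment[OF st _ Suc.prems(2)[of n], where f="\<lambda>y. (f y)\<^sup>2"])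
      (use Yn f f2 ts in auto)
  have "has_bochner_integral M
      (\<lambda>\<omega>. (?S \<omega>)\<^sup>2 + (2 * ((?S \<omega> * Y n \<omega>) * ?f \<omega>) + (Y n \<omega>)\<^sup>2 * (?f \<omega>)\<^sup>2))
      (v * (\<Sum>i<n. \<integral>\<omega>. (Y i \<omega>)\<^sup>2 \<partial>M) + (2 * (integral\<^sup>L M (\<lambda>\<omega>. ?S \<omega> * Y n \<omega>) * 0)
         + integral\<^sup>L M (\<lambda>\<omega>. (Y n \<omega>)\<^sup>2) * v))"
    by (intro has_bochner_integral_add has_bochner_integral_mult_right IH 1 2)
  then show ?case
    by (simp add: power2_sum power_mult_distrib algebra_simps)
qed (simp add: has_bochner_integral_zero)

end

section \<open>Convergence in probability of increment sums\<close>

text \<open>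
  Convergence to \<open>0\<close> of this quantity is convergence to \<open>0\<close> in probability, in a form that satisfies the triangle
  inequality.
\<close>

definition trunc_mean :: "'a measure \<Rightarrow> ('a \<Rightarrow> real) \<Rightarrow> real" where
  "trunc_mean M Y = (\<integral>\<omega>. min 1 \<bar>Y \<omega>\<bar> \<partial>M)"

context prob_space
begin

lemma integrable_min_one:
  fixes Y :: "'a \<Rightarrow> real"
  assumes "Y \<in> borel_measurable M"
  shows "integrable M (\<lambda>\<omega>. min 1 \<bar>Y \<omega>\<bar>)"
  using assms by (intro integrable_const_bound[where B=1]) auto

lemma trunc_mean_nonneg: "0 \<le> trunc_mean M Y"
  unfolding trunc_mean_def by (intro integral_nonneg_AE) auto

lemma trunc_mean_le_add:
  assumes "X \<in> borel_measurable M" "Y \<in> borel_measurable M" "Z \<in> borel_measurable M"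
    and "AE \<omega> in M. \<bar>X \<omega>\<bar> \<le> \<bar>Y \<omega>\<bar> + \<bar>Z \<omega>\<bar>"
  shows "trunc_mean M X \<le> trunc_mean M Y + trunc_mean M Z"
proof -
  have "trunc_mean M X \<le> (\<integral>\<omega>. min 1 \<bar>Y \<omega>\<bar> + min 1 \<bar>Z \<omega>\<bar> \<partial>M)"
    unfolding trunc_mean_def using assms
    by (intro integral_mono_AE integrable_min_one Bochner_Integration.integrable_add) auto
  also have "\<dots> = trunc_mean M Y + trunc_mean M Z"
    unfolding trunc_mean_def using assms
    by (intro Bochner_Integration.integral_add integrable_min_one)
  finally show ?thesis .
qed

lemma trunc_mean_tendsto_zero:
  assumes "\<And>n. Y n \<in> borel_measurable M" "AE \<omega> in M. (\<lambda>n. Y n \<omega>) \<longlonglongrightarrow> 0"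
  shows "(\<lambda>n. trunc_mean M (Y n)) \<longlonglongrightarrow> 0"
proof -
  have "(\<lambda>n. \<integral>\<omega>. min 1 \<bar>Y n \<omega>\<bar> \<partial>M) \<longlonglongrightarrow> (\<integral>\<omega>. 0 \<partial>M)"
  proof (rule integral_dominated_convergence[where w="\<lambda>_. 1"])
    show "AE \<omega> in M. (\<lambda>n. min 1 \<bar>Y n \<omega>\<bar>) \<longlonglongrightarrow> 0"
      using assms(2)
    proof eventually_elim
      case (elim \<omega>)
      from tendsto_min[OF tendsto_const[of 1] tendsto_rabs_zero[OF elim]] show ?case by simp
    qed
  qed (use assms in auto)
  then show ?thesis by (simp add: trunc_mean_def)
qed

lemma trunc_mean_tendsto_zero_le:
  assumes "\<And>n. trunc_mean M (Y n) \<le> a n" and "a \<longlonglongrightarrow> 0"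
  shows "(\<lambda>n. trunc_mean M (Y n)) \<longlonglongrightarrow> 0"
  by (rule real_tendsto_sandwich[OF _ _ tendsto_const assms(2)])
    (intro always_eventually allI trunc_mean_nonneg assms(1))+

lemma expectation_abs_le_sqrt:
  assumes Y: "Y \<in> borel_measurable M" and Y2: "integrable M (\<lambda>\<omega>. (Y \<omega>)\<^sup>2)"
  shows "(\<integral>\<omega>. \<bar>Y \<omega>\<bar> \<partial>M) \<le> sqrt (\<integral>\<omega>. (Y \<omega>)\<^sup>2 \<partial>M)"
proof -
  have "integrable M (\<lambda>\<omega>. \<bar>Y \<omega>\<bar>)"
    using square_integrable_imp_integrable[OF Y Y2] by simp
  then have "(\<integral>\<omega>. \<bar>Y \<omega>\<bar> \<partial>M)\<^sup>2 \<le> (\<integral>\<omega>. \<bar>Y \<omega>\<bar>\<^sup>2 \<partial>M)"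
    using variance_positive[of "\<lambda>\<omega>. \<bar>Y \<omega>\<bar>"] variance_eq[of "\<lambda>\<omega>. \<bar>Y \<omega>\<bar>"] Y2 by simp
  then show ?thesis by (intro real_le_rsqrt) simp
qed

lemma trunc_mean_le_L1:
  assumes Y: "integrable M Y"
  shows "trunc_mean M Y \<le> (\<integral>\<omega>. \<bar>Y \<omega>\<bar> \<partial>M)"
  unfolding trunc_mean_def using Y by (intro integral_mono integrable_min_one) auto

lemma trunc_mean_le_L2:
  assumes Y: "Y \<in> borel_measurable M" and Y2: "integrable M (\<lambda>\<omega>. (Y \<omega>)\<^sup>2)"
  shows "trunc_mean M Y \<le> sqrt (\<integral>\<omega>. (Y \<omega>)\<^sup>2 \<partial>M)"
  using trunc_mean_le_L1[OF square_integrable_imp_integrable[OF Y Y2]] expectation_abs_le_sqrt[OF Y Y2]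
  by simp

lemma prob_gt_le_trunc_mean:
  assumes Y[measurable]: "Y \<in> borel_measurable M" and "0 < \<epsilon>" "\<epsilon> \<le> 1"
  shows "prob {\<omega> \<in> space M. \<epsilon> < \<bar>Y \<omega>\<bar>} \<le> trunc_mean M Y / \<epsilon>"
proof -
  have "\<epsilon> * prob {\<omega> \<in> space M. \<epsilon> < \<bar>Y \<omega>\<bar>} = (\<integral>\<omega>. \<epsilon> * indicator {\<omega> \<in> space M. \<epsilon> < \<bar>Y \<omega>\<bar>} \<omega> \<partial>M)"
    by simp
  also have "\<dots> \<le> trunc_mean M Y"
    unfolding trunc_mean_def using assms
    by (intro integral_mono integrable_min_one integrable_const_bound[where B=\<epsilon>])
       (auto split: split_indicator)
  finally show ?thesis using assms by (simp add: field_simps)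
qed

lemma trunc_mean_le_prob_gt:
  assumes Y[measurable]: "Y \<in> borel_measurable M" and "0 < \<epsilon>"
  shows "trunc_mean M Y \<le> \<epsilon> + prob {\<omega> \<in> space M. \<epsilon> < \<bar>Y \<omega>\<bar>}"
proof -
  have "trunc_mean M Y \<le> (\<integral>\<omega>. \<epsilon> + indicator {\<omega> \<in> space M. \<epsilon> < \<bar>Y \<omega>\<bar>} \<omega> \<partial>M)"
    unfolding trunc_mean_def using assms
    by (intro integral_mono integrable_min_one integrable_const_bound[where B="\<epsilon> + 1"])
       (auto split: split_indicator)
  also have "\<dots> = \<epsilon> + prob {\<omega> \<in> space M. \<epsilon> < \<bar>Y \<omega>\<bar>}"
    by (subst Bochner_Integration.integral_add) (auto simp: prob_space emeasure_eq_measure)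
  finally show ?thesis .
qed

lemma trunc_mean_tendsto_zeroI:
  assumes Y: "\<And>k. Y k \<in> borel_measurable M"
    and lim: "tendsto_zero_in_prob M Z" and YZ: "\<And>k \<omega>. \<omega> \<in> space M \<Longrightarrow> Z k \<omega> = ennreal \<bar>Y k \<omega>\<bar>"
  shows "(\<lambda>k. trunc_mean M (Y k)) \<longlonglongrightarrow> 0"
proof (rule LIMSEQ_I)
  fix \<epsilon> :: real assume \<epsilon>: "\<epsilon> > 0"
  have "(\<lambda>k. prob {\<omega> \<in> space M. ennreal (\<epsilon> / 2) < Z k \<omega>}) \<longlonglongrightarrow> 0"
    using lim \<epsilon> unfolding tendsto_zero_in_prob_def by simp
  moreover have "{\<omega> \<in> space M. ennreal (\<epsilon> / 2) < Z k \<omega>} = {\<omega> \<in> space M. \<epsilon> / 2 < \<bar>Y k \<omega>\<bar>}" for k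
    using \<epsilon> by (auto simp: YZ ennreal_less_iff)
  ultimately have "(\<lambda>k. prob {\<omega> \<in> space M. \<epsilon> / 2 < \<bar>Y k \<omega>\<bar>}) \<longlonglongrightarrow> 0" by simp
  then obtain n0 where n0: "\<And>k. k \<ge> n0 \<Longrightarrow> prob {\<omega> \<in> space M. \<epsilon> / 2 < \<bar>Y k \<omega>\<bar>} < \<epsilon> / 2"
    using LIMSEQ_D[of "\<lambda>k. prob {\<omega> \<in> space M. \<epsilon> / 2 < \<bar>Y k \<omega>\<bar>}" 0 "\<epsilon> / 2"] \<epsilon>
    by (auto simp: measure_nonneg)
  show "\<exists>n0. \<forall>k\<ge>n0. norm (trunc_mean M (Y k) - 0) < \<epsilon>"
  proof (intro exI[of _ n0] allI impI)
    fix k assume "k \<ge> n0"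
    then show "norm (trunc_mean M (Y k) - 0) < \<epsilon>"
      using n0[of k] trunc_mean_le_prob_gt[OF Y, of "\<epsilon> / 2" k] \<epsilon> trunc_mean_nonneg[of "Y k"] by auto
  qed
qed

end

text \<open>
  Stopping the summation as soon as a partial sum exceeds \<open>N\<close>. Membership of the index \<open>i\<close> is decided by
  the terms up to \<open>i\<close>, so for squared step coefficients the stopped sum has adapted coefficients again.
\<close>

lemma truncated_sum_le:
  fixes a :: "nat \<Rightarrow> real"
  assumes a: "\<And>i. 0 \<le> a i" and N: "0 \<le> N"
  shows "(\<Sum>i<n. a i * of_bool ((\<Sum>j\<le>i. a j) \<le> N)) \<le> N"
proof (induction n)
  case (Suc n)
  show ?case
  proof (cases "(\<Sum>j\<le>n. a j) \<le> N")
    case True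
    have "(\<Sum>i<Suc n. a i * of_bool ((\<Sum>j\<le>i. a j) \<le> N)) \<le> (\<Sum>i<Suc n. a i)"
      using a by (intro sum_mono) auto
    also have "\<dots> = (\<Sum>j\<le>n. a j)" by (simp add: lessThan_Suc_atMost)
    finally show ?thesis using True by simp
  qed (use Suc in simp)
qed (use N in simp)

text \<open>
  The isometry needs square integrable coefficients, whereas here they are merely adapted. Stopping the
  coefficients once the accumulated squares exceed \<open>\<epsilon>\<^sup>2\<close> makes the second moment at most \<open>\<epsilon>\<^sup>2\<close> and
  changes the sum only where the total of the squares exceeds \<open>\<epsilon>\<^sup>2\<close>.
\<close>

lemma (in brownian_motion) trunc_mean_increment_sum_le:
  assumes h: "0 < h"
    and Y: "\<And>i. i < n \<Longrightarrow> Y i \<in> borel_measurable (F (ennreal (real i * h)))"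
    and \<epsilon>: "0 < \<epsilon>" "\<epsilon> \<le> 1"
  shows "trunc_mean M (\<lambda>\<omega>. \<Sum>i<n. Y i \<omega> * increment W h i \<omega>)
    \<le> \<epsilon> + trunc_mean M (\<lambda>\<omega>. \<Sum>i<n. (Y i \<omega>)\<^sup>2 * h) / \<epsilon>\<^sup>2"
proof -
  define N where "N = \<epsilon>\<^sup>2"
  have N: "0 < N" "N \<le> 1" using \<epsilon> by (auto simp: N_def power_le_one)
  define Z where "Z i \<omega> = Y i \<omega> * of_bool ((\<Sum>j\<le>i. (Y j \<omega>)\<^sup>2 * h) \<le> N)" for i \<omega>
  have YM[measurable]: "i < n \<Longrightarrow> Y i \<in> borel_measurable M" for i
    using measurable_F[OF Y] .
  have Z: "Z i \<in> borel_measurable (F (ennreal (real i * h)))" if i: "i < n" for i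
  proof -
    have [measurable]: "Y j \<in> borel_measurable (F (ennreal (real i * h)))" if "j \<le> i" for j
      using that i h by (intro measurable_F_mono[OF Y[of j]]) (auto intro!: ennreal_leI mult_right_mono)
    have [measurable]: "(\<lambda>\<omega>. \<Sum>j\<le>i. (Y j \<omega>)\<^sup>2 * h) \<in> borel_measurable (F (ennreal (real i * h)))"
      by (intro borel_measurable_sum borel_measurable_times) auto
    show ?thesis unfolding Z_def of_bool_def by measurable
  qed
  have Zsum: "(\<Sum>i<n. (Z i \<omega>)\<^sup>2 * h) \<le> N" for \<omega>
  proof -
    have "(Z i \<omega>)\<^sup>2 * h = (Y i \<omega>)\<^sup>2 * h * of_bool ((\<Sum>j\<le>i. (Y j \<omega>)\<^sup>2 * h) \<le> N)" for i
      by (simp add: Z_def)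
    then show ?thesis
      using truncated_sum_le[of "\<lambda>i. (Y i \<omega>)\<^sup>2 * h" N n] h N by (simp only:) simp
  qed
  have Zi: "(Z i \<omega>)\<^sup>2 \<le> N / h" if "i < n" for i \<omega>
  proof -
    have "(Z i \<omega>)\<^sup>2 * h \<le> (\<Sum>i<n. (Z i \<omega>)\<^sup>2 * h)"
      using that h by (intro member_le_sum) auto
    then show ?thesis using Zsum[of \<omega>] h by (simp add: field_simps)
  qed
  have Z2: "integrable M (\<lambda>\<omega>. (Z i \<omega>)\<^sup>2)" if "i < n" for i
    using measurable_F[OF Z[OF that]] Zi[OF that] by (intro integrable_const_bound[where B="N / h"]) auto
  let ?S = "\<lambda>\<omega>. \<Sum>i<n. Z i \<omega> * increment W h i \<omega>"
  let ?T = "\<lambda>\<omega>. \<Sum>i<n. Y i \<omega> * increment W h i \<omega>"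
  let ?Q = "\<lambda>\<omega>. \<Sum>i<n. (Y i \<omega>)\<^sup>2 * h"
  have inc[measurable]: "i < n \<Longrightarrow> increment W h i \<in> borel_measurable M" for i
    using h by (simp add: increment_measurable)
  have SM[measurable]: "?S \<in> borel_measurable M" "?T \<in> borel_measurable M" "?Q \<in> borel_measurable M"
    using measurable_F[OF Z] by (auto intro!: borel_measurable_sum borel_measurable_times)
  have S2: "has_bochner_integral M (\<lambda>\<omega>. (?S \<omega>)\<^sup>2) (h * (\<Sum>i<n. \<integral>\<omega>. (Z i \<omega>)\<^sup>2 \<partial>M))"
    by (rule orthogonal_increment_sum[where f="\<lambda>y. y"])
      (use h Z Z2 has_bochner_integral_normal_id[of "sqrt h"] has_bochner_integral_normal_square[of "sqrt h"] in auto)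
  have "(\<integral>\<omega>. (?S \<omega>)\<^sup>2 \<partial>M) = (\<integral>\<omega>. (\<Sum>i<n. (Z i \<omega>)\<^sup>2 * h) \<partial>M)"
    using S2 Z2 by (simp add: has_bochner_integral_iff sum_distrib_left mult.commute)
  also have "\<dots> \<le> (\<integral>\<omega>. N \<partial>M)"
    using Z2 Zsum by (intro integral_mono) auto
  finally have "(\<integral>\<omega>. (?S \<omega>)\<^sup>2 \<partial>M) \<le> \<epsilon>\<^sup>2" by (simp add: prob_space N_def)
  then have S: "(\<integral>\<omega>. \<bar>?S \<omega>\<bar> \<partial>M) \<le> \<epsilon>"
    using expectation_abs_le_sqrt[of ?S] S2 \<epsilon> real_sqrt_le_mono[of _ "\<epsilon>\<^sup>2"]
    by (fastforce simp: has_bochner_integral_iff)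
  have Sint: "integrable M (\<lambda>\<omega>. \<bar>?S \<omega>\<bar>)"
    using square_integrable_imp_integrable[of ?S] S2 by (auto simp: has_bochner_integral_iff)
  have eq: "?S \<omega> = ?T \<omega>" if "?Q \<omega> \<le> N" for \<omega>
  proof (intro sum.cong refl)
    fix i assume "i \<in> {..<n}"
    then have "(\<Sum>j\<le>i. (Y j \<omega>)\<^sup>2 * h) \<le> ?Q \<omega>"
      using h by (intro sum_mono2) auto
    then show "Z i \<omega> * increment W h i \<omega> = Y i \<omega> * increment W h i \<omega>"
      using that by (auto simp: Z_def)
  qed
  have Qset: "{\<omega> \<in> space M. N < \<bar>?Q \<omega>\<bar>} \<in> sets M" by measurable
  have "trunc_mean M ?T \<le> (\<integral>\<omega>. \<bar>?S \<omega>\<bar> + indicator {\<omega> \<in> space M. N < \<bar>?Q \<omega>\<bar>} \<omega> \<partial>M)"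
    unfolding trunc_mean_def
  proof (intro integral_mono integrable_min_one Bochner_Integration.integrable_add Sint)
    show "integrable M (indicator {\<omega> \<in> space M. N < \<bar>?Q \<omega>\<bar>} :: _ \<Rightarrow> real)"
      using Qset by (simp add: emeasure_eq_measure)
    fix \<omega> assume "\<omega> \<in> space M"
    then show "min 1 \<bar>?T \<omega>\<bar> \<le> \<bar>?S \<omega>\<bar> + indicator {\<omega> \<in> space M. N < \<bar>?Q \<omega>\<bar>} \<omega>"
      using eq[of \<omega>]
      by (cases "?Q \<omega> \<le> N") (auto simp: not_le intro: less_le_trans[OF _ abs_ge_self] add_increasing2 min.coboundedI2)
  qed (simp add: SM)
  also have "\<dots> = (\<integral>\<omega>. \<bar>?S \<omega>\<bar> \<partial>M) + prob {\<omega> \<in> space M. N < \<bar>?Q \<omega>\<bar>}"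
    using Qset Sint by (subst Bochner_Integration.integral_add) (auto simp: emeasure_eq_measure)
  also have "\<dots> \<le> \<epsilon> + trunc_mean M ?Q / N"
    by (intro add_mono S prob_gt_le_trunc_mean SM N)
  finally show ?thesis unfolding N_def .
qed

section \<open>Left-point sums on uniform grids\<close>

lemma mesh_tendsto_zero: "(\<lambda>n. t / Suc n) \<longlonglongrightarrow> (0 :: real)"
  using tendsto_mult[OF tendsto_const[of t] LIMSEQ_inverse_real_of_nat] by (simp add: field_simps)

lemma continuous_on_tendsto_sequence:
  fixes g :: "real \<Rightarrow> real"
  assumes "continuous_on S g" and "\<And>n. f n \<in> S" and "s \<in> S" and "f \<longlonglongrightarrow> s"
  shows "(\<lambda>n. g (f n)) \<longlonglongrightarrow> g s"
  by (rule continuous_on_tendsto_compose[OF assms(1,4,3)]) (simp add: assms(2))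

lemma floor_grid_unique:
  fixes h s :: real
  assumes "0 < h" "real i * h \<le> s" "s < real (Suc i) * h"
  shows "i = nat \<lfloor>s / h\<rfloor>"
proof -
  have "of_int (int i) \<le> s / h" "s / h < of_int (int i) + 1"
    using assms by (auto simp: field_simps)
  then have "\<lfloor>s / h\<rfloor> = int i" by (rule floor_unique)
  then show ?thesis by simp
qed

lemma floor_grid_bounds:
  fixes h s :: real
  assumes "0 < h" "0 \<le> s"
  shows "real (nat \<lfloor>s / h\<rfloor>) * h \<le> s" "s < real (Suc (nat \<lfloor>s / h\<rfloor>)) * h"
proof -
  have k: "real (nat \<lfloor>s / h\<rfloor>) = of_int \<lfloor>s / h\<rfloor>" using assms by simp
  have "of_int \<lfloor>s / h\<rfloor> \<le> s / h" "s / h < of_int \<lfloor>s / h\<rfloor> + 1"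
    by (simp_all add: floor_less_iff)
  then have "of_int \<lfloor>s / h\<rfloor> * h \<le> s" "s < (of_int \<lfloor>s / h\<rfloor> + 1) * h"
    using assms by (simp_all only: pos_le_divide_eq pos_divide_less_eq)
  then show "real (nat \<lfloor>s / h\<rfloor>) * h \<le> s" "s < real (Suc (nat \<lfloor>s / h\<rfloor>)) * h"
    by (simp_all add: k add.commute)
qed

lemma floor_grid_tendsto:
  fixes t s :: real
  assumes t: "0 < t" and s: "0 \<le> s"
  shows "(\<lambda>n. real (nat \<lfloor>s / (t / Suc n)\<rfloor>) * (t / Suc n)) \<longlonglongrightarrow> s"
proof (rule real_tendsto_sandwich)
  have h: "0 < t / Suc n" for n using t by simp
  show "\<forall>\<^sub>F n in sequentially. s - t / Suc n \<le> real (nat \<lfloor>s / (t / Suc n)\<rfloor>) * (t / Suc n)"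
    using floor_grid_bounds(2)[OF h s] by (intro always_eventually allI) (simp add: algebra_simps add_divide_distrib less_imp_le)
  show "\<forall>\<^sub>F n in sequentially. real (nat \<lfloor>s / (t / Suc n)\<rfloor>) * (t / Suc n) \<le> s"
    using floor_grid_bounds(1)[OF h s] by (intro always_eventually allI)
  have "(\<lambda>n. t / Suc n) \<longlonglongrightarrow> 0" by (rule mesh_tendsto_zero)
  from tendsto_diff[OF tendsto_const[of s] this] show "(\<lambda>n. s - t / Suc n) \<longlonglongrightarrow> s" by simp
qed simp

text \<open>
  The sum is the integral of the step function \<open>s \<mapsto> g (h \<lfloor>s / h\<rfloor>)\<close>, which converges to \<open>g\<close> at every point of
  continuity, so dominated convergence applies. Exceptional points are admitted because simple processes jump.
\<close>

lemma left_riemann_sum: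
  fixes g :: "real \<Rightarrow> real"
  assumes t: "0 < t" and g: "(\<lambda>s. indicator {0..t} s * g s) \<in> borel_measurable borel"
    and B: "\<And>s. 0 \<le> s \<Longrightarrow> s \<le> t \<Longrightarrow> \<bar>g s\<bar> \<le> B"
    and D: "finite D" and cont: "\<And>s. 0 \<le> s \<Longrightarrow> s \<le> t \<Longrightarrow> s \<notin> D \<Longrightarrow> continuous (at s within {0..t}) g"
  shows "set_integrable lborel {0..t} g"
    and "(\<lambda>n. \<Sum>i<Suc n. g (real i * (t / Suc n)) * (t / Suc n)) \<longlonglongrightarrow> (LBINT s:{0..t}. g s)"
proof -
  define h where "h n = t / Suc n" for n
  have h: "0 < h n" "real (Suc n) * h n = t" for n using t by (auto simp: h_def)
  define I where "I n i = {real i * h n..<real (Suc i) * h n}" for n i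
  let ?step = "\<lambda>n s. \<Sum>i<Suc n. g (real i * h n) * indicator (I n i) s"
  have Ile: "real i * h n \<le> real (Suc i) * h n" for i n using h[of n] by (simp add: mult_right_mono)
  have step_int: "integrable lborel (?step n)"
    and step_eq: "integral\<^sup>L lborel (?step n) = (\<Sum>i<Suc n. g (real i * h n) * h n)" for n
  proof -
    have i: "integrable lborel (\<lambda>s. g (real i * h n) * indicator (I n i) s)" for i
      unfolding I_def using Ile by (intro integrable_mult_right integrable_real_indicator) auto
    show "integrable lborel (?step n)" by (intro Bochner_Integration.integrable_sum i)
    have "measure lborel (I n i) = h n" for i
      unfolding I_def using Ile[of i n] by (simp add: algebra_simps)
    then have ii: "(\<integral>s. g (real i * h n) * indicator (I n i) s \<partial>lborel) = g (real i * h n) * h n" for i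
      by simp
    show "integral\<^sup>L lborel (?step n) = (\<Sum>i<Suc n. g (real i * h n) * h n)"
      by (subst Bochner_Integration.integral_sum[OF i]) (simp only: ii)
  qed
  have step_val: "?step n s = g (real (nat \<lfloor>s / h n\<rfloor>) * h n)" if s: "0 \<le> s" "s < t" for n s
  proof -
    let ?k = "nat \<lfloor>s / h n\<rfloor>"
    have k: "real ?k * h n \<le> s" "s < real (Suc ?k) * h n"
      using floor_grid_bounds[OF h(1)[of n] s(1)] by auto
    have "real ?k * h n < real (Suc n) * h n" using k(1) s(2) h(2)[of n] by linarith
    then have "real ?k < real (Suc n)" using h(1)[of n] by (metis mult_less_cancel_right_pos)
    then have kn: "?k \<in> {..<Suc n}" by simp
    have "?step n s = (\<Sum>i<Suc n. if i = ?k then g (real i * h n) else 0)"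
    proof (intro sum.cong refl)
      fix i
      have "s \<in> I n i \<longleftrightarrow> i = ?k"
      proof
        assume "s \<in> I n i"
        then show "i = ?k" by (intro floor_grid_unique[OF h(1)[of n]]) (auto simp: I_def)
      next
        assume "i = ?k"
        then show "s \<in> I n i" unfolding I_def using k by simp
      qed
      then show "g (real i * h n) * indicator (I n i) s = (if i = ?k then g (real i * h n) else 0)"
        by (simp add: indicator_def)
    qed
    also have "\<dots> = g (real ?k * h n)"
      using kn by (subst sum.delta) auto
    finally show ?thesis .
  qed
  have step_0: "?step n s = 0" if "s < 0 \<or> t \<le> s" for n s
  proof (intro sum.neutral ballI)
    fix i assume "i \<in> {..<Suc n}"
    then have "real (Suc i) * h n \<le> real (Suc n) * h n" using h(1)[of n] by (intro mult_right_mono) auto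
    then have "real (Suc i) * h n \<le> t" "0 \<le> real i * h n" using h[of n] by auto
    then have "s \<notin> I n i" using that by (auto simp: I_def)
    then show "g (real i * h n) * indicator (I n i) s = 0" by simp
  qed
  have B0: "0 \<le> B" using B[of 0] t by auto
  have bound: "norm (?step n s) \<le> B * indicator {0..t} s" for n s
  proof (cases "0 \<le> s \<and> s < t")
    case True
    have "real (nat \<lfloor>s / h n\<rfloor>) * h n \<le> s" using True h[of n] by (intro floor_grid_bounds) auto
    then show ?thesis using True step_val[of s n] B[of "real (nat \<lfloor>s / h n\<rfloor>) * h n"] h(1)[of n] by simp
  qed (use step_0[of s n] B0 in \<open>auto split: split_indicator\<close>)
  have lim: "(\<lambda>n. ?step n s) \<longlonglongrightarrow> indicator {0..t} s * g s" if sD: "s \<notin> insert t D" for s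
  proof (cases "0 \<le> s \<and> s < t")
    case True
    let ?f = "\<lambda>n. real (nat \<lfloor>s / h n\<rfloor>) * h n"
    have "?f n \<in> {0..t}" for n
      using floor_grid_bounds(1)[OF h(1)[of n], of s] True h(1)[of n] by auto
    then have in_t: "\<forall>\<^sub>F n in sequentially. ?f n \<in> {0..t}" by (intro always_eventually allI)
    have fs: "?f \<longlonglongrightarrow> s" unfolding h_def using floor_grid_tendsto[OF t] True by auto
    have "continuous (at s within {0..t}) g" using cont[of s] sD True by simp
    from continuous_within_tendsto_compose[OF this in_t fs] have "(\<lambda>n. g (?f n)) \<longlonglongrightarrow> g s" .
    moreover have "(\<lambda>n. ?step n s) = (\<lambda>n. g (?f n))"
      by (intro ext step_val) (use True in auto)
    ultimately show ?thesis using True by (simp only:) simp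
  next
    case False
    then have "s < 0 \<or> t \<le> s" "s \<notin> {0..t}" using sD by auto
    then show ?thesis using step_0[of s] by simp
  qed
  have ae: "AE s in lborel. s \<notin> insert t D"
  proof (rule AE_not_in)
    show "insert t D \<in> null_sets lborel" using D finite_imp_null_set_lborel[of "insert t D"] by simp
  qed
  have w: "integrable lborel (\<lambda>s. B * indicator {0..t} s)"
    using t by (intro integrable_mult_right integrable_real_indicator) auto
  have ae': "AE s in lborel. (\<lambda>n. ?step n s) \<longlonglongrightarrow> indicator {0..t} s * g s"
    using ae by eventually_elim (rule lim)
  have gm: "(\<lambda>s. indicator {0..t} s * g s) \<in> borel_measurable lborel" using g by simp
  have bnd: "AE s in lborel. norm (?step n s) \<le> B * indicator {0..t} s" for n
    by (rule AE_I2) (rule bound)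
  have 1: "integrable lborel (\<lambda>s. indicator {0..t} s * g s)"
    by (rule integrable_dominated_convergence[OF gm borel_measurable_integrable[OF step_int] w ae' bnd])
  then show "set_integrable lborel {0..t} g" by (simp add: set_integrable_def)
  have "(\<lambda>n. integral\<^sup>L lborel (?step n)) \<longlonglongrightarrow> (\<integral>s. indicator {0..t} s * g s \<partial>lborel)"
    by (rule integral_dominated_convergence[OF gm borel_measurable_integrable[OF step_int] w ae' bnd])
  moreover have "(\<lambda>n. integral\<^sup>L lborel (?step n)) = (\<lambda>n. \<Sum>i<Suc n. g (real i * h n) * h n)"
    by (rule ext) (rule step_eq)
  ultimately have "(\<lambda>n. \<Sum>i<Suc n. g (real i * h n) * h n) \<longlonglongrightarrow> (\<integral>s. indicator {0..t} s * g s \<partial>lborel)"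
    by (simp only:)
  then show "(\<lambda>n. \<Sum>i<Suc n. g (real i * (t / Suc n)) * (t / Suc n)) \<longlonglongrightarrow> (LBINT s:{0..t}. g s)"
    unfolding h_def set_lebesgue_integral_def real_scaleR_def .
qed

lemma left_riemann_sum_continuous:
  fixes g :: "real \<Rightarrow> real"
  assumes t: "0 < t" and g: "continuous_on {0..t} g"
  shows "set_integrable lborel {0..t} g"
    and "(\<lambda>n. \<Sum>i<Suc n. g (real i * (t / Suc n)) * (t / Suc n)) \<longlonglongrightarrow> (LBINT s:{0..t}. g s)"
proof -
  have "bounded (g ` {0..t})"
    using g by (intro compact_imp_bounded compact_continuous_image) auto
  then obtain B where B: "\<And>s. s \<in> {0..t} \<Longrightarrow> \<bar>g s\<bar> \<le> B"
    by (force simp: bounded_iff)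
  note rs = left_riemann_sum[OF t, of g B "{}"]
  have m: "(\<lambda>s. indicator {0..t} s * g s) \<in> borel_measurable borel"
    using borel_measurable_continuous_on_indicator[OF _ g] by simp
  show "set_integrable lborel {0..t} g"
    by (rule rs(1)) (use m B g in \<open>auto simp: continuous_on_eq_continuous_within\<close>)
  show "(\<lambda>n. \<Sum>i<Suc n. g (real i * (t / Suc n)) * (t / Suc n)) \<longlonglongrightarrow> (LBINT s:{0..t}. g s)"
    by (rule rs(2)) (use m B g in \<open>auto simp: continuous_on_eq_continuous_within\<close>)
qed

text \<open>
  The sum telescopes to the value of \<open>w\<close> at the first grid point after \<open>q\<close>.
\<close>

lemma increment_sum_le_tendsto:
  fixes w :: "real \<Rightarrow> real"
  assumes t: "0 < t" and w: "continuous_on {0..} w" and q: "0 \<le> q"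
  shows "(\<lambda>n. \<Sum>i<Suc n. of_bool (real i * (t / Suc n) \<le> q)
      * (w (real (Suc i) * (t / Suc n)) - w (real i * (t / Suc n)))) \<longlonglongrightarrow> w (min q t) - w 0"
proof -
  define h where "h n = t / Suc n" for n
  have h: "0 < h n" "real (Suc n) * h n = t" for n using t by (auto simp: h_def)
  define m where "m n = Suc (nat \<lfloor>q / h n\<rfloor>)" for n
  have le_iff: "real i * h n \<le> q \<longleftrightarrow> i < m n" for i n
  proof -
    have "real i * h n \<le> q \<longleftrightarrow> real i \<le> q / h n" using h(1)[of n] by (simp add: field_simps)
    also have "\<dots> \<longleftrightarrow> int i \<le> \<lfloor>q / h n\<rfloor>" by (simp add: le_floor_iff)
    also have "\<dots> \<longleftrightarrow> i < m n" using q h(1)[of n] unfolding m_def by (auto simp: less_Suc_eq_le le_nat_iff)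
    finally show ?thesis .
  qed
  have tele: "(\<Sum>i<k. of_bool (i < m) * (w (real (Suc i) * d) - w (real i * d))) = w (real (min k m) * d) - w 0"
    for k m :: nat and d
    by (induction k) (auto simp: min_def not_less dest: le_antisym)
  have lim: "(\<lambda>n. real (min (Suc n) (m n)) * h n) \<longlonglongrightarrow> min q t"
  proof -
    have "(\<lambda>n. t / Suc n) \<longlonglongrightarrow> 0" by (rule mesh_tendsto_zero)
    then have "(\<lambda>n. real (nat \<lfloor>q / h n\<rfloor>) * h n + h n) \<longlonglongrightarrow> q + 0"
      unfolding h_def by (intro tendsto_add floor_grid_tendsto t q)
    then have "(\<lambda>n. min (real (nat \<lfloor>q / h n\<rfloor>) * h n + h n) t) \<longlonglongrightarrow> min q t"
      by (intro tendsto_min tendsto_const) simp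
    moreover have "min (real (nat \<lfloor>q / h n\<rfloor>) * h n + h n) t = real (min (Suc n) (m n)) * h n" for n
    proof -
      have "real (m n) * h n = real (nat \<lfloor>q / h n\<rfloor>) * h n + h n"
        by (simp add: m_def algebra_simps)
      moreover have "real (min (Suc n) (m n)) * h n = min (real (Suc n) * h n) (real (m n) * h n)"
        using h(1)[of n] by (simp add: min_mult_distrib_right of_nat_min del: of_nat_Suc)
      ultimately show ?thesis using h(2)[of n] by (simp add: min.commute del: of_nat_Suc)
    qed
    ultimately show ?thesis by simp
  qed
  have "(\<lambda>n. w (real (min (Suc n) (m n)) * h n)) \<longlonglongrightarrow> w (min q t)"
    by (rule continuous_on_tendsto_sequence[OF w _ _ lim]) (use h(1) q t in \<open>auto simp: less_imp_le\<close>)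
  then have "(\<lambda>n. w (real (min (Suc n) (m n)) * h n) - w 0) \<longlonglongrightarrow> w (min q t) - w 0"
    by (intro tendsto_diff tendsto_const)
  then show ?thesis
    unfolding h_def[symmetric] le_iff tele .
qed

text \<open>
  The indicator of \<open>{p j<..p (Suc j)}\<close> is a difference of two indicators of half-lines; continuity of the path of \<open>W\<close>
  absorbs the grid points that fall short of the partition points.
\<close>

lemma simple_sum_tendsto:
  assumes t: "0 < t" and w: "continuous_on {0..} (\<lambda>s. W s \<omega>)"
    and p: "0 \<le> p 0" "\<And>j. j < m \<Longrightarrow> p j < p (Suc j)"
  shows "(\<lambda>n. \<Sum>i<Suc n. simple_value m p e (real i * (t / Suc n)) \<omega> * increment W (t / Suc n) i \<omega>)
     \<longlonglongrightarrow> simple_integral W m p e t \<omega>"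
proof -
  have p0: "0 \<le> p j" if "j \<le> m" for j
    using that by (induction j) (use p in \<open>auto simp: less_imp_le Suc_le_eq intro: order_trans\<close>)
  let ?d = "\<lambda>n i. increment W (t / Suc n) i \<omega>"
  let ?L = "\<lambda>q n. \<Sum>i<Suc n. of_bool (real i * (t / Suc n) \<le> q) * ?d n i"
  have L: "?L q \<longlonglongrightarrow> W (min q t) \<omega> - W 0 \<omega>" if "0 \<le> q" for q
    using increment_sum_le_tendsto[OF t w that] unfolding increment_def .
  have lim: "(\<lambda>n. \<Sum>j<m. e j \<omega> * (?L (p (Suc j)) n - ?L (p j) n)) \<longlonglongrightarrow>
      (\<Sum>j<m. e j \<omega> * ((W (min (p (Suc j)) t) \<omega> - W 0 \<omega>) - (W (min (p j) t) \<omega> - W 0 \<omega>)))"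
    by (intro tendsto_sum tendsto_mult tendsto_const tendsto_diff L p0) auto
  have eq: "(\<lambda>n. \<Sum>j<m. e j \<omega> * (?L (p (Suc j)) n - ?L (p j) n)) =
      (\<lambda>n. \<Sum>i<Suc n. simple_value m p e (real i * (t / Suc n)) \<omega> * ?d n i)"
  proof
    fix n
    have ind: "indicator {p j<..p (Suc j)} s = (of_bool (s \<le> p (Suc j)) - of_bool (s \<le> p j) :: real)"
      if "j < m" for j s
      using p(2)[OF that] by (auto simp: indicator_def)
    have "(\<Sum>i<Suc n. simple_value m p e (real i * (t / Suc n)) \<omega> * ?d n i)
        = (\<Sum>i<Suc n. \<Sum>j<m. e j \<omega> * ((of_bool (real i * (t / Suc n) \<le> p (Suc j))
            - of_bool (real i * (t / Suc n) \<le> p j)) * ?d n i))"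
      unfolding simple_value_def sum_distrib_right by (intro sum.cong refl) (simp add: ind)
    also have "\<dots> = (\<Sum>j<m. e j \<omega> * (?L (p (Suc j)) n - ?L (p j) n))"
      by (subst sum.swap) (simp add: sum_distrib_left[symmetric] left_diff_distrib sum_subtractf del: sum.lessThan_Suc)
    finally show "(\<Sum>j<m. e j \<omega> * (?L (p (Suc j)) n - ?L (p j) n)) =
      (\<Sum>i<Suc n. simple_value m p e (real i * (t / Suc n)) \<omega> * ?d n i)" by simp
  qed
  show ?thesis
    using lim unfolding eq by (simp add: simple_integral_def del: sum.lessThan_Suc)
qed

section \<open>The Ito integral of a continuous process as a limit of left-point sums\<close>

lemma simple_process_mono:
  assumes "simple_process F m p e"
  shows "0 \<le> p 0" "\<And>j. j < m \<Longrightarrow> p j < p (Suc j)" "\<And>j. j \<le> m \<Longrightarrow> 0 \<le> p j"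
proof -
  show 1: "0 \<le> p 0" "\<And>j. j < m \<Longrightarrow> p j < p (Suc j)"
    using assms by (auto simp: simple_process_def)
  show "0 \<le> p j" if "j \<le> m" for j
    using that
  proof (induction j)
    case (Suc j)
    then show ?case using 1(2)[of j] by simp
  qed (use 1 in simp)
qed

text \<open>
  The pattern for replacing one approximation by another: \<open>k\<close> selects a simple process, \<open>n\<close> a grid,
  and \<open>\<epsilon>\<close> is the level in \<open>trunc_mean_increment_sum_le\<close>. First \<open>\<epsilon>\<close>, then \<open>k\<close>, then \<open>n\<close> is chosen.
\<close>

lemma tendsto_zero_by_double_limit:
  fixes a :: "nat \<Rightarrow> real"
  assumes a: "\<And>n. 0 \<le> a n"
    and le: "\<And>k n \<epsilon>. 0 < \<epsilon> \<Longrightarrow> \<epsilon> \<le> 1 \<Longrightarrow> a n \<le> \<epsilon> + (b k + c k n) / \<epsilon>\<^sup>2 + d k"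
    and b: "b \<longlonglongrightarrow> 0" and d: "d \<longlonglongrightarrow> 0" and c: "\<And>k. c k \<longlonglongrightarrow> (0::real)"
  shows "a \<longlonglongrightarrow> 0"
proof (rule LIMSEQ_I)
  fix \<delta> :: real assume \<delta>: "\<delta> > 0"
  define \<epsilon> where "\<epsilon> = min 1 (\<delta> / 4)"
  have \<epsilon>: "0 < \<epsilon>" "\<epsilon> \<le> 1" "\<epsilon> \<le> \<delta> / 4" using \<delta> by (auto simp: \<epsilon>_def)
  have "(\<lambda>k. b k / \<epsilon>\<^sup>2 + d k) \<longlonglongrightarrow> 0 / \<epsilon>\<^sup>2 + 0"
    by (intro tendsto_add tendsto_divide b d tendsto_const) (use \<epsilon> in auto)
  then obtain k where k: "norm (b k / \<epsilon>\<^sup>2 + d k) < \<delta> / 4"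
    using LIMSEQ_D[of "\<lambda>k. b k / \<epsilon>\<^sup>2 + d k" 0 "\<delta> / 4"] \<delta> by auto
  have "(\<lambda>n. c k n / \<epsilon>\<^sup>2) \<longlonglongrightarrow> 0 / \<epsilon>\<^sup>2"
    by (intro tendsto_divide c tendsto_const) (use \<epsilon> in auto)
  then obtain n0 where n0: "\<And>n. n \<ge> n0 \<Longrightarrow> norm (c k n / \<epsilon>\<^sup>2) < \<delta> / 4"
    using LIMSEQ_D[of "\<lambda>n. c k n / \<epsilon>\<^sup>2" 0 "\<delta> / 4"] \<delta> by auto
  show "\<exists>n0. \<forall>n\<ge>n0. norm (a n - 0) < \<delta>"
  proof (intro exI[of _ n0] allI impI)
    fix n assume "n \<ge> n0"
    then have "c k n / \<epsilon>\<^sup>2 < \<delta> / 4" using n0[of n] by (simp only: real_norm_def abs_less_iff)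
    moreover have "b k / \<epsilon>\<^sup>2 + d k < \<delta> / 4" using k by (simp only: real_norm_def abs_less_iff)
    moreover have "a n \<le> \<epsilon> + (b k / \<epsilon>\<^sup>2 + c k n / \<epsilon>\<^sup>2) + d k"
      using le[OF \<epsilon>(1,2), of n k] by (simp only: add_divide_distrib)
    ultimately have "a n < \<delta>" using \<epsilon>(3) \<delta> by linarith
    then show "norm (a n - 0) < \<delta>" using a[of n] by simp
  qed
qed

context brownian_motion
begin

lemma simple_value_adapted:
  assumes e: "simple_process F m p e" and s: "0 \<le> s"
  shows "simple_value m p e s \<in> borel_measurable (F (ennreal s))"
proof -
  note p = simple_process_mono[OF e]
  have "(\<lambda>\<omega>. e j \<omega> * indicator {p j<..p (Suc j)} s) \<in> borel_measurable (F (ennreal s))" if j: "j < m" for j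
  proof (cases "p j < s")
    case True
    have "e j \<in> borel_measurable (F (ennreal (p j)))"
      using e j by (simp add: simple_process_def)
    then have "e j \<in> borel_measurable (F (ennreal s))"
      by (rule measurable_F_mono) (use True in \<open>auto intro: ennreal_leI\<close>)
    then show ?thesis by auto
  qed auto
  then have "(\<lambda>\<omega>. \<Sum>j<m. e j \<omega> * indicator {p j<..p (Suc j)} s) \<in> borel_measurable (F (ennreal s))"
    by (intro borel_measurable_sum) auto
  moreover have "simple_value m p e s = (\<lambda>\<omega>. \<Sum>j<m. e j \<omega> * indicator {p j<..p (Suc j)} s)"
    by (simp add: simple_value_def fun_eq_iff)
  ultimately show ?thesis by simp
qed

text \<open>
  The integral that measures the quality of a simple approximation is itself a limit of left-point sums;
  this also provides its measurability in \<open>\<omega>\<close>.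
\<close>

lemma simple_square_sum_tendsto:
  fixes H :: "real \<Rightarrow> 'a \<Rightarrow> real" and m :: nat and p :: "nat \<Rightarrow> real" and e :: "nat \<Rightarrow> 'a \<Rightarrow> real"
  assumes t: "0 < t" and H: "continuous_on {0..t} (\<lambda>s. H s \<omega>)"
  defines "g \<equiv> \<lambda>s. (simple_value m p e s \<omega> - H s \<omega>)\<^sup>2"
  shows "(\<lambda>n. \<Sum>i<Suc n. g (real i * (t / Suc n)) * (t / Suc n)) \<longlonglongrightarrow> (LBINT s:{0..t}. g s)"
    and "(\<integral>\<^sup>+s\<in>{0..t}. ennreal (g s) \<partial>lborel) = ennreal (LBINT s:{0..t}. g s)"
proof -
  let ?v = "\<lambda>s. simple_value m p e s \<omega>"
  have "bounded ((\<lambda>s. H s \<omega>) ` {0..t})"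
    using H by (intro compact_imp_bounded compact_continuous_image) auto
  then obtain B where B: "\<And>s. s \<in> {0..t} \<Longrightarrow> \<bar>H s \<omega>\<bar> \<le> B"
    by (force simp: bounded_iff)
  define C where "C = (\<Sum>j<m. \<bar>e j \<omega>\<bar>)"
  have vC: "\<bar>?v s\<bar> \<le> C" for s
    unfolding simple_value_def C_def
    by (intro order_trans[OF sum_abs] sum_mono) (auto split: split_indicator)
  have gB: "\<bar>g s\<bar> \<le> (C + B)\<^sup>2" if "0 \<le> s" "s \<le> t" for s
  proof -
    have "\<bar>?v s - H s \<omega>\<bar> \<le> \<bar>C + B\<bar>" using vC[of s] B[of s] that by auto
    then show ?thesis unfolding g_def by (simp only: abs_power2 abs_le_square_iff)
  qed
  have vm: "?v \<in> borel_measurable borel"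
    unfolding simple_value_def by measurable
  have Hm: "(\<lambda>s. indicator {0..t} s * H s \<omega>) \<in> borel_measurable borel"
    using borel_measurable_continuous_on_indicator[OF _ H] by simp
  have "(\<lambda>s. indicator {0..t} s * (?v s - indicator {0..t} s * H s \<omega>)\<^sup>2) \<in> borel_measurable borel"
    using vm Hm by measurable
  also have "(\<lambda>s. indicator {0..t} s * (?v s - indicator {0..t} s * H s \<omega>)\<^sup>2) = (\<lambda>s. indicator {0..t} s * g s)"
    by (auto simp: g_def indicator_def)
  finally have gm: "(\<lambda>s. indicator {0..t} s * g s) \<in> borel_measurable borel" .
  have cont: "continuous (at s within {0..t}) g" if s: "0 \<le> s" "s \<le> t" "s \<notin> p ` {..m}" for s
  proof -
    have "continuous (at s) (\<lambda>s. indicator {p j<..p (Suc j)} s :: real)" if "j < m" for j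
    proof (cases "p j < p (Suc j)")
      case True
      have "{p j<..<p (Suc j)} \<subseteq> interior {p j<..p (Suc j)}"
        by (rule interior_maximal) auto
      moreover have "s \<noteq> p j" "s \<noteq> p (Suc j)" using s(3) that by auto
      ultimately show ?thesis
        using True unfolding isCont_indicator frontier_def by auto
    qed simp
    then have "continuous (at s) ?v"
      unfolding simple_value_def by (intro continuous_intros) auto
    then have "continuous (at s within {0..t}) ?v" by (rule continuous_at_imp_continuous_at_within)
    then show ?thesis unfolding g_def
      using H s by (intro continuous_intros) (auto simp: continuous_on_eq_continuous_within)
  qed
  note rs = left_riemann_sum[OF t gm gB _ cont]
  show "(\<lambda>n. \<Sum>i<Suc n. g (real i * (t / Suc n)) * (t / Suc n)) \<longlonglongrightarrow> (LBINT s:{0..t}. g s)"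
    by (rule rs(2)) auto
  have "set_integrable lborel {0..t} g" by (rule rs(1)) auto
  then have "(\<integral>\<^sup>+s. ennreal (indicator {0..t} s * g s) \<partial>lborel) = ennreal (\<integral>s. indicator {0..t} s * g s \<partial>lborel)"
    by (intro nn_integral_eq_integral) (auto simp: set_integrable_def g_def)
  moreover have "ennreal (indicator {0..t} s * g s) = ennreal (g s) * indicator {0..t} s" for s
    by (auto split: split_indicator)
  ultimately show "(\<integral>\<^sup>+s\<in>{0..t}. ennreal (g s) \<partial>lborel) = ennreal (LBINT s:{0..t}. g s)"
    by (simp add: set_lebesgue_integral_def)
qed

text \<open>
  The approximating simple processes \<open>e k\<close> and their partitions are given by the definition and unrelated
  to the grid. For fixed \<open>k\<close> the left-point sum of \<open>e k\<close> tends to its integral, and the left-point sum of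
  the difference \<open>e k - H\<close> is controlled by its squares, whose sum tends to the integral of \<open>(e k - H)\<^sup>2\<close>.
\<close>

theorem ito_integral_left_sums:
  assumes t: "0 < t" and I: "has_ito_integral M F W H I"
    and H: "\<And>s. 0 \<le> s \<Longrightarrow> H s \<in> borel_measurable (F (ennreal s))"
    and Hc: "\<And>\<omega>. \<omega> \<in> space M \<Longrightarrow> continuous_on {0..} (\<lambda>s. H s \<omega>)"
  shows "(\<lambda>n. trunc_mean M (\<lambda>\<omega>.
      (\<Sum>i<Suc n. H (real i * (t / Suc n)) \<omega> * increment W (t / Suc n) i \<omega>) - I t \<omega>)) \<longlonglongrightarrow> 0"
proof -
  from I obtain m p e where e: "\<And>k. simple_process F (m k) (p k) (e k)"
    and lims: "\<forall>t\<ge>0. tendsto_zero_in_prob M (\<lambda>k \<omega>.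
           \<integral>\<^sup>+s\<in>{0..t}. ennreal ((simple_value (m k) (p k) (e k) s \<omega> - H s \<omega>)\<^sup>2) \<partial>lborel) \<and>
         tendsto_zero_in_prob M (\<lambda>k \<omega>.
           ennreal \<bar>simple_integral W (m k) (p k) (e k) t \<omega> - I t \<omega>\<bar>)"
    unfolding has_ito_integral_def by blast
  have Q0: "tendsto_zero_in_prob M (\<lambda>k \<omega>.
           \<integral>\<^sup>+s\<in>{0..t}. ennreal ((simple_value (m k) (p k) (e k) s \<omega> - H s \<omega>)\<^sup>2) \<partial>lborel)"
    and J0: "tendsto_zero_in_prob M (\<lambda>k \<omega>.
           ennreal \<bar>simple_integral W (m k) (p k) (e k) t \<omega> - I t \<omega>\<bar>)"
    using lims t by auto
  have IF: "I t \<in> borel_measurable (F (ennreal t))"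
    using I t unfolding has_ito_integral_def by auto
  have IM[measurable]: "I t \<in> borel_measurable M" using measurable_F[OF IF] .
  define h where "h n = t / Suc n" for n
  have h: "0 < h n" for n using t by (simp add: h_def)
  let ?v = "\<lambda>k. simple_value (m k) (p k) (e k)"
  define S where "S n \<omega> = (\<Sum>i<Suc n. H (real i * h n) \<omega> * increment W (h n) i \<omega>)" for n \<omega>
  define V where "V k n \<omega> = (\<Sum>i<Suc n. ?v k (real i * h n) \<omega> * increment W (h n) i \<omega>)" for k n \<omega>
  define J where "J k \<omega> = simple_integral W (m k) (p k) (e k) t \<omega>" for k \<omega>
  define Q where "Q k n \<omega> = (\<Sum>i<Suc n. (?v k (real i * h n) \<omega> - H (real i * h n) \<omega>)\<^sup>2 * h n)" for k n \<omega>
  define q where "q k \<omega> = (LBINT s:{0..t}. (?v k s \<omega> - H s \<omega>)\<^sup>2)" for k \<omega>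
  have HM: "H (real i * h n) \<in> borel_measurable M" for i n
    using h[of n] by (intro measurable_F[OF H]) auto
  have vM: "?v k (real i * h n) \<in> borel_measurable M" for k i n
    using h[of n] by (intro measurable_F[OF simple_value_adapted[OF e]]) auto
  have incM: "increment W (h n) i \<in> borel_measurable M" for n i
    using h(1)[of n] by (simp add: increment_measurable)
  have SM[measurable]: "S n \<in> borel_measurable M" for n
    unfolding S_def using HM incM by (intro borel_measurable_sum borel_measurable_times)
  have VM[measurable]: "V k n \<in> borel_measurable M" for k n
    unfolding V_def using vM incM by (intro borel_measurable_sum borel_measurable_times)
  have QM[measurable]: "Q k n \<in> borel_measurable M" for k n
    unfolding Q_def using HM vM
    by (intro borel_measurable_sum borel_measurable_times borel_measurable_power borel_measurable_diff) auto
  have cont: "continuous_on {0..t} (\<lambda>s. H s \<omega>)" if "\<omega> \<in> space M" for \<omega>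
    using Hc[OF that] by (rule continuous_on_subset) auto
  have Vlim: "(\<lambda>n. V k n \<omega>) \<longlonglongrightarrow> J k \<omega>" if "\<omega> \<in> space M" for k \<omega>
    unfolding V_def J_def h_def
    by (rule simple_sum_tendsto[where W=W and \<omega>=\<omega>, OF t W_continuous[OF that]]) (use simple_process_mono[OF e] in auto)
  have Qlim: "(\<lambda>n. Q k n \<omega>) \<longlonglongrightarrow> q k \<omega>" if "\<omega> \<in> space M" for k \<omega>
    unfolding Q_def q_def h_def 
    by (rule simple_square_sum_tendsto(1)[where H=H and \<omega>=\<omega>, OF t cont[OF that]])
  have JM[measurable]: "J k \<in> borel_measurable M" for k
    by (rule borel_measurable_LIMSEQ_real[OF Vlim VM])
  have qM[measurable]: "q k \<in> borel_measurable M" for k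
    by (rule borel_measurable_LIMSEQ_real[OF Qlim QM])
  have q0: "0 \<le> q k \<omega>" for k \<omega>
    unfolding q_def set_lebesgue_integral_def by (intro integral_nonneg_AE) auto
  have b: "(\<lambda>k. trunc_mean M (q k)) \<longlonglongrightarrow> 0"
    by (rule trunc_mean_tendsto_zeroI[OF qM Q0])
      (use simple_square_sum_tendsto(2)[where H=H, OF t cont] q0 in \<open>simp add: q_def\<close>)
  have d: "(\<lambda>k. trunc_mean M (\<lambda>\<omega>. J k \<omega> - I t \<omega>)) \<longlonglongrightarrow> 0"
    by (rule trunc_mean_tendsto_zeroI[OF _ J0]) (auto simp: J_def[symmetric])
  have c1: "(\<lambda>n. trunc_mean M (\<lambda>\<omega>. Q k n \<omega> - q k \<omega>)) \<longlonglongrightarrow> 0" for k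
    using Qlim by (intro trunc_mean_tendsto_zero) (auto intro!: AE_I2 simp: LIM_zero)
  have c2: "(\<lambda>n. trunc_mean M (\<lambda>\<omega>. V k n \<omega> - J k \<omega>)) \<longlonglongrightarrow> 0" for k
    using Vlim by (intro trunc_mean_tendsto_zero) (auto intro!: AE_I2 simp: LIM_zero)
  have "(\<lambda>n. trunc_mean M (\<lambda>\<omega>. S n \<omega> - I t \<omega>)) \<longlonglongrightarrow> 0"
  proof (rule tendsto_zero_by_double_limit[OF trunc_mean_nonneg _ b d])
    show "(\<lambda>n. trunc_mean M (\<lambda>\<omega>. Q k n \<omega> - q k \<omega>) + trunc_mean M (\<lambda>\<omega>. V k n \<omega> - J k \<omega>)) \<longlonglongrightarrow> 0" for k
      using tendsto_add[OF c1 c2] by simp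
    fix k n and \<epsilon> :: real assume \<epsilon>: "0 < \<epsilon>" "\<epsilon> \<le> 1"
    let ?m = "trunc_mean M"
    have "?m (\<lambda>\<omega>. S n \<omega> - I t \<omega>) \<le> ?m (\<lambda>\<omega>. V k n \<omega> - S n \<omega>) + ?m (\<lambda>\<omega>. V k n \<omega> - I t \<omega>)"
      by (rule trunc_mean_le_add) auto
    also have "?m (\<lambda>\<omega>. V k n \<omega> - I t \<omega>) \<le> ?m (\<lambda>\<omega>. V k n \<omega> - J k \<omega>) + ?m (\<lambda>\<omega>. J k \<omega> - I t \<omega>)"
      by (rule trunc_mean_le_add) auto
    also have "?m (\<lambda>\<omega>. V k n \<omega> - S n \<omega>) \<le> \<epsilon> + ?m (Q k n) / \<epsilon>\<^sup>2"
    proof -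
      have "?m (\<lambda>\<omega>. \<Sum>i<Suc n. (?v k (real i * h n) \<omega> - H (real i * h n) \<omega>) * increment W (h n) i \<omega>)
          \<le> \<epsilon> + ?m (\<lambda>\<omega>. \<Sum>i<Suc n. (?v k (real i * h n) \<omega> - H (real i * h n) \<omega>)\<^sup>2 * h n) / \<epsilon>\<^sup>2"
        using h[of n] \<epsilon>
        by (intro trunc_mean_increment_sum_le borel_measurable_diff H simple_value_adapted[OF e]) auto
      then show ?thesis
        unfolding Q_def S_def V_def
        by (simp only: left_diff_distrib sum_subtractf)
    qed
    also have "?m (Q k n) \<le> ?m (q k) + ?m (\<lambda>\<omega>. Q k n \<omega> - q k \<omega>)"
      by (rule trunc_mean_le_add) auto
    also have "\<epsilon> + (?m (q k) + ?m (\<lambda>\<omega>. Q k n \<omega> - q k \<omega>)) / \<epsilon>\<^sup>2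
        + (?m (\<lambda>\<omega>. V k n \<omega> - J k \<omega>) + ?m (\<lambda>\<omega>. J k \<omega> - I t \<omega>))
        \<le> \<epsilon> + (?m (q k) + (?m (\<lambda>\<omega>. Q k n \<omega> - q k \<omega>) + ?m (\<lambda>\<omega>. V k n \<omega> - J k \<omega>))) / \<epsilon>\<^sup>2
          + ?m (\<lambda>\<omega>. J k \<omega> - I t \<omega>)"
    proof -
      have "\<epsilon>\<^sup>2 \<le> 1" "0 < \<epsilon>\<^sup>2" using \<epsilon> by (auto simp: power_le_one)
      then have "x \<le> x / \<epsilon>\<^sup>2" if "0 \<le> x" for x
        using that by (simp add: pos_le_divide_eq mult_left_le)
      from this[OF trunc_mean_nonneg[of "\<lambda>\<omega>. V k n \<omega> - J k \<omega>"]] show ?thesis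
        by (simp add: add_divide_distrib)
    qed
    finally show "?m (\<lambda>\<omega>. S n \<omega> - I t \<omega>) \<le> \<epsilon> + (?m (q k) +
        (?m (\<lambda>\<omega>. Q k n \<omega> - q k \<omega>) + ?m (\<lambda>\<omega>. V k n \<omega> - J k \<omega>))) / \<epsilon>\<^sup>2 + ?m (\<lambda>\<omega>. J k \<omega> - I t \<omega>)"
      using \<epsilon> by (simp add: divide_right_mono)
  qed
  then show ?thesis unfolding S_def h_def .
qed

end

section \<open>The exponential of Brownian motion solves the linear equation\<close>

definition geometric_path :: "(real \<Rightarrow> 'a \<Rightarrow> real) \<Rightarrow> real \<Rightarrow> real \<Rightarrow> real \<Rightarrow> real \<Rightarrow> 'a \<Rightarrow> real" where
  "geometric_path W \<alpha> \<sigma> x t \<omega> = x * exp ((\<alpha> - \<sigma>\<^sup>2 / 2) * t + \<sigma> * W t \<omega>)"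

text \<open>
  The relative error of one Euler step of size \<open>h\<close> for the exponential, with the mean
  \<open>exp (\<alpha> h) - 1 - \<alpha> h\<close> subtracted, in terms of the increment \<open>y\<close> of \<open>W\<close>.
\<close>

lemma euler_defect_moments:
  fixes \<alpha> \<sigma> h :: real
  assumes h: "0 < h"
  defines "f \<equiv> \<lambda>y. exp ((\<alpha> - \<sigma>\<^sup>2 / 2) * h + \<sigma> * y) - exp (\<alpha> * h) - \<sigma> * y"
  shows "has_bochner_integral lborel (\<lambda>y. normal_density 0 (sqrt h) y * f y) 0" (is ?A)
    and "has_bochner_integral lborel (\<lambda>y. normal_density 0 (sqrt h) y * (f y)\<^sup>2)
      (exp ((2 * \<alpha> + \<sigma>\<^sup>2) * h) - exp (2 * \<alpha> * h) + \<sigma>\<^sup>2 * h - 2 * \<sigma>\<^sup>2 * h * exp (\<alpha> * h))" (is ?B)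
proof -
  let ?N = "normal_density 0 (sqrt h)"
  let ?c = "exp ((\<alpha> - \<sigma>\<^sup>2 / 2) * h)" and ?d = "exp (\<alpha> * h)"
  have sh: "0 < sqrt h" using h by simp
  have one: "has_bochner_integral lborel ?N 1"
    using has_bochner_integral_normal_exp[OF sh, of 0] by simp
  note e = has_bochner_integral_normal_exp[OF sh] and ye = has_bochner_integral_normal_id_exp[OF sh]
    and y = has_bochner_integral_normal_id[OF sh] and y2 = has_bochner_integral_normal_square[OF sh]
  have c: "?c * exp (\<sigma>\<^sup>2 * (sqrt h)\<^sup>2 / 2) = ?d"
    using h by (simp add: exp_add[symmetric] algebra_simps)
  have c2: "?c\<^sup>2 * exp ((2 * \<sigma>)\<^sup>2 * (sqrt h)\<^sup>2 / 2) = exp ((2 * \<alpha> + \<sigma>\<^sup>2) * h)"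
    using h by (simp add: exp_add[symmetric] exp_double[symmetric] algebra_simps power_mult_distrib)
  have d2: "?d\<^sup>2 = exp (2 * \<alpha> * h)"
    by (simp add: exp_double[symmetric] ac_simps)
  have ex: "exp ((\<alpha> - \<sigma>\<^sup>2 / 2) * h + \<sigma> * y) = ?c * exp (\<sigma> * y)" for y
    by (simp add: exp_add)
  have ey2: "(exp (\<sigma> * y))\<^sup>2 = exp (2 * \<sigma> * y)" for y
    by (simp add: exp_double[symmetric] ac_simps)
  have "has_bochner_integral lborel
      (\<lambda>y. ?c * (?N y * exp (\<sigma> * y)) - ?d * ?N y - \<sigma> * (?N y * y))
      (?c * exp (\<sigma>\<^sup>2 * (sqrt h)\<^sup>2 / 2) - ?d * 1 - \<sigma> * 0)"
    by (intro has_bochner_integral_diff has_bochner_integral_mult_right e one y)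
  moreover have "?c * (?N y * exp (\<sigma> * y)) - ?d * ?N y - \<sigma> * (?N y * y) = ?N y * f y" for y
    unfolding f_def ex by (simp add: algebra_simps)
  ultimately show ?A using c by simp
  have "has_bochner_integral lborel
      (\<lambda>y. (((?c\<^sup>2 * (?N y * exp (2 * \<sigma> * y)) + ?d\<^sup>2 * ?N y + \<sigma>\<^sup>2 * (?N y * y\<^sup>2))
          - 2 * ?d * ?c * (?N y * exp (\<sigma> * y))) - 2 * \<sigma> * ?c * (?N y * (y * exp (\<sigma> * y))))
          + 2 * ?d * \<sigma> * (?N y * y))
      ((((?c\<^sup>2 * exp ((2 * \<sigma>)\<^sup>2 * (sqrt h)\<^sup>2 / 2) + ?d\<^sup>2 * 1 + \<sigma>\<^sup>2 * (sqrt h)\<^sup>2)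
          - 2 * ?d * ?c * exp (\<sigma>\<^sup>2 * (sqrt h)\<^sup>2 / 2))
          - 2 * \<sigma> * ?c * (\<sigma> * (sqrt h)\<^sup>2 * exp (\<sigma>\<^sup>2 * (sqrt h)\<^sup>2 / 2))) + 2 * ?d * \<sigma> * 0)" (is "has_bochner_integral _ _ ?v")
    by (intro has_bochner_integral_diff has_bochner_integral_add has_bochner_integral_mult_right e one y ye y2)
  moreover have "((?c\<^sup>2 * (?N y * exp (2 * \<sigma> * y)) + ?d\<^sup>2 * ?N y + \<sigma>\<^sup>2 * (?N y * y\<^sup>2))
          - 2 * ?d * ?c * (?N y * exp (\<sigma> * y))) - 2 * \<sigma> * ?c * (?N y * (y * exp (\<sigma> * y)))
          + 2 * ?d * \<sigma> * (?N y * y) = ?N y * (f y)\<^sup>2" for y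
    unfolding f_def ex ey2[symmetric] by (simp add: algebra_simps power2_eq_square)
  moreover have "?v = exp ((2 * \<alpha> + \<sigma>\<^sup>2) * h) - exp (2 * \<alpha> * h) + \<sigma>\<^sup>2 * h - 2 * \<sigma>\<^sup>2 * h * exp (\<alpha> * h)"
  proof -
    have k1: "2 * ?d * ?c * exp (\<sigma>\<^sup>2 * (sqrt h)\<^sup>2 / 2) = 2 * ?d\<^sup>2"
      using c by (simp add: power2_eq_square)
    have k2: "2 * \<sigma> * ?c * (\<sigma> * (sqrt h)\<^sup>2 * exp (\<sigma>\<^sup>2 * (sqrt h)\<^sup>2 / 2)) = 2 * \<sigma>\<^sup>2 * h * ?d"
      using c h by (simp add: power2_eq_square)
    show ?thesis unfolding c2 k1 k2 using h by (simp add: d2)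
  qed
  ultimately show ?B by simp
qed

text \<open>
  Mean and variance of the defect are functions of \<open>h\<close> that vanish at \<open>0\<close> together with their derivatives; for the variance
  this uses \<open>(2 \<alpha> + \<sigma>\<^sup>2) - 2 \<alpha> + \<sigma>\<^sup>2 - 2 \<sigma>\<^sup>2 = 0\<close>. So the \<open>n\<close> steps of size \<open>t / n\<close> accumulate nothing.
\<close>

lemma euler_defect_small:
  fixes \<alpha> \<sigma> t :: real
  assumes t: "0 < t"
  shows "(\<lambda>n. real (Suc n) * (exp (\<alpha> * (t / Suc n)) - 1 - \<alpha> * (t / Suc n))) \<longlonglongrightarrow> 0" (is ?A)
    and "(\<lambda>n. real (Suc n) * (exp ((2 * \<alpha> + \<sigma>\<^sup>2) * (t / Suc n)) - exp (2 * \<alpha> * (t / Suc n))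
       + \<sigma>\<^sup>2 * (t / Suc n) - 2 * \<sigma>\<^sup>2 * (t / Suc n) * exp (\<alpha> * (t / Suc n)))) \<longlonglongrightarrow> 0" (is ?B)
proof -
  have "(\<lambda>n. t / Suc n) \<longlonglongrightarrow> 0" by (rule mesh_tendsto_zero)
  then have h0: "filterlim (\<lambda>n. t / Suc n) (at 0) sequentially"
    using t by (simp add: filterlim_at)
  have *: "(\<lambda>n. real (Suc n) * f (t / Suc n)) \<longlonglongrightarrow> 0"
    if f0: "f 0 = 0" and f': "(f has_real_derivative 0) (at 0)" for f :: "real \<Rightarrow> real"
  proof -
    have "((\<lambda>h. f h / h) \<longlongrightarrow> 0) (at 0)"
      using f' f0 by (simp add: has_field_derivative_iff)
    then have "(\<lambda>n. f (t / Suc n) / (t / Suc n)) \<longlonglongrightarrow> 0"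
      using h0 by (rule filterlim_compose)
    then have "(\<lambda>n. t * (f (t / Suc n) / (t / Suc n))) \<longlonglongrightarrow> t * 0"
      by (intro tendsto_mult tendsto_const)
    moreover have "t * (f (t / Suc n) / (t / Suc n)) = real (Suc n) * f (t / Suc n)" for n
      using t by (simp add: field_simps)
    ultimately show ?thesis by simp
  qed
  show ?A
    by (rule *[of "\<lambda>h. exp (\<alpha> * h) - 1 - \<alpha> * h"]) (auto intro!: derivative_eq_intros)
  show ?B
    by (rule *[of "\<lambda>h. exp ((2 * \<alpha> + \<sigma>\<^sup>2) * h) - exp (2 * \<alpha> * h) + \<sigma>\<^sup>2 * h - 2 * \<sigma>\<^sup>2 * h * exp (\<alpha> * h)"])
      (auto intro!: derivative_eq_intros)
qed

context brownian_motion
begin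

lemma has_bochner_integral_exp_W:
  assumes t: "0 \<le> t"
  shows "has_bochner_integral M (\<lambda>\<omega>. exp (a * W t \<omega>)) (exp (a\<^sup>2 * t / 2))"
proof (cases "t = 0")
  case True
  have "has_bochner_integral M (\<lambda>\<omega>. 1 :: real) 1"
    using prob_space by (simp add: has_bochner_integral_iff)
  then show ?thesis
    using W_0 W_measurable[of 0] True
    by (subst has_bochner_integral_cong_AE[where g="\<lambda>_. 1"]) auto
next
  case False
  then have t: "0 < t" using t by simp
  have "has_bochner_integral M (\<lambda>\<omega>. exp (a * (W t \<omega> - W 0 \<omega>))) (exp (a\<^sup>2 * (sqrt t)\<^sup>2 / 2))"
    by (rule has_bochner_integral_increment[where f="\<lambda>y. exp (a * y)"])
      (use t has_bochner_integral_normal_exp[of "sqrt t" a] in auto)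
  then show ?thesis
    using W_0 W_measurable[of 0] W_measurable[of t] t
    by (subst has_bochner_integral_cong_AE[where g="\<lambda>\<omega>. exp (a * (W t \<omega> - W 0 \<omega>))"]) auto
qed

lemma has_bochner_integral_geometric_path_square:
  assumes "0 \<le> t"
  shows "has_bochner_integral M (\<lambda>\<omega>. (geometric_path W \<alpha> \<sigma> x t \<omega>)\<^sup>2) (x\<^sup>2 * exp ((2 * \<alpha> + \<sigma>\<^sup>2) * t))"
proof -
  have "has_bochner_integral M
      (\<lambda>\<omega>. (x\<^sup>2 * exp ((2 * \<alpha> - \<sigma>\<^sup>2) * t)) * exp ((2 * \<sigma>) * W t \<omega>))
      ((x\<^sup>2 * exp ((2 * \<alpha> - \<sigma>\<^sup>2) * t)) * exp ((2 * \<sigma>)\<^sup>2 * t / 2))"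
    by (intro has_bochner_integral_mult_right has_bochner_integral_exp_W assms)
  then show ?thesis
    by (simp add: geometric_path_def power_mult_distrib exp_double[symmetric] exp_add[symmetric]
      mult.assoc algebra_simps)
qed

lemma geometric_path_adapted:
  assumes "0 \<le> s"
  shows "geometric_path W \<alpha> \<sigma> x s \<in> borel_measurable (F (ennreal s))"
  using W_adapted[OF assms] unfolding geometric_path_def by measurable

text \<open>
  The defects of the single steps split into centred parts, which are orthogonal and add up in square mean,
  and their means, which add up absolutely.
\<close>

theorem geometric_path_left_sums:
  fixes \<alpha> \<sigma> x t :: real
  assumes t: "0 < t"
  defines "Z \<equiv> geometric_path W \<alpha> \<sigma> x"
  shows "(\<lambda>n. trunc_mean M (\<lambda>\<omega>. Z t \<omega> - Z 0 \<omega>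
      - (\<Sum>i<Suc n. Z (real i * (t / Suc n)) \<omega> * (\<alpha> * (t / Suc n) + \<sigma> * increment W (t / Suc n) i \<omega>)))) \<longlonglongrightarrow> 0"
proof -
  define h where "h n = t / Suc n" for n
  have h: "0 < h n" "real (Suc n) * h n = t" for n using t by (auto simp: h_def)
  define c where "c n = exp (\<alpha> * h n) - 1 - \<alpha> * h n" for n
  define v where "v n = exp ((2 * \<alpha> + \<sigma>\<^sup>2) * h n) - exp (2 * \<alpha> * h n) + \<sigma>\<^sup>2 * h n
      - 2 * \<sigma>\<^sup>2 * h n * exp (\<alpha> * h n)" for n
  define f where "f n y = exp ((\<alpha> - \<sigma>\<^sup>2 / 2) * h n + \<sigma> * y) - exp (\<alpha> * h n) - \<sigma> * y" for n y
  have f_moments: "has_bochner_integral lborel (\<lambda>y. normal_density 0 (sqrt (h n)) y * f n y) 0"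
    "has_bochner_integral lborel (\<lambda>y. normal_density 0 (sqrt (h n)) y * (f n y)\<^sup>2) (v n)" for n
    unfolding f_def v_def by (rule euler_defect_moments[OF h(1)])+
  define K where "K = x\<^sup>2 * exp (\<bar>2 * \<alpha> + \<sigma>\<^sup>2\<bar> * t)"
  have K0: "0 \<le> K" by (simp add: K_def)
  have grid: "0 \<le> real i * h n" "i < Suc n \<Longrightarrow> real i * h n \<le> t" for i n
  proof -
    show "0 \<le> real i * h n" using h(1)[of n] by simp
    assume "i < Suc n"
    then have "real i * h n \<le> real (Suc n) * h n" using h(1)[of n] by (intro mult_right_mono) auto
    then show "real i * h n \<le> t" using h(2)[of n] by simp
  qed
  have ZF: "Z (real i * h n) \<in> borel_measurable (F (ennreal (real i * h n)))" for i n
    unfolding Z_def by (rule geometric_path_adapted[OF grid(1)])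
  have ZM[measurable]: "Z s \<in> borel_measurable M" if "0 \<le> s" for s
    unfolding Z_def by (rule measurable_F[OF geometric_path_adapted[OF that]])
  have ZM'[measurable]: "Z (real i * h n) \<in> borel_measurable M" for i n
    using ZM[OF grid(1)] .
  have incM[measurable]: "increment W (h n) i \<in> borel_measurable M" for n i
    using h(1)[of n] by (simp add: increment_measurable)
  have fM[measurable]: "f n \<in> borel_measurable borel" for n unfolding f_def by measurable
  have Z2: "integrable M (\<lambda>\<omega>. (Z s \<omega>)\<^sup>2)" if "0 \<le> s" for s
    using has_bochner_integral_geometric_path_square[OF that] unfolding Z_def by (simp add: has_bochner_integral_iff)
  have ZK: "(\<integral>\<omega>. (Z s \<omega>)\<^sup>2 \<partial>M) \<le> K" if s: "0 \<le> s" "s \<le> t" for s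
  proof -
    have "(2 * \<alpha> + \<sigma>\<^sup>2) * s \<le> \<bar>2 * \<alpha> + \<sigma>\<^sup>2\<bar> * t"
      using s t by (intro mult_mono) auto
    then show ?thesis
      using has_bochner_integral_geometric_path_square[OF s(1), of \<alpha> \<sigma> x] s unfolding Z_def K_def
      by (auto simp: has_bochner_integral_iff intro!: mult_left_mono)
  qed
  define A where "A n \<omega> = (\<Sum>i<Suc n. Z (real i * h n) \<omega> * f n (increment W (h n) i \<omega>))" for n \<omega>
  define B where "B n \<omega> = (\<Sum>i<Suc n. c n * Z (real i * h n) \<omega>)" for n \<omega>
  \<comment> \<open>The total defect \<open>R\<close> is the centred part \<open>A\<close> plus the sum \<open>B\<close> of the means.\<close>
  define R where "R n \<omega> = Z t \<omega> - Z 0 \<omega>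
      - (\<Sum>i<Suc n. Z (real i * h n) \<omega> * (\<alpha> * h n + \<sigma> * increment W (h n) i \<omega>))" for n \<omega>
  have RAB: "R n \<omega> = A n \<omega> + B n \<omega>" for n \<omega>
  proof -
    \<comment> \<open>One step of the exponential is multiplication by a function of the increment alone.\<close>
    have step: "Z (real (Suc i) * h n) \<omega> - Z (real i * h n) \<omega>
        = Z (real i * h n) \<omega> * (\<alpha> * h n + \<sigma> * increment W (h n) i \<omega>)
          + (Z (real i * h n) \<omega> * f n (increment W (h n) i \<omega>) + c n * Z (real i * h n) \<omega>)" for i
    proof -
      have "Z (real (Suc i) * h n) \<omega> = Z (real i * h n) \<omega> * exp ((\<alpha> - \<sigma>\<^sup>2 / 2) * h n + \<sigma> * increment W (h n) i \<omega>)"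
        unfolding Z_def geometric_path_def increment_def mult.assoc exp_add[symmetric]
        by (simp add: algebra_simps)
      then show ?thesis unfolding f_def c_def by (simp add: algebra_simps)
    qed
    have "Z t \<omega> - Z 0 \<omega> = (\<Sum>i<Suc n. Z (real (Suc i) * h n) \<omega> - Z (real i * h n) \<omega>)"
      using sum_lessThan_telescope[of "\<lambda>i. Z (real i * h n) \<omega>" "Suc n"] h(2)[of n] by simp
    then show ?thesis
      unfolding R_def A_def B_def step sum.distrib by simp
  qed
  have AM[measurable]: "A n \<in> borel_measurable M" for n
    unfolding A_def by (intro borel_measurable_sum borel_measurable_times) auto
  have BM[measurable]: "B n \<in> borel_measurable M" for n
    unfolding B_def by (intro borel_measurable_sum borel_measurable_times) auto
  have RM[measurable]: "R n \<in> borel_measurable M" for n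
    unfolding RAB by measurable
  have v0: "0 \<le> v n" for n
    unfolding has_bochner_integral_integral_eq[OF f_moments(2), symmetric]
    by (intro integral_nonneg_AE) auto
  have Ale: "trunc_mean M (A n) \<le> sqrt (real (Suc n) * v n * K)" for n
  proof -
    have A2: "has_bochner_integral M (\<lambda>\<omega>. (A n \<omega>)\<^sup>2) (v n * (\<Sum>i<Suc n. \<integral>\<omega>. (Z (real i * h n) \<omega>)\<^sup>2 \<partial>M))"
      unfolding A_def
      by (rule orthogonal_increment_sum) (use h(1) ZF Z2 grid(1) fM f_moments in auto)
    have "(\<integral>\<omega>. (A n \<omega>)\<^sup>2 \<partial>M) \<le> v n * (\<Sum>i<Suc n. K)"
      using A2 v0[of n] grid
      by (subst has_bochner_integral_integral_eq[OF A2]) (intro mult_left_mono sum_mono ZK; simp)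
    also have "\<dots> = real (Suc n) * v n * K" by simp
    finally have "sqrt (\<integral>\<omega>. (A n \<omega>)\<^sup>2 \<partial>M) \<le> sqrt (real (Suc n) * v n * K)" by (rule real_sqrt_le_mono)
    with trunc_mean_le_L2[OF AM integrable.intros[OF A2]] show ?thesis by (rule order_trans)
  qed
  have Ble: "trunc_mean M (B n) \<le> \<bar>real (Suc n) * c n\<bar> * sqrt K" for n
  proof -
    have Zi: "integrable M (Z (real i * h n))" for i
      using square_integrable_imp_integrable[OF ZM' Z2[OF grid(1)]] .
    have "integrable M (B n)" unfolding B_def using Zi by (intro Bochner_Integration.integrable_sum) auto
    then have "trunc_mean M (B n) \<le> (\<integral>\<omega>. \<bar>B n \<omega>\<bar> \<partial>M)" by (rule trunc_mean_le_L1)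
    also have "\<dots> \<le> (\<integral>\<omega>. (\<Sum>i<Suc n. \<bar>c n\<bar> * \<bar>Z (real i * h n) \<omega>\<bar>) \<partial>M)"
    proof (rule integral_mono)
      show "integrable M (\<lambda>\<omega>. \<bar>B n \<omega>\<bar>)" using \<open>integrable M (B n)\<close> by simp
      show "integrable M (\<lambda>\<omega>. \<Sum>i<Suc n. \<bar>c n\<bar> * \<bar>Z (real i * h n) \<omega>\<bar>)"
        using Zi by (intro Bochner_Integration.integrable_sum) auto
      show "\<bar>B n \<omega>\<bar> \<le> (\<Sum>i<Suc n. \<bar>c n\<bar> * \<bar>Z (real i * h n) \<omega>\<bar>)" for \<omega>
        unfolding B_def abs_mult[symmetric] by (rule sum_abs)
    qed
    also have "\<dots> = (\<Sum>i<Suc n. \<bar>c n\<bar> * (\<integral>\<omega>. \<bar>Z (real i * h n) \<omega>\<bar> \<partial>M))"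
      using Zi by (subst Bochner_Integration.integral_sum) auto
    also have "\<dots> \<le> (\<Sum>i<Suc n. \<bar>c n\<bar> * sqrt K)"
    proof (intro sum_mono mult_left_mono)
      fix i assume "i \<in> {..<Suc n}"
      then show "(\<integral>\<omega>. \<bar>Z (real i * h n) \<omega>\<bar> \<partial>M) \<le> sqrt K"
        by (intro order_trans[OF expectation_abs_le_sqrt[OF ZM' Z2[OF grid(1)]]]
            real_sqrt_le_mono ZK[OF grid(1) grid(2)]) simp
    qed simp
    also have "\<dots> = \<bar>real (Suc n) * c n\<bar> * sqrt K" by (simp add: abs_mult)
    finally show ?thesis .
  qed
  have small: "(\<lambda>n. real (Suc n) * c n) \<longlonglongrightarrow> 0" "(\<lambda>n. real (Suc n) * v n) \<longlonglongrightarrow> 0"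
    unfolding c_def v_def h_def by (rule euler_defect_small[OF t])+
  have "(\<lambda>n. sqrt (real (Suc n) * v n * K) + \<bar>real (Suc n) * c n\<bar> * sqrt K) \<longlonglongrightarrow> sqrt (0 * K) + \<bar>0\<bar> * sqrt K"
    by (intro tendsto_add tendsto_real_sqrt tendsto_mult tendsto_rabs small tendsto_const)
  then have lim: "(\<lambda>n. sqrt (real (Suc n) * v n * K) + \<bar>real (Suc n) * c n\<bar> * sqrt K) \<longlonglongrightarrow> 0" by simp
  have le: "trunc_mean M (R n) \<le> sqrt (real (Suc n) * v n * K) + \<bar>real (Suc n) * c n\<bar> * sqrt K" for n
  proof -
    have "trunc_mean M (R n) \<le> trunc_mean M (A n) + trunc_mean M (B n)"
      by (rule trunc_mean_le_add) (auto simp: RAB)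
    then show ?thesis using Ale[of n] Ble[of n] by linarith
  qed
  have "(\<lambda>n. trunc_mean M (R n)) \<longlonglongrightarrow> 0"
    by (rule trunc_mean_tendsto_zero_le[OF le lim])
  then show ?thesis unfolding R_def h_def .
qed

end

section \<open>Uniqueness for the linear equation\<close>

lemma rational_approximation_from_below:
  fixes s :: real
  assumes s: "0 \<le> s"
  obtains q where "\<And>n. q n \<in> \<rat>" "\<And>n. 0 \<le> q n" "\<And>n. q n \<le> s" "q \<longlonglongrightarrow> s"
proof
  let ?q = "\<lambda>n. real (nat \<lfloor>s / (1 / Suc n)\<rfloor>) * (1 / Suc n)"
  show "?q n \<in> \<rat>" for n by (intro Rats_mult Rats_divide) auto
  show "0 \<le> ?q n" for n by simp
  show "?q n \<le> s" for n using floor_grid_bounds(1)[of "1 / Suc n" s] s by simp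
  show "?q \<longlonglongrightarrow> s" using floor_grid_tendsto[of 1 s] s by simp
qed

lemma le_on_interval_if_le_on_rationals:
  fixes u :: "real \<Rightarrow> real"
  assumes u: "continuous_on {0..t} u" and le: "\<And>q. q \<in> \<rat> \<Longrightarrow> 0 \<le> q \<Longrightarrow> q \<le> t \<Longrightarrow> \<bar>u q\<bar> \<le> C"
    and s: "0 \<le> s" "s \<le> t"
  shows "\<bar>u s\<bar> \<le> C"
proof -
  obtain q where q: "\<And>n. q n \<in> \<rat>" "\<And>n. 0 \<le> q n" "\<And>n. q n \<le> s" "q \<longlonglongrightarrow> s"
    using rational_approximation_from_below[OF s(1)] by blast
  have "(\<lambda>n. u (q n)) \<longlonglongrightarrow> u s"
    by (rule continuous_on_tendsto_sequence[OF u _ _ q(4)]) (use q(2) order_trans[OF q(3) s(2)] s in auto)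
  then have "(\<lambda>n. \<bar>u (q n)\<bar>) \<longlonglongrightarrow> \<bar>u s\<bar>" by (rule tendsto_rabs)
  then show ?thesis
    by (rule LIMSEQ_le_const2) (use le q(1,2) order_trans[OF q(3) s(2)] in auto)
qed

text \<open>
  A left-point sum of the increasing function \<open>exp (c s)\<close> lies below its integral, by telescoping. With the weight
  \<open>exp (2 c s)\<close> in place of powers of \<open>s\<close>, Gronwall's iteration gains a factor \<open>1 / 2\<close> per round.
\<close>

lemma exp_left_sum_le:
  fixes c h :: real
  assumes c: "0 < c" and h: "0 \<le> h"
  shows "(\<Sum>i<n. exp (c * (real i * h)) * h) \<le> exp (c * (real n * h)) / c"
proof -
  have "exp (c * (real i * h)) * h \<le> (exp (c * (real (Suc i) * h)) - exp (c * (real i * h))) / c" for i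
  proof -
    have "c * h \<le> exp (c * h) - 1" using exp_ge_add_one_self[of "c * h"] by linarith
    then have "exp (c * (real i * h)) * (c * h) \<le> exp (c * (real i * h)) * (exp (c * h) - 1)"
      by (intro mult_left_mono) auto
    also have "\<dots> = exp (c * (real (Suc i) * h)) - exp (c * (real i * h))"
      by (simp add: right_diff_distrib exp_add[symmetric] algebra_simps)
    finally show ?thesis using c by (simp add: field_simps)
  qed
  then have "(\<Sum>i<n. exp (c * (real i * h)) * h)
      \<le> (\<Sum>i<n. (exp (c * (real (Suc i) * h)) - exp (c * (real i * h))) / c)"
    by (intro sum_mono)
  also have "\<dots> = (\<Sum>i<n. exp (c * (real (Suc i) * h)) - exp (c * (real i * h))) / c"
    by (simp only: sum_divide_distrib)
  also have "\<dots> = (exp (c * (real n * h)) - 1) / c"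
    by (subst sum_lessThan_telescope[of "\<lambda>i. exp (c * (real i * h))"]) simp
  also have "\<dots> \<le> exp (c * (real n * h)) / c"
    using c by (simp add: divide_right_mono)
  finally show ?thesis .
qed

context brownian_motion
begin

lemma expectation_square_euler_sum_le:
  fixes \<alpha> \<sigma> h :: real
  assumes h: "0 < h"
    and Y: "\<And>i. i < n \<Longrightarrow> Y i \<in> borel_measurable (F (ennreal (real i * h)))"
    and Y2: "\<And>i. i < n \<Longrightarrow> integrable M (\<lambda>\<omega>. (Y i \<omega>)\<^sup>2)"
  defines "S \<equiv> \<lambda>\<omega>. \<Sum>i<n. Y i \<omega> * (\<alpha> * h + \<sigma> * increment W h i \<omega>)"
  shows "integrable M (\<lambda>\<omega>. (S \<omega>)\<^sup>2)"
    and "(\<integral>\<omega>. (S \<omega>)\<^sup>2 \<partial>M) \<le> (2 * \<alpha>\<^sup>2 * (real n * h) + 2 * \<sigma>\<^sup>2) * (\<Sum>i<n. (\<integral>\<omega>. (Y i \<omega>)\<^sup>2 \<partial>M) * h)"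
proof -
  have [measurable]: "Y i \<in> borel_measurable M" if "i < n" for i
    using measurable_F[OF Y[OF that]] .
  have [measurable]: "increment W h i \<in> borel_measurable M" for i
    using h by (simp add: increment_measurable)
  have SM[measurable]: "S \<in> borel_measurable M"
    unfolding S_def by (intro borel_measurable_sum borel_measurable_times) auto
  define m where "m \<omega> = (\<Sum>i<n. Y i \<omega> * increment W h i \<omega>)" for \<omega>
  define d where "d \<omega> = (\<Sum>i<n. (Y i \<omega>)\<^sup>2)" for \<omega>
  have m2: "has_bochner_integral M (\<lambda>\<omega>. (m \<omega>)\<^sup>2) (h * (\<Sum>i<n. \<integral>\<omega>. (Y i \<omega>)\<^sup>2 \<partial>M))"
    unfolding m_def
    by (rule orthogonal_increment_sum[where f="\<lambda>y. y"])
      (use h Y Y2 has_bochner_integral_normal_id[of "sqrt h"] has_bochner_integral_normal_square[of "sqrt h"] in auto)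
  have d1: "has_bochner_integral M d (\<Sum>i<n. \<integral>\<omega>. (Y i \<omega>)\<^sup>2 \<partial>M)"
    unfolding d_def using Y2 by (auto intro!: has_bochner_integral_sum simp: has_bochner_integral_iff)
  let ?w = "\<lambda>\<omega>. 2 * \<alpha>\<^sup>2 * h\<^sup>2 * real n * d \<omega> + 2 * \<sigma>\<^sup>2 * (m \<omega>)\<^sup>2"
  have w: "has_bochner_integral M ?w
      (2 * \<alpha>\<^sup>2 * h\<^sup>2 * real n * (\<Sum>i<n. \<integral>\<omega>. (Y i \<omega>)\<^sup>2 \<partial>M) + 2 * \<sigma>\<^sup>2 * (h * (\<Sum>i<n. \<integral>\<omega>. (Y i \<omega>)\<^sup>2 \<partial>M)))"
    by (intro has_bochner_integral_add has_bochner_integral_mult_right m2 d1)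
  have le: "(S \<omega>)\<^sup>2 \<le> ?w \<omega>" for \<omega>
  proof -
    have "S \<omega> = \<alpha> * h * (\<Sum>i<n. Y i \<omega>) + \<sigma> * m \<omega>"
      unfolding S_def m_def by (simp add: sum_distrib_left sum.distrib algebra_simps)
    moreover have "(a + b)\<^sup>2 \<le> 2 * a\<^sup>2 + 2 * b\<^sup>2" for a b :: real
      using sum_squares_bound[of a b] by (simp add: power2_sum)
    ultimately have "(S \<omega>)\<^sup>2 \<le> 2 * (\<alpha> * h * (\<Sum>i<n. Y i \<omega>))\<^sup>2 + 2 * (\<sigma> * m \<omega>)\<^sup>2" by simp
    also have "(\<alpha> * h * (\<Sum>i<n. Y i \<omega>))\<^sup>2 \<le> (\<alpha> * h)\<^sup>2 * (real n * d \<omega>)"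
      unfolding power_mult_distrib[of "\<alpha> * h"]
      using sum_squared_le_sum_of_squares[of "\<lambda>i. Y i \<omega>" "{..<n}"]
      by (intro mult_left_mono) (auto simp: d_def mult.commute)
    finally show ?thesis by (simp add: power_mult_distrib algebra_simps)
  qed
  show int: "integrable M (\<lambda>\<omega>. (S \<omega>)\<^sup>2)"
    by (rule Bochner_Integration.integrable_bound[OF integrable.intros[OF w]])
       (use le in \<open>auto intro!: AE_I2 intro: order_trans[OF _ abs_ge_self]\<close>)
  have "(\<integral>\<omega>. (S \<omega>)\<^sup>2 \<partial>M) \<le> (\<integral>\<omega>. ?w \<omega> \<partial>M)"
    using le by (intro integral_mono int integrable.intros[OF w])
  also have "\<dots> = (2 * \<alpha>\<^sup>2 * (real n * h) + 2 * \<sigma>\<^sup>2) * (\<Sum>i<n. (\<integral>\<omega>. (Y i \<omega>)\<^sup>2 \<partial>M) * h)"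
    unfolding has_bochner_integral_integral_eq[OF w] sum_distrib_right[symmetric]
    by (simp add: power2_eq_square algebra_simps)
  finally show "(\<integral>\<omega>. (S \<omega>)\<^sup>2 \<partial>M) \<le> (2 * \<alpha>\<^sup>2 * (real n * h) + 2 * \<sigma>\<^sup>2) * (\<Sum>i<n. (\<integral>\<omega>. (Y i \<omega>)\<^sup>2 \<partial>M) * h)" .
qed

text \<open>
  Gronwall's inequality for second moments. The second moment of \<open>U\<close> may be infinite, so \<open>U\<close> is cut off
  at the first exit from \<open>[- C, C]\<close>: \<open>Y C s\<close> equals \<open>U s\<close> if the path stays in this interval up to \<open>s\<close>, and \<open>0\<close>
  otherwise. Where the path stays inside until \<open>t\<close>, the Euler sums of \<open>U\<close> and of \<open>Y C\<close> coincide. Hence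
  a bound \<open>B exp (2 c s)\<close> for the second moment of \<open>Y C s\<close> improves to \<open>B / 2 exp (2 c s)\<close>.
\<close>

theorem linear_sde_unique:
  fixes \<alpha> \<sigma> :: real and U :: "real \<Rightarrow> 'a \<Rightarrow> real"
  assumes UF: "\<And>s. 0 \<le> s \<Longrightarrow> U s \<in> borel_measurable (F (ennreal s))"
    and Uc: "\<And>\<omega>. \<omega> \<in> space M \<Longrightarrow> continuous_on {0..} (\<lambda>s. U s \<omega>)"
    and U0: "AE \<omega> in M. U 0 \<omega> = 0"
    and sde: "\<And>t. 0 < t \<Longrightarrow> (\<lambda>n. trunc_mean M (\<lambda>\<omega>. U t \<omega>
      - (\<Sum>i<Suc n. U (real i * (t / Suc n)) \<omega> * (\<alpha> * (t / Suc n) + \<sigma> * increment W (t / Suc n) i \<omega>)))) \<longlonglongrightarrow> 0"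
    and T: "0 \<le> T"
  shows "AE \<omega> in M. U T \<omega> = 0"
proof -
  \<comment> \<open>Rational times keep the event measurable; by continuity they control the whole path.\<close>
  define bdd where "bdd C s \<omega> \<longleftrightarrow> (\<forall>q\<in>\<rat> \<inter> {0..s}. \<bar>U q \<omega>\<bar> \<le> C)" for C s \<omega>
  define Y where "Y C s \<omega> = U s \<omega> * of_bool (bdd C s \<omega>)" for C s \<omega>
  have bdd_le: "\<bar>U s \<omega>\<bar> \<le> C" if "bdd C t \<omega>" "0 \<le> s" "s \<le> t" "\<omega> \<in> space M" for C s t \<omega>
    by (rule le_on_interval_if_le_on_rationals[where t=t, OF continuous_on_subset[OF Uc[OF that(4)]]])
       (use that in \<open>auto simp: bdd_def\<close>)
  have bdd_mono: "bdd C s \<omega>" if "bdd C t \<omega>" "s \<le> t" for C s t \<omega>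
    using that by (auto simp: bdd_def)
  have YF: "Y C s \<in> borel_measurable (F (ennreal s))" if s: "0 \<le> s" for C s
  proof -
    have [measurable]: "U q \<in> borel_measurable (F (ennreal s))" if "q \<in> \<rat> \<inter> {0..s}" for q
      using that by (intro measurable_F_mono[OF UF]) (auto intro: ennreal_leI)
    have [measurable]: "U s \<in> borel_measurable (F (ennreal s))" by (rule UF[OF s])
    have "Measurable.pred (F (ennreal s)) (bdd C s)"
      unfolding bdd_def
      by (rule measurable_pred_countable(1)) (auto intro: countable_subset[OF _ countable_rat])
    then show ?thesis unfolding Y_def of_bool_def by measurable
  qed
  have YM[measurable]: "Y C s \<in> borel_measurable M" if "0 \<le> s" for C s
    using measurable_F[OF YF[OF that]] .
  have UM[measurable]: "U s \<in> borel_measurable M" if "0 \<le> s" for s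
    using measurable_F[OF UF[OF that]] .
  have YC: "\<bar>Y C s \<omega>\<bar> \<le> C" if "0 \<le> s" "0 \<le> C" "\<omega> \<in> space M" for C s \<omega>
    using bdd_le[of C s \<omega> s] that by (auto simp: Y_def)
  have Y2C: "(Y C s \<omega>)\<^sup>2 \<le> C\<^sup>2" if "0 \<le> s" "0 \<le> C" "\<omega> \<in> space M" for C s \<omega>
    using YC[OF that] that(2) by (simp add: abs_le_square_iff[symmetric])
  have Y2: "integrable M (\<lambda>\<omega>. (Y C s \<omega>)\<^sup>2)" if "0 \<le> s" "0 \<le> C" for C s
    using that Y2C by (intro integrable_const_bound[where B="C\<^sup>2"]) (auto intro!: AE_I2)
  define \<phi> where "\<phi> C s = (\<integral>\<omega>. (Y C s \<omega>)\<^sup>2 \<partial>M)" for C s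
  \<comment> \<open>Twice the constant of \<open>expectation_square_euler_sum_le\<close> on \<open>[0, T]\<close>; the summand \<open>1\<close> makes it positive.\<close>
  define c where "c = 4 * \<alpha>\<^sup>2 * T + 4 * \<sigma>\<^sup>2 + 1"
  have c: "0 < c" using T by (simp add: c_def add_nonneg_pos)

  have halve: "\<phi> C t \<le> B / 2 * exp (2 * c * t)"
    if C: "0 \<le> C" and t: "0 \<le> t" "t \<le> T" and B: "\<And>s. 0 \<le> s \<Longrightarrow> s \<le> T \<Longrightarrow> \<phi> C s \<le> B * exp (2 * c * s)" for C B t
  proof (cases "t = 0")
    case True
    have "0 \<le> \<phi> C 0" unfolding \<phi>_def by (intro integral_nonneg_AE) auto
    moreover have "\<phi> C 0 = 0"
      unfolding \<phi>_def by (rule integral_eq_zero_AE) (use U0 in \<open>auto simp: Y_def\<close>)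
    ultimately show ?thesis using True B[of 0] T by simp
  next
    case False
    then have t: "0 < t" "t \<le> T" using t by auto
    define h where "h n = t / Suc n" for n
    have h: "0 < h n" "real (Suc n) * h n = t" for n using t by (auto simp: h_def)
    have grid: "0 \<le> real i * h n" "i < Suc n \<Longrightarrow> real i * h n \<le> t" for i n
    proof -
      show "0 \<le> real i * h n" using h(1)[of n] by simp
      assume "i < Suc n"
      then have "real i * h n \<le> real (Suc n) * h n" using h(1)[of n] by (intro mult_right_mono) auto
      then show "real i * h n \<le> t" using h(2)[of n] by simp
    qed
    have [measurable]: "increment W (h n) i \<in> borel_measurable M" for n i
      using h(1)[of n] by (simp add: increment_measurable)
    define S where "S n \<omega> = (\<Sum>i<Suc n. Y C (real i * h n) \<omega> * (\<alpha> * h n + \<sigma> * increment W (h n) i \<omega>))" for n \<omega>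
    define R where "R n \<omega> = U t \<omega> - (\<Sum>i<Suc n. U (real i * h n) \<omega> * (\<alpha> * h n + \<sigma> * increment W (h n) i \<omega>))" for n \<omega>
    have RM[measurable]: "R n \<in> borel_measurable M" for n
      unfolding R_def using grid(1)[of _ n] t(1)
      by (intro borel_measurable_diff borel_measurable_sum borel_measurable_times UM) auto
    have S2: "integrable M (\<lambda>\<omega>. (S n \<omega>)\<^sup>2)" for n
      unfolding S_def
      by (rule expectation_square_euler_sum_le(1)[OF h(1)]) (use YF Y2 grid(1) C in auto)
    have S_le: "2 * (\<integral>\<omega>. (S n \<omega>)\<^sup>2 \<partial>M) \<le> B / 2 * exp (2 * c * t)" for n
    proof -
      have "(\<integral>\<omega>. (S n \<omega>)\<^sup>2 \<partial>M) \<le> (2 * \<alpha>\<^sup>2 * (real (Suc n) * h n) + 2 * \<sigma>\<^sup>2)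
          * (\<Sum>i<Suc n. \<phi> C (real i * h n) * h n)"
        unfolding S_def \<phi>_def
        by (rule expectation_square_euler_sum_le(2)[OF h(1)]) (use YF Y2 grid(1) C in auto)
      also have "\<dots> \<le> c / 2 * (B * (exp (2 * c * t) / (2 * c)))"
      proof (rule mult_mono)
        show "2 * \<alpha>\<^sup>2 * (real (Suc n) * h n) + 2 * \<sigma>\<^sup>2 \<le> c / 2"
        proof -
          have "\<alpha>\<^sup>2 * t \<le> \<alpha>\<^sup>2 * T" using t by (intro mult_left_mono) auto
          then show ?thesis unfolding h(2) c_def by (simp add: field_simps)
        qed
        have B0: "0 \<le> B"
        proof -
          have "0 \<le> \<phi> C 0" unfolding \<phi>_def by (intro integral_nonneg_AE) auto
          then show ?thesis using B[of 0] T by simp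
        qed
        have "(\<Sum>i<Suc n. \<phi> C (real i * h n) * h n) \<le> (\<Sum>i<Suc n. (B * exp (2 * c * (real i * h n))) * h n)"
          using h(1)[of n] grid(1) by (intro sum_mono mult_right_mono B order_trans[OF grid(2) t(2)]) auto
        also have "\<dots> = B * (\<Sum>i<Suc n. exp (2 * c * (real i * h n)) * h n)"
          by (simp only: sum_distrib_left mult.assoc)
        also have "\<dots> \<le> B * (exp (2 * c * (real (Suc n) * h n)) / (2 * c))"
          using c h(1)[of n] B0 by (intro mult_left_mono exp_left_sum_le) auto
        finally show "(\<Sum>i<Suc n. \<phi> C (real i * h n) * h n) \<le> B * (exp (2 * c * t) / (2 * c))"
          unfolding h(2) .
        show "0 \<le> (\<Sum>i<Suc n. \<phi> C (real i * h n) * h n)"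
          unfolding \<phi>_def using h(1)[of n] by (intro sum_nonneg mult_nonneg_nonneg integral_nonneg_AE) auto
      qed (use c in simp)
      finally show ?thesis using c by simp
    qed
    have "\<phi> C t \<le> B / 2 * exp (2 * c * t) + (2 + C\<^sup>2) * trunc_mean M (R n)" for n
    proof -
      \<comment> \<open>If \<open>\<bar>R n\<bar> > 1\<close>, the cut-off bounds the left-hand side by \<open>C\<^sup>2\<close>.\<close>
      have pw: "(Y C t \<omega>)\<^sup>2 \<le> 2 * (S n \<omega>)\<^sup>2 + (2 + C\<^sup>2) * min 1 \<bar>R n \<omega>\<bar>" if \<omega>: "\<omega> \<in> space M" for \<omega>
      proof (cases "bdd C t \<omega>")
        case True
        have "bdd C (real i * h n) \<omega>" if "i < Suc n" for i
          using bdd_mono[OF True grid(2)[OF that]] .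
        then have "S n \<omega> = (\<Sum>i<Suc n. U (real i * h n) \<omega> * (\<alpha> * h n + \<sigma> * increment W (h n) i \<omega>))"
          unfolding S_def by (intro sum.cong refl) (simp add: Y_def)
        then have Yt: "Y C t \<omega> = S n \<omega> + R n \<omega>" using True by (simp add: Y_def R_def)
        show ?thesis
        proof (cases "\<bar>R n \<omega>\<bar> \<le> 1")
          case True
          have "(Y C t \<omega>)\<^sup>2 \<le> 2 * (S n \<omega>)\<^sup>2 + 2 * (R n \<omega>)\<^sup>2"
            unfolding Yt using sum_squares_bound[of "S n \<omega>" "R n \<omega>"] by (simp add: power2_sum)
          also have "(R n \<omega>)\<^sup>2 \<le> \<bar>R n \<omega>\<bar>"
            using mult_left_mono[OF True, of "\<bar>R n \<omega>\<bar>"] by (simp add: power2_eq_square)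
          finally have "(Y C t \<omega>)\<^sup>2 \<le> 2 * (S n \<omega>)\<^sup>2 + 2 * \<bar>R n \<omega>\<bar>" by simp
          moreover have "2 * \<bar>R n \<omega>\<bar> \<le> (2 + C\<^sup>2) * \<bar>R n \<omega>\<bar>" by (intro mult_right_mono) auto
          ultimately show ?thesis using True by simp
        next
          case False
          then show ?thesis using Y2C[OF _ C \<omega>, of t] t by (auto simp: min_def intro: add_increasing)
        qed
      qed (auto simp: Y_def)
      have "\<phi> C t \<le> (\<integral>\<omega>. 2 * (S n \<omega>)\<^sup>2 + (2 + C\<^sup>2) * min 1 \<bar>R n \<omega>\<bar> \<partial>M)"
        unfolding \<phi>_def using pw S2 Y2[of t C] t C
        by (intro integral_mono Bochner_Integration.integrable_add integrable_mult_right integrable_min_one) auto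
      also have "\<dots> = 2 * (\<integral>\<omega>. (S n \<omega>)\<^sup>2 \<partial>M) + (2 + C\<^sup>2) * trunc_mean M (R n)"
        unfolding trunc_mean_def using S2 integrable_min_one[OF RM[of n]]
        by (subst Bochner_Integration.integral_add) (auto simp del: integral_mult_right_zero simp: integral_mult_right)
      finally show ?thesis using S_le[of n] by linarith
    qed
    moreover have "(\<lambda>n. B / 2 * exp (2 * c * t) + (2 + C\<^sup>2) * trunc_mean M (R n))
        \<longlonglongrightarrow> B / 2 * exp (2 * c * t) + (2 + C\<^sup>2) * 0"
      unfolding R_def h_def by (intro tendsto_add tendsto_mult tendsto_const sde t)
    ultimately show ?thesis
      by (intro LIMSEQ_le_const[of "\<lambda>n. B / 2 * exp (2 * c * t) + (2 + C\<^sup>2) * trunc_mean M (R n)"]) auto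
  qed
  have "\<phi> C t \<le> C\<^sup>2 / 2 ^ k * exp (2 * c * t)" if "0 \<le> C" "0 \<le> t" "t \<le> T" for C t k
    using that(2,3)
  proof (induction k arbitrary: t)
    case 0
    have "\<phi> C t \<le> (\<integral>\<omega>. C\<^sup>2 \<partial>M)"
      unfolding \<phi>_def using Y2C Y2 0 that(1) by (intro integral_mono) auto
    also have "\<dots> = C\<^sup>2" by (simp add: prob_space)
    also have "\<dots> \<le> C\<^sup>2 * exp (2 * c * t)" using c 0 by (simp add: mult_le_cancel_left1)
    finally show ?case by simp
  next
    case (Suc k)
    show ?case
      using halve[OF that(1) Suc.prems, of "C\<^sup>2 / 2 ^ k"] Suc.IH by (simp add: mult.commute)
  qed
  then have le: "\<phi> C T \<le> C\<^sup>2 * exp (2 * c * T) * (1 / 2) ^ k" if "0 \<le> C" for C k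
    using that T by (simp add: power_one_over field_simps)
  have "\<phi> C T = 0" if C: "0 \<le> C" for C
  proof (rule antisym)
    have "(\<lambda>k. C\<^sup>2 * exp (2 * c * T) * (1 / 2) ^ k) \<longlonglongrightarrow> C\<^sup>2 * exp (2 * c * T) * 0"
      by (intro tendsto_mult tendsto_const LIMSEQ_power_zero) simp
    then show "\<phi> C T \<le> 0"
      using le[OF C] by (intro LIMSEQ_le_const[of "\<lambda>k. C\<^sup>2 * exp (2 * c * T) * (1 / 2) ^ k"]) auto
    show "0 \<le> \<phi> C T" unfolding \<phi>_def by (intro integral_nonneg_AE) auto
  qed
  then have "AE \<omega> in M. (Y (real N) T \<omega>)\<^sup>2 = 0" for N
    using integral_nonneg_eq_0_iff_AE[OF Y2[of T "real N"]] T by (auto simp: \<phi>_def)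
  then have "AE \<omega> in M. \<forall>N. (Y (real N) T \<omega>)\<^sup>2 = 0" by (simp add: AE_all_countable)
  then show ?thesis
    using AE_space
  proof eventually_elim
    case (elim \<omega>)
    have "continuous_on {0..T} (\<lambda>s. U s \<omega>)"
      using Uc[OF elim(2)] by (rule continuous_on_subset) auto
    then have "bounded ((\<lambda>s. U s \<omega>) ` {0..T})"
      by (intro compact_imp_bounded compact_continuous_image) auto
    then obtain B where B: "\<And>s. s \<in> {0..T} \<Longrightarrow> \<bar>U s \<omega>\<bar> \<le> B"
      by (force simp: bounded_iff)
    obtain N where N: "B \<le> real N" using real_arch_simple by blast
    have "bdd (real N) T \<omega>" unfolding bdd_def using B N by (fastforce intro: order_trans)
    then show ?case using elim(1) by (auto simp: Y_def)
  qed
qed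

end

context geometric_brownian_motion
begin

text \<open>
  Both integrals in the equation are limits of left-point sums on the same grid.
\<close>

lemma solution_left_sums:
  assumes t: "0 < t"
  shows "(\<lambda>n. trunc_mean M (\<lambda>\<omega>. X t \<omega> - x
      - (\<Sum>i<Suc n. X (real i * (t / Suc n)) \<omega> * (\<alpha> * (t / Suc n) + \<sigma> * increment W (t / Suc n) i \<omega>)))) \<longlonglongrightarrow> 0"
proof -
  obtain I where I: "has_ito_integral M F W (\<lambda>s \<omega>. \<sigma> * X s \<omega>) I"
    and eq: "AE \<omega> in M. X t \<omega> = x + (LBINT s:{0..t}. \<alpha> * X s \<omega>) + I t \<omega>"
    using X_sde t by (meson less_imp_le)
  have IM[measurable]: "I t \<in> borel_measurable M"
    using I t unfolding has_ito_integral_def by (intro measurable_F[of _ "ennreal t"]) auto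
  define h where "h n = t / Suc n" for n
  have h: "0 < h n" for n using t by (simp add: h_def)
  have XM[measurable]: "X s \<in> borel_measurable M" if "0 \<le> s" for s
    using measurable_F[OF X_adapted[OF that]] .
  have XM'[measurable]: "X (real i * h n) \<in> borel_measurable M" for i n
    using h[of n] by (intro XM) auto
  have [measurable]: "increment W (h n) i \<in> borel_measurable M" for n i
    using h(1)[of n] by (simp add: increment_measurable)
  have [measurable]: "X t \<in> borel_measurable M" using t by simp
  define D where "D n \<omega> = (\<Sum>i<Suc n. \<alpha> * X (real i * h n) \<omega> * h n)" for n \<omega>
  define d where "d \<omega> = (LBINT s:{0..t}. \<alpha> * X s \<omega>)" for \<omega>
  define E where "E n \<omega> = (\<Sum>i<Suc n. \<sigma> * X (real i * h n) \<omega> * increment W (h n) i \<omega>)" for n \<omega>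
  define R where "R n \<omega> = X t \<omega> - x - (\<Sum>i<Suc n. X (real i * h n) \<omega> * (\<alpha> * h n + \<sigma> * increment W (h n) i \<omega>))" for n \<omega>
  have DM[measurable]: "D n \<in> borel_measurable M" for n
    unfolding D_def by (intro borel_measurable_sum) auto
  have EM[measurable]: "E n \<in> borel_measurable M" for n
    unfolding E_def by (intro borel_measurable_sum) auto
  have RM[measurable]: "R n \<in> borel_measurable M" for n
    unfolding R_def by (intro borel_measurable_diff borel_measurable_sum) auto
  have lim: "(\<lambda>n. D n \<omega>) \<longlonglongrightarrow> d \<omega>" if "\<omega> \<in> space M" for \<omega>
  proof -
    have "continuous_on {0..t} (\<lambda>s. \<alpha> * X s \<omega>)"
      by (intro continuous_intros continuous_on_subset[OF X_continuous[OF that]]) auto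
    from left_riemann_sum_continuous(2)[OF t this] show ?thesis unfolding D_def d_def h_def .
  qed
  have dM[measurable]: "d \<in> borel_measurable M"
    by (rule borel_measurable_LIMSEQ_real[OF lim DM])
  have "(\<lambda>n. trunc_mean M (\<lambda>\<omega>. D n \<omega> - d \<omega>)) \<longlonglongrightarrow> 0"
    using lim by (intro trunc_mean_tendsto_zero) (auto intro!: AE_I2 simp: LIM_zero)
  moreover have "(\<lambda>n. trunc_mean M (\<lambda>\<omega>. E n \<omega> - I t \<omega>)) \<longlonglongrightarrow> 0"
    unfolding E_def h_def
  proof (rule ito_integral_left_sums[OF t I])
    show "(\<lambda>\<omega>. \<sigma> * X s \<omega>) \<in> borel_measurable (F (ennreal s))" if "0 \<le> s" for s
      using X_adapted[OF that] by measurable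
    show "continuous_on {0..} (\<lambda>s. \<sigma> * X s \<omega>)" if "\<omega> \<in> space M" for \<omega>
      by (intro continuous_intros X_continuous[OF that])
  qed
  ultimately have lim0: "(\<lambda>n. trunc_mean M (\<lambda>\<omega>. D n \<omega> - d \<omega>) + trunc_mean M (\<lambda>\<omega>. E n \<omega> - I t \<omega>)) \<longlonglongrightarrow> 0"
    using tendsto_add[of _ 0 _ _ 0] by force
  have le: "trunc_mean M (R n) \<le> trunc_mean M (\<lambda>\<omega>. D n \<omega> - d \<omega>) + trunc_mean M (\<lambda>\<omega>. E n \<omega> - I t \<omega>)" for n
  proof (rule trunc_mean_le_add)
    show "AE \<omega> in M. \<bar>R n \<omega>\<bar> \<le> \<bar>D n \<omega> - d \<omega>\<bar> + \<bar>E n \<omega> - I t \<omega>\<bar>"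
      using eq
    proof eventually_elim
      case (elim \<omega>)
      have "(\<Sum>i<Suc n. X (real i * h n) \<omega> * (\<alpha> * h n + \<sigma> * increment W (h n) i \<omega>)) = D n \<omega> + E n \<omega>"
        unfolding D_def E_def sum.distrib[symmetric] by (intro sum.cong refl) (simp add: algebra_simps)
      then have "R n \<omega> = - (D n \<omega> - d \<omega>) - (E n \<omega> - I t \<omega>)"
        unfolding R_def using elim by (simp add: d_def)
      then show ?case by linarith
    qed
  qed auto
  have "(\<lambda>n. trunc_mean M (R n)) \<longlonglongrightarrow> 0"
    by (rule trunc_mean_tendsto_zero_le[OF le lim0])
  then show ?thesis unfolding R_def h_def .
qed

text \<open>
  Uniqueness gives equality at each fixed time; countably many times suffice by continuity of the paths.
\<close>

theorem AE_X_eq_geometric_path: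
  "AE \<omega> in M. \<forall>t\<ge>0. X t \<omega> = geometric_path W \<alpha> \<sigma> x t \<omega>"
proof -
  define Z where "Z = geometric_path W \<alpha> \<sigma> x"
  have ZF: "Z s \<in> borel_measurable (F (ennreal s))" if "0 \<le> s" for s
    unfolding Z_def by (rule geometric_path_adapted[OF that])
  have Zc: "continuous_on {0..} (\<lambda>s. Z s \<omega>)" if "\<omega> \<in> space M" for \<omega>
    unfolding Z_def geometric_path_def by (intro continuous_intros W_continuous[OF that])
  have Z0: "AE \<omega> in M. Z 0 \<omega> = x"
    using W_0 by eventually_elim (simp add: Z_def geometric_path_def)
  have each: "AE \<omega> in M. X T \<omega> - Z T \<omega> = 0" if T: "0 \<le> T" for T
  proof (rule linear_sde_unique[where U="\<lambda>t \<omega>. X t \<omega> - Z t \<omega>", OF _ _ _ _ T])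
    show "(\<lambda>\<omega>. X s \<omega> - Z s \<omega>) \<in> borel_measurable (F (ennreal s))" if "0 \<le> s" for s
      using X_adapted[OF that] ZF[OF that] by measurable
    show "continuous_on {0..} (\<lambda>s. X s \<omega> - Z s \<omega>)" if "\<omega> \<in> space M" for \<omega>
      by (intro continuous_intros X_continuous[OF that] Zc[OF that])
    show "AE \<omega> in M. X 0 \<omega> - Z 0 \<omega> = 0"
      using X_0 Z0 by eventually_elim simp
    fix t :: real assume t: "0 < t"
    define h where "h n = t / Suc n" for n
    have h: "0 < h n" for n using t by (simp add: h_def)
    have [measurable]: "increment W (h n) i \<in> borel_measurable M" for n i
      using h(1)[of n] by (simp add: increment_measurable)
    define S where "S V n \<omega> = (\<Sum>i<Suc n. V (real i * h n) \<omega> * (\<alpha> * h n + \<sigma> * increment W (h n) i \<omega>))"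
      for V :: "real \<Rightarrow> 'a \<Rightarrow> real" and n \<omega>
    have SM: "S V n \<in> borel_measurable M" if "\<And>s. 0 \<le> s \<Longrightarrow> V s \<in> borel_measurable (F (ennreal s))" for V n
      unfolding S_def using h[of n] measurable_F[OF that]
      by (intro borel_measurable_sum borel_measurable_times) auto
    have [measurable]: "X t \<in> borel_measurable M" "Z t \<in> borel_measurable M" "Z 0 \<in> borel_measurable M"
      "S X n \<in> borel_measurable M" "S Z n \<in> borel_measurable M" for n
      using measurable_F[OF X_adapted[of t]] measurable_F[OF ZF] t SM[of X, OF X_adapted] SM[of Z, OF ZF] by auto
    let ?x = "\<lambda>n. trunc_mean M (\<lambda>\<omega>. X t \<omega> - x - S X n \<omega>)"
    let ?z = "\<lambda>n. trunc_mean M (\<lambda>\<omega>. Z t \<omega> - Z 0 \<omega> - S Z n \<omega>)"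
    have "?x \<longlonglongrightarrow> 0" unfolding S_def h_def by (rule solution_left_sums[OF t])
    moreover have "?z \<longlonglongrightarrow> 0" unfolding S_def h_def Z_def by (rule geometric_path_left_sums[OF t])
    ultimately have lim: "(\<lambda>n. ?x n + ?z n) \<longlonglongrightarrow> 0"
      using tendsto_add[of ?x 0 _ ?z 0] by simp
    have split: "S (\<lambda>s \<omega>. X s \<omega> - Z s \<omega>) n \<omega> = S X n \<omega> - S Z n \<omega>" for n \<omega>
      unfolding S_def by (simp only: left_diff_distrib sum_subtractf)
    have le: "trunc_mean M (\<lambda>\<omega>. X t \<omega> - Z t \<omega> - S (\<lambda>s \<omega>. X s \<omega> - Z s \<omega>) n \<omega>) \<le> ?x n + ?z n" for n
    proof (rule trunc_mean_le_add)
      show "AE \<omega> in M. \<bar>X t \<omega> - Z t \<omega> - S (\<lambda>s \<omega>. X s \<omega> - Z s \<omega>) n \<omega>\<bar>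
          \<le> \<bar>X t \<omega> - x - S X n \<omega>\<bar> + \<bar>Z t \<omega> - Z 0 \<omega> - S Z n \<omega>\<bar>"
        using Z0 unfolding split by eventually_elim linarith
    qed (unfold split, measurable)
    have "(\<lambda>n. trunc_mean M (\<lambda>\<omega>. X t \<omega> - Z t \<omega> - S (\<lambda>s \<omega>. X s \<omega> - Z s \<omega>) n \<omega>)) \<longlonglongrightarrow> 0"
      by (rule trunc_mean_tendsto_zero_le[OF le lim])
    then show "(\<lambda>n. trunc_mean M (\<lambda>\<omega>. X t \<omega> - Z t \<omega> - (\<Sum>i<Suc n. (X (real i * (t / Suc n)) \<omega> - Z (real i * (t / Suc n)) \<omega>)
        * (\<alpha> * (t / Suc n) + \<sigma> * increment W (t / Suc n) i \<omega>)))) \<longlonglongrightarrow> 0"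
      unfolding S_def h_def .
  qed
  have "AE \<omega> in M. \<forall>q\<in>\<rat> \<inter> {0..}. X q \<omega> - Z q \<omega> = 0"
    using each by (subst AE_ball_countable) (auto intro: countable_subset[OF _ countable_rat])
  then show ?thesis
    using AE_space
  proof eventually_elim
    case (elim \<omega>)
    show ?case
    proof (intro allI impI)
      fix t :: real assume t: "0 \<le> t"
      have "continuous_on {0..t} (\<lambda>s. X s \<omega> - Z s \<omega>)"
        by (intro continuous_intros continuous_on_subset[OF X_continuous[OF elim(2)]]
            continuous_on_subset[OF Zc[OF elim(2)]]) auto
      then have "\<bar>X t \<omega> - Z t \<omega>\<bar> \<le> 0"
        by (rule le_on_interval_if_le_on_rationals) (use elim(1) t in auto)
      then show "X t \<omega> = geometric_path W \<alpha> \<sigma> x t \<omega>" by (simp add: Z_def)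
    qed
  qed
qed

end

section \<open>Optional stopping of exponential martingales\<close>

text \<open>
  Since \<open>y - y\<^sup>2 / C \<le> min y C \<le> y\<close> for \<open>y \<ge> 0\<close>, cutting at the level \<open>C\<close> loses at most \<open>B / C\<close> uniformly in \<open>n\<close>,
  and expectations of the cut variables converge.
\<close>

lemma (in prob_space) has_bochner_integral_limit_L2_bounded:
  fixes Y :: "nat \<Rightarrow> 'a \<Rightarrow> real"
  assumes Y: "\<And>n. has_bochner_integral M (Y n) c"
    and Y0: "\<And>n \<omega>. \<omega> \<in> space M \<Longrightarrow> 0 \<le> Y n \<omega>"
    and Y2: "\<And>n. integrable M (\<lambda>\<omega>. (Y n \<omega>)\<^sup>2)" "\<And>n. (\<integral>\<omega>. (Y n \<omega>)\<^sup>2 \<partial>M) \<le> B"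
    and lim: "\<And>\<omega>. \<omega> \<in> space M \<Longrightarrow> (\<lambda>n. Y n \<omega>) \<longlonglongrightarrow> Z \<omega>"
  shows "has_bochner_integral M Z c"
proof -
  have YM[measurable]: "Y n \<in> borel_measurable M" for n
    using Y by (auto dest: has_bochner_integral_iff[THEN iffD1])
  have ZM[measurable]: "Z \<in> borel_measurable M"
    by (rule borel_measurable_LIMSEQ_real[OF lim YM])
  have Z0: "0 \<le> Z \<omega>" if "\<omega> \<in> space M" for \<omega>
    using lim[OF that] Y0[OF that] by (intro LIMSEQ_le_const) auto
  have int: "integrable M (\<lambda>\<omega>. min (V \<omega>) C)"
    if "V \<in> borel_measurable M" "\<And>\<omega>. \<omega> \<in> space M \<Longrightarrow> 0 \<le> V \<omega>" "0 \<le> C" for V and C :: real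
    using that by (intro integrable_const_bound[where B=C]) (auto intro!: AE_I2)
  let ?m = "\<lambda>C. \<integral>\<omega>. min (Z \<omega>) C \<partial>M"
  have mlim: "(\<lambda>n. \<integral>\<omega>. min (Y n \<omega>) C \<partial>M) \<longlonglongrightarrow> ?m C" if C: "0 \<le> C" for C
    by (rule integral_dominated_convergence[where w="\<lambda>_. C"])
      (use C Y0 lim in \<open>auto intro!: AE_I2 tendsto_min\<close>)
  have up: "?m C \<le> c" if C: "0 \<le> C" for C
  proof (rule LIMSEQ_le_const2[OF mlim[OF C]], intro exI allI impI)
    fix n
    have "(\<integral>\<omega>. min (Y n \<omega>) C \<partial>M) \<le> (\<integral>\<omega>. Y n \<omega> \<partial>M)"
      using Y[of n] C Y0 by (intro integral_mono int) (auto simp: has_bochner_integral_iff)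
    then show "(\<integral>\<omega>. min (Y n \<omega>) C \<partial>M) \<le> c" using Y[of n] by (simp add: has_bochner_integral_iff)
  qed
  have low: "c - B / C \<le> ?m C" if C: "0 < C" for C
  proof (rule LIMSEQ_le_const[OF mlim], use C in simp, intro exI allI impI)
    fix n
    have pw: "Y n \<omega> - (Y n \<omega>)\<^sup>2 / C \<le> min (Y n \<omega>) C" for \<omega>
    proof (cases "Y n \<omega> \<le> C")
      case False
      then have "Y n \<omega> * C \<le> (Y n \<omega>)\<^sup>2" using C unfolding power2_eq_square by (intro mult_left_mono) auto
      then have "Y n \<omega> \<le> (Y n \<omega>)\<^sup>2 / C" using C by (simp add: pos_le_divide_eq)
      then show ?thesis using False C by simp
    qed (use C in simp)
    have "c - B / C \<le> c - (\<integral>\<omega>. (Y n \<omega>)\<^sup>2 \<partial>M) / C"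
      using Y2(2)[of n] C by (simp add: divide_right_mono)
    also have "\<dots> = (\<integral>\<omega>. Y n \<omega> - (Y n \<omega>)\<^sup>2 / C \<partial>M)"
      using Y[of n] Y2(1)[of n] by (simp add: has_bochner_integral_iff)
    also have "\<dots> \<le> (\<integral>\<omega>. min (Y n \<omega>) C \<partial>M)"
      using Y[of n] Y2(1)[of n] C Y0 pw by (intro integral_mono int) (auto simp: has_bochner_integral_iff)
    finally show "c - B / C \<le> (\<integral>\<omega>. min (Y n \<omega>) C \<partial>M)" .
  qed
  have "(\<lambda>n. c - B * inverse (real (Suc n))) \<longlonglongrightarrow> c - B * 0"
    by (intro tendsto_diff tendsto_mult tendsto_const LIMSEQ_inverse_real_of_nat)
  then have clim: "(\<lambda>n. c - B * inverse (real (Suc n))) \<longlonglongrightarrow> c" by simp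
  have mc: "(\<lambda>n. ?m (real (Suc n))) \<longlonglongrightarrow> c"
    by (rule real_tendsto_sandwich[OF _ _ clim tendsto_const])
      (use low[of "real (Suc _)"] up[of "real (Suc _)"] in \<open>auto intro!: always_eventually simp: divide_inverse\<close>)
  have zlim: "AE \<omega> in M. (\<lambda>n. min (Z \<omega>) (real (Suc n))) \<longlonglongrightarrow> Z \<omega>"
  proof (rule AE_I2)
    fix \<omega>
    obtain N where N: "Z \<omega> \<le> real N" using real_arch_simple by blast
    have "\<forall>\<^sub>F n in sequentially. min (Z \<omega>) (real (Suc n)) = Z \<omega>"
      using N by (intro eventually_sequentiallyI[of N]) (auto simp: min_def)
    then show "(\<lambda>n. min (Z \<omega>) (real (Suc n))) \<longlonglongrightarrow> Z \<omega>" by (rule tendsto_eventually)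
  qed
  have i: "integrable M (\<lambda>\<omega>. min (Z \<omega>) (real (Suc n)))" for n
    using Z0 by (intro int) auto
  have mono: "AE \<omega> in M. mono (\<lambda>n. min (Z \<omega>) (real (Suc n)))"
    by (intro AE_I2 monoI) auto
  show ?thesis
    unfolding has_bochner_integral_iff
    using integrable_monotone_convergence[OF i mono zlim mc ZM]
      integral_monotone_convergence[OF i mono zlim mc ZM] by simp
qed

context brownian_motion
begin

definition exp_martingale :: "real \<Rightarrow> real \<Rightarrow> 'a \<Rightarrow> real" where
  "exp_martingale \<theta> t \<omega> = exp (\<theta> * W t \<omega> - \<theta>\<^sup>2 / 2 * t)"

lemma exp_martingale_pos: "0 < exp_martingale \<theta> t \<omega>"
  by (simp add: exp_martingale_def)

lemma exp_martingale_adapted: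
  "0 \<le> t \<Longrightarrow> exp_martingale \<theta> t \<in> borel_measurable (F (ennreal t))"
  using W_adapted[of t] unfolding exp_martingale_def by measurable

lemma exp_martingale_continuous:
  "\<omega> \<in> space M \<Longrightarrow> continuous_on {0..} (\<lambda>t. exp_martingale \<theta> t \<omega>)"
  unfolding exp_martingale_def by (intro continuous_intros W_continuous) auto

lemma has_bochner_integral_exp_martingale:
  assumes "0 \<le> t"
  shows "has_bochner_integral M (exp_martingale \<theta> t) 1"
proof -
  have "has_bochner_integral M (\<lambda>\<omega>. exp (- \<theta>\<^sup>2 / 2 * t) * exp (\<theta> * W t \<omega>)) (exp (- \<theta>\<^sup>2 / 2 * t) * exp (\<theta>\<^sup>2 * t / 2))"
    by (intro has_bochner_integral_mult_right has_bochner_integral_exp_W assms)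
  then show ?thesis
    by (simp add: exp_martingale_def[abs_def] exp_add[symmetric] algebra_simps)
qed

text \<open>
  The martingale property, tested on an event of the past: the factor between the times \<open>s\<close> and \<open>t\<close> is
  independent of the past and has mean \<open>1\<close>.
\<close>

lemma exp_martingale_past:
  assumes st: "0 \<le> s" "s \<le> t" and A: "A \<in> sets (F (ennreal s))"
  shows "(\<integral>\<omega>. indicator A \<omega> * exp_martingale \<theta> t \<omega> \<partial>M) = (\<integral>\<omega>. indicator A \<omega> * exp_martingale \<theta> s \<omega> \<partial>M)"
proof (cases "s = t")
  case False
  then have st: "0 \<le> s" "s < t" using st by auto
  let ?Y = "\<lambda>\<omega>. indicator A \<omega> * exp_martingale \<theta> s \<omega>"
  let ?f = "\<lambda>y. exp (- \<theta>\<^sup>2 / 2 * (t - s)) * exp (\<theta> * y)"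
  have AM: "A \<in> sets M" using A subalgebra_F[of "ennreal s"] by (auto simp: subalgebra_def)
  have YF: "?Y \<in> borel_measurable (F (ennreal s))"
    using exp_martingale_adapted[OF st(1)] A by measurable
  have Y: "integrable M ?Y"
    using integrable_mult_indicator[OF AM integrable.intros[OF has_bochner_integral_exp_martingale[OF st(1)]]]
    by simp
  have "has_bochner_integral lborel (\<lambda>y. exp (- \<theta>\<^sup>2 / 2 * (t - s)) * (normal_density 0 (sqrt (t - s)) y * exp (\<theta> * y)))
      (exp (- \<theta>\<^sup>2 / 2 * (t - s)) * exp (\<theta>\<^sup>2 * (sqrt (t - s))\<^sup>2 / 2))"
    using st by (intro has_bochner_integral_mult_right has_bochner_integral_normal_exp) auto
  moreover have "exp (- \<theta>\<^sup>2 / 2 * (t - s)) * exp (\<theta>\<^sup>2 * (sqrt (t - s))\<^sup>2 / 2) = 1"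
    using st by (simp add: exp_add[symmetric] field_simps)
  ultimately have I: "has_bochner_integral lborel (\<lambda>y. normal_density 0 (sqrt (t - s)) y * ?f y) 1"
    by (simp only: mult.left_commute)
  have "has_bochner_integral M (\<lambda>\<omega>. ?Y \<omega> * ?f (W t \<omega> - W s \<omega>)) (integral\<^sup>L M ?Y * 1)"
    by (rule has_bochner_integral_past_increment[OF st YF Y _ I]) measurable
  moreover have "?Y \<omega> * ?f (W t \<omega> - W s \<omega>) = indicator A \<omega> * exp_martingale \<theta> t \<omega>" for \<omega>
  proof -
    have "\<theta> * W s \<omega> - \<theta>\<^sup>2 / 2 * s + (- \<theta>\<^sup>2 / 2 * (t - s) + \<theta> * (W t \<omega> - W s \<omega>)) = \<theta> * W t \<omega> - \<theta>\<^sup>2 / 2 * t"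
      by (simp add: field_simps)
    then show ?thesis by (simp only: exp_martingale_def mult.assoc exp_add[symmetric])
  qed
  ultimately have "has_bochner_integral M (\<lambda>\<omega>. indicator A \<omega> * exp_martingale \<theta> t \<omega>) (integral\<^sup>L M ?Y * 1)"
    by (simp only:)
  then show ?thesis by (simp add: has_bochner_integral_iff)
qed simp

text \<open>
  On the event \<open>k = j\<close>, which belongs to the past at time \<open>j h\<close>, the martingale may be evaluated at the final time
  \<open>N h\<close> instead.
\<close>

lemma exp_martingale_grid_stopping:
  fixes k :: "'a \<Rightarrow> nat"
  assumes h: "0 \<le> h" and k: "\<And>j. {\<omega> \<in> space M. k \<omega> = j} \<in> sets (F (ennreal (real j * h)))"
    and N: "\<And>\<omega>. \<omega> \<in> space M \<Longrightarrow> k \<omega> \<le> N"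
  shows "has_bochner_integral M (\<lambda>\<omega>. exp_martingale \<theta> (real (k \<omega>) * h) \<omega>) 1"
proof -
  let ?A = "\<lambda>j. {\<omega> \<in> space M. k \<omega> = j}"
  let ?E = "\<lambda>j. exp_martingale \<theta> (real j * h)"
  have AM: "?A j \<in> sets M" for j
    using k[of j] subalgebra_F[of "ennreal (real j * h)"] by (auto simp: subalgebra_def)
  have E: "has_bochner_integral M (?E j) 1" for j
    using h by (intro has_bochner_integral_exp_martingale) auto
  have i: "integrable M (\<lambda>\<omega>. indicator (?A j) \<omega> * ?E i \<omega>)" for i j
    using integrable_mult_indicator[OF AM[of j] integrable.intros[OF E[of i]]] by simp
  have pw: "(\<Sum>j\<le>N. indicator (?A j) \<omega> * g j) = g (k \<omega>)" if "\<omega> \<in> space M" for g :: "nat \<Rightarrow> real" and \<omega>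
  proof -
    have "(\<Sum>j\<le>N. indicator (?A j) \<omega> * g j) = (\<Sum>j\<le>N. if k \<omega> = j then g j else 0)"
      using that by (intro sum.cong) (auto simp: indicator_def)
    then show ?thesis using N[OF that] by simp
  qed
  have "has_bochner_integral M (\<lambda>\<omega>. \<Sum>j\<le>N. indicator (?A j) \<omega> * ?E j \<omega>)
      (\<Sum>j\<le>N. \<integral>\<omega>. indicator (?A j) \<omega> * ?E j \<omega> \<partial>M)"
    using i by (intro has_bochner_integral_sum) (auto simp: has_bochner_integral_iff)
  also have "(\<Sum>j\<le>N. \<integral>\<omega>. indicator (?A j) \<omega> * ?E j \<omega> \<partial>M) = (\<Sum>j\<le>N. \<integral>\<omega>. indicator (?A j) \<omega> * ?E N \<omega> \<partial>M)"
    using h k by (intro sum.cong refl exp_martingale_past[symmetric]) (auto intro: mult_right_mono)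
  also have "\<dots> = (\<integral>\<omega>. (\<Sum>j\<le>N. indicator (?A j) \<omega> * ?E N \<omega>) \<partial>M)"
    using i by (subst Bochner_Integration.integral_sum) auto
  also have "\<dots> = (\<integral>\<omega>. ?E N \<omega> \<partial>M)"
    by (rule Bochner_Integration.integral_cong[OF refl]) (rule pw)
  also have "\<dots> = 1" using E[of N] by (simp add: has_bochner_integral_iff)
  finally have "has_bochner_integral M (\<lambda>\<omega>. \<Sum>j\<le>N. indicator (?A j) \<omega> * ?E j \<omega>) 1" .
  then show ?thesis
    by (subst has_bochner_integral_cong[OF refl _ refl, where g="\<lambda>\<omega>. \<Sum>j\<le>N. indicator (?A j) \<omega> * ?E j \<omega>"])
      (use pw in auto)
qed

text \<open>
  The time \<open>\<tau>\<close> is approximated from above by grid-valued stopping times \<open>k n * h n\<close>. The square of the martingale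
  with parameter \<open>\<theta>\<close> is \<open>exp (\<theta>\<^sup>2 t)\<close> times the one with parameter \<open>2 \<theta>\<close>, and this bounds the second moments.
\<close>

theorem exp_martingale_optional_stopping:
  fixes \<tau> :: "'a \<Rightarrow> real"
  assumes \<tau>: "\<And>t. 0 \<le> t \<Longrightarrow> {\<omega> \<in> space M. \<tau> \<omega> \<le> t} \<in> sets (F (ennreal t))"
    and bounds: "\<And>\<omega>. \<omega> \<in> space M \<Longrightarrow> 0 \<le> \<tau> \<omega>" "\<And>\<omega>. \<omega> \<in> space M \<Longrightarrow> \<tau> \<omega> \<le> T"
  shows "has_bochner_integral M (\<lambda>\<omega>. exp_martingale \<theta> (\<tau> \<omega>) \<omega>) 1"
proof -
  \<comment> \<open>A positive time horizon, so that the mesh is positive even if \<open>T = 0\<close>.\<close>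
  define S where "S = max T 1"
  have S: "0 < S" "\<And>\<omega>. \<omega> \<in> space M \<Longrightarrow> \<tau> \<omega> \<le> S" using bounds by (auto simp: S_def intro: max.coboundedI1)
  define h where "h n = S / Suc n" for n
  have h: "0 < h n" "real (Suc n) * h n = S" for n using S by (auto simp: h_def)
  define k where "k n \<omega> = nat \<lceil>\<tau> \<omega> / h n\<rceil>" for n \<omega>
  have k_le: "k n \<omega> \<le> j \<longleftrightarrow> \<tau> \<omega> \<le> real j * h n" if "\<omega> \<in> space M" for n j \<omega>
  proof -
    have "k n \<omega> \<le> j \<longleftrightarrow> \<tau> \<omega> / h n \<le> real j"
      unfolding k_def by (simp add: nat_le_iff ceiling_le_iff)
    then show ?thesis using h(1)[of n] by (simp add: pos_divide_le_eq)
  qed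
  have kS: "k n \<omega> \<le> Suc n" if "\<omega> \<in> space M" for n \<omega>
    using k_le[OF that] S(2)[OF that] h(2)[of n] by simp
  have kh: "\<tau> \<omega> \<le> real (k n \<omega>) * h n" "real (k n \<omega>) * h n \<le> \<tau> \<omega> + h n" if "\<omega> \<in> space M" for n \<omega>
  proof -
    show "\<tau> \<omega> \<le> real (k n \<omega>) * h n" using k_le[OF that] by blast
    have "real (k n \<omega>) \<le> \<tau> \<omega> / h n + 1"
      unfolding k_def using bounds(1)[OF that] h(1)[of n] by (simp add: of_nat_nat)
    then show "real (k n \<omega>) * h n \<le> \<tau> \<omega> + h n" using h(1)[of n] by (simp add: field_simps)
  qed
  have kF: "{\<omega> \<in> space M. k n \<omega> = j} \<in> sets (F (ennreal (real j * h n)))" for n j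
  proof (cases j)
    case 0
    then have "{\<omega> \<in> space M. k n \<omega> = j} = {\<omega> \<in> space M. \<tau> \<omega> \<le> 0}" using k_le[of _ n 0] by auto
    then show ?thesis using \<tau>[of 0] 0 by simp
  next
    case (Suc i)
    have "{\<omega> \<in> space M. k n \<omega> = j} = {\<omega> \<in> space M. k n \<omega> \<le> Suc i} - {\<omega> \<in> space M. k n \<omega> \<le> i}"
      using Suc by auto
    also have "\<dots> = {\<omega> \<in> space M. \<tau> \<omega> \<le> real (Suc i) * h n} - {\<omega> \<in> space M. \<tau> \<omega> \<le> real i * h n}"
      using k_le by auto
    finally have eq: "{\<omega> \<in> space M. k n \<omega> = j}
        = {\<omega> \<in> space M. \<tau> \<omega> \<le> real (Suc i) * h n} - {\<omega> \<in> space M. \<tau> \<omega> \<le> real i * h n}" .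
    have "sets (F (ennreal (real i * h n))) \<subseteq> sets (F (ennreal (real j * h n)))"
      using h(1)[of n] Suc by (intro sets_F_mono ennreal_leI mult_right_mono) auto
    moreover have "{\<omega> \<in> space M. \<tau> \<omega> \<le> real i * h n} \<in> sets (F (ennreal (real i * h n)))"
      "{\<omega> \<in> space M. \<tau> \<omega> \<le> real (Suc i) * h n} \<in> sets (F (ennreal (real j * h n)))"
      using h(1)[of n] Suc \<tau>[of "real i * h n"] \<tau>[of "real (Suc i) * h n"] by auto
    ultimately show ?thesis unfolding eq by blast
  qed
  have E: "has_bochner_integral M (\<lambda>\<omega>. exp_martingale \<eta> (real (k n \<omega>) * h n) \<omega>) 1" for n \<eta>
    by (rule exp_martingale_grid_stopping[OF _ kF kS]) (use h(1)[of n] in auto)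
  let ?Y = "\<lambda>n \<omega>. exp_martingale \<theta> (real (k n \<omega>) * h n) \<omega>"
  have sq: "(?Y n \<omega>)\<^sup>2 \<le> exp (\<theta>\<^sup>2 * S) * exp_martingale (2 * \<theta>) (real (k n \<omega>) * h n) \<omega>" if "\<omega> \<in> space M" for n \<omega>
  proof -
    let ?t = "real (k n \<omega>) * h n"
    have "real (k n \<omega>) \<le> real (Suc n)" using kS[OF that] by (simp only: of_nat_le_iff)
    from mult_right_mono[OF this less_imp_le[OF h(1)]] have "?t \<le> real (Suc n) * h n" .
    then have "\<theta>\<^sup>2 * ?t \<le> \<theta>\<^sup>2 * S" unfolding h(2) by (intro mult_left_mono) auto
    moreover have "(?Y n \<omega>)\<^sup>2 = exp (\<theta>\<^sup>2 * ?t) * exp_martingale (2 * \<theta>) ?t \<omega>"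
      unfolding exp_martingale_def exp_double[symmetric] exp_add[symmetric]
      by (simp add: power_mult_distrib algebra_simps)
    ultimately show ?thesis using exp_martingale_pos by (auto intro!: mult_right_mono less_imp_le)
  qed
  have YM: "?Y n \<in> borel_measurable M" for n using E[of \<theta> n] by (auto simp: has_bochner_integral_iff)
  have dom: "has_bochner_integral M (\<lambda>\<omega>. exp (\<theta>\<^sup>2 * S) * exp_martingale (2 * \<theta>) (real (k n \<omega>) * h n) \<omega>) (exp (\<theta>\<^sup>2 * S) * 1)" for n
    by (intro has_bochner_integral_mult_right E)
  show ?thesis
  proof (rule has_bochner_integral_limit_L2_bounded[where Y="?Y" and B="exp (\<theta>\<^sup>2 * S)"])
    show "has_bochner_integral M (?Y n) 1" for n by (rule E)
    show "0 \<le> ?Y n \<omega>" for n \<omega> using exp_martingale_pos by (rule less_imp_le)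
    show int: "integrable M (\<lambda>\<omega>. (?Y n \<omega>)\<^sup>2)" for n
      by (rule Bochner_Integration.integrable_bound[OF integrable.intros[OF dom]])
        (use YM sq in \<open>auto intro!: AE_I2 order_trans[OF _ abs_ge_self]\<close>)
    have "(\<integral>\<omega>. (?Y n \<omega>)\<^sup>2 \<partial>M) \<le> (\<integral>\<omega>. exp (\<theta>\<^sup>2 * S) * exp_martingale (2 * \<theta>) (real (k n \<omega>) * h n) \<omega> \<partial>M)" for n
      using sq by (intro integral_mono int integrable.intros[OF dom]) auto
    then show "(\<integral>\<omega>. (?Y n \<omega>)\<^sup>2 \<partial>M) \<le> exp (\<theta>\<^sup>2 * S)" for n
      unfolding has_bochner_integral_integral_eq[OF dom] by simp
    fix \<omega> assume \<omega>: "\<omega> \<in> space M"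
    have "(\<lambda>n. S / Suc n) \<longlonglongrightarrow> 0" by (rule mesh_tendsto_zero)
    then have up: "(\<lambda>n. \<tau> \<omega> + h n) \<longlonglongrightarrow> \<tau> \<omega>"
      unfolding h_def using tendsto_add[OF tendsto_const[of "\<tau> \<omega>"]] by fastforce
    have lim: "(\<lambda>n. real (k n \<omega>) * h n) \<longlonglongrightarrow> \<tau> \<omega>"
      by (rule real_tendsto_sandwich[OF _ _ tendsto_const up])
        (intro always_eventually allI kh[OF \<omega>])+
    show "(\<lambda>n. ?Y n \<omega>) \<longlonglongrightarrow> exp_martingale \<theta> (\<tau> \<omega>) \<omega>"
      by (rule continuous_on_tendsto_sequence[OF exp_martingale_continuous[OF \<omega>] _ _ lim])
        (use h(1) bounds(1)[OF \<omega>] in \<open>auto simp: less_imp_le\<close>)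
  qed
qed

end

section \<open>Expected discounted profit up to a stopping time\<close>

text \<open>
  Vanishes at negative times, so that integrals over \<open>[0, \<infinity>)\<close> can be taken over the whole line.
\<close>

definition discount :: "real \<Rightarrow> real \<Rightarrow> real" where
  "discount \<delta> s = indicator {0..} s * exp (- \<delta> * s)"

lemma discount_nonneg [simp]: "0 \<le> discount \<delta> s"
  by (simp add: discount_def)

lemma borel_measurable_discount [measurable]: "discount \<delta> \<in> borel_measurable borel"
  unfolding discount_def[abs_def] by measurable

lemma integrable_discount:
  assumes "0 < \<delta>"
  shows "integrable lborel (discount \<delta>)"
proof -
  have "integrable lborel (\<lambda>s. indicator {0<..} s * exp (- (s * \<delta>)))"
    using integrable_I0i_exp_mscale[OF assms] by (simp add: set_integrable_def)
  moreover have "AE s in lborel. discount \<delta> s = indicator {0<..} s * exp (- (s * \<delta>))"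
    using AE_lborel_singleton[of 0] by eventually_elim (auto simp: discount_def indicator_def)
  ultimately show ?thesis by (subst integrable_cong_AE) auto
qed

lemma integral_discount_atMost:
  assumes \<delta>: "0 < \<delta>" and a: "0 \<le> a"
  shows "(\<integral>s. indicator {..a} s * discount \<delta> s \<partial>lborel) = (1 - exp (- \<delta> * a)) / \<delta>"
proof -
  have eq: "indicator {..a} s * discount \<delta> s = indicator {0..a} s *\<^sub>R exp (- \<delta> * s)" for s
    by (auto simp: discount_def indicator_def)
  have "(\<integral>s. indicator {0..a} s *\<^sub>R exp (- \<delta> * s) \<partial>lborel) = - exp (- \<delta> * a) / \<delta> - (- exp (- \<delta> * 0) / \<delta>)"
    using \<delta> a
    by (intro integral_FTC_atLeastAtMost)
       (auto intro!: derivative_eq_intros continuous_intros simp: has_real_derivative_iff_has_vector_derivative[symmetric])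
  then show ?thesis unfolding eq using \<delta> by (simp add: field_simps)
qed

text \<open>
  Rounding the time down to a grid leaves countably many random variables. The argument \<open>max 0 s\<close>
  extends the process to all real times, where the measure \<open>lborel\<close> lives.
\<close>

lemma borel_measurable_continuous_process:
  fixes V :: "real \<Rightarrow> 'a \<Rightarrow> real"
  assumes V: "\<And>s. 0 \<le> s \<Longrightarrow> V s \<in> borel_measurable M"
    and Vc: "\<And>\<omega>. \<omega> \<in> space M \<Longrightarrow> continuous_on {0..} (\<lambda>s. V s \<omega>)"
  shows "(\<lambda>(s, \<omega>). V (max 0 s) \<omega>) \<in> borel_measurable (borel \<Otimes>\<^sub>M M)"
proof -
  define g where "g n s = nat \<lfloor>max 0 s / (1 / Suc n)\<rfloor>" for n :: nat and s :: real
  have g_lim: "(\<lambda>n. real (g n s) * (1 / Suc n)) \<longlonglongrightarrow> max 0 s" for s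
    unfolding g_def by (rule floor_grid_tendsto) auto
  have lim: "(\<lambda>n. V (real (g n s) * (1 / Suc n)) \<omega>) \<longlonglongrightarrow> V (max 0 s) \<omega>" if "\<omega> \<in> space M" for s \<omega>
    by (rule continuous_on_tendsto_sequence[OF Vc[OF that] _ _ g_lim]) auto
  have gM: "(\<lambda>p. g n (fst p)) \<in> borel \<Otimes>\<^sub>M M \<rightarrow>\<^sub>M count_space UNIV" for n
    unfolding g_def by measurable
  have "(\<lambda>p. V (real (g n (fst p)) * (1 / Suc n)) (snd p)) \<in> borel_measurable (borel \<Otimes>\<^sub>M M)" for n
  proof (rule measurable_compose_countable[OF _ gM])
    show "(\<lambda>p. V (real i * (1 / Suc n)) (snd p)) \<in> borel_measurable (borel \<Otimes>\<^sub>M M)" for i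
      by (rule measurable_compose[OF measurable_snd V]) simp
  qed
  then have "(\<lambda>p. V (max 0 (fst p)) (snd p)) \<in> borel_measurable (borel \<Otimes>\<^sub>M M)"
    by (rule borel_measurable_LIMSEQ_real[rotated]) (use lim in \<open>auto simp: space_pair_measure\<close>)
  then show ?thesis by (simp add: case_prod_beta')
qed

context brownian_motion
begin

lemma pair_sigma_finite_time: "pair_sigma_finite lborel M"
  by unfold_locales

lemma integrable_discount_times:
  assumes \<delta>: "0 < \<delta>" and V: "integrable M V"
  shows "integrable (lborel \<Otimes>\<^sub>M M) (\<lambda>(s, \<omega>). discount \<delta> s * V \<omega>)"
proof -
  interpret P: pair_sigma_finite lborel M by (rule pair_sigma_finite_time)
  have [measurable]: "V \<in> borel_measurable M" using V by simp
  show ?thesis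
  proof (rule P.Fubini_integrable)
    show "integrable lborel (\<lambda>s. \<integral>\<omega>. norm (case (s, \<omega>) of (s, \<omega>) \<Rightarrow> discount \<delta> s * V \<omega>) \<partial>M)"
      using integrable_discount[OF \<delta>] by (simp add: abs_mult)
  qed (use V in auto)
qed

lemma exp_martingale_jointly_measurable [measurable]:
  "(\<lambda>(s, \<omega>). exp_martingale \<theta> (max 0 s) \<omega>) \<in> borel_measurable (borel \<Otimes>\<^sub>M M)"
  by (rule borel_measurable_continuous_process)
    (use measurable_F[OF exp_martingale_adapted] exp_martingale_continuous in auto)

lemma integrable_discount_exp_martingale:
  assumes \<delta>: "0 < \<delta>"
  shows "integrable (lborel \<Otimes>\<^sub>M M) (\<lambda>(s, \<omega>). discount \<delta> s * exp_martingale \<theta> (max 0 s) \<omega>)"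
proof -
  interpret P: pair_sigma_finite lborel M by (rule pair_sigma_finite_time)
  have E: "has_bochner_integral M (exp_martingale \<theta> (max 0 s)) 1" for s
    by (rule has_bochner_integral_exp_martingale) simp
  show ?thesis
  proof (rule P.Fubini_integrable)
    have "(\<integral>\<omega>. norm (discount \<delta> s * exp_martingale \<theta> (max 0 s) \<omega>) \<partial>M) = discount \<delta> s" for s
      using E[of s] by (simp add: abs_mult has_bochner_integral_iff exp_martingale_pos less_imp_le)
    then show "integrable lborel (\<lambda>s. \<integral>\<omega>. norm (case (s, \<omega>) of (s, \<omega>) \<Rightarrow> discount \<delta> s * exp_martingale \<theta> (max 0 s) \<omega>) \<partial>M)"
      using integrable_discount[OF \<delta>] by simp
    show "AE s in lborel. integrable M (\<lambda>\<omega>. case (s, \<omega>) of (s, \<omega>) \<Rightarrow> discount \<delta> s * exp_martingale \<theta> (max 0 s) \<omega>)"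
      using E by (auto simp: has_bochner_integral_iff)
  qed measurable
qed

text \<open>
  Real-valued, because processes are evaluated at such times; the stopping times of the problem have values in
  \<open>[0, \<infinity>]\<close> and enter through \<open>truncate\<close>.
\<close>

definition bounded_stopping :: "('a \<Rightarrow> real) \<Rightarrow> real \<Rightarrow> bool" where
  "bounded_stopping \<rho> T \<longleftrightarrow> (\<forall>t\<ge>0. {\<omega> \<in> space M. \<rho> \<omega> \<le> t} \<in> sets (F (ennreal t)))
     \<and> (\<forall>\<omega>\<in>space M. 0 \<le> \<rho> \<omega> \<and> \<rho> \<omega> \<le> T)"

lemma bounded_stopping_measurable:
  assumes "bounded_stopping \<rho> T"
  shows "\<rho> \<in> borel_measurable M"
proof (rule borel_measurableI_le)
  fix t :: real
  show "{\<omega> \<in> space M. \<rho> \<omega> \<le> t} \<in> sets M"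
  proof (cases "0 \<le> t")
    case True
    then show ?thesis
      using assms subalgebra_F[of "ennreal t"] by (auto simp: bounded_stopping_def subalgebra_def)
  next
    case False
    then have "{\<omega> \<in> space M. \<rho> \<omega> \<le> t} = {}" using assms by (fastforce simp: bounded_stopping_def)
    then show ?thesis by (simp only: sets.empty_sets)
  qed
qed

lemma bounded_stopping_min:
  assumes \<rho>: "bounded_stopping \<rho> T" and s: "0 \<le> s"
  shows "bounded_stopping (\<lambda>\<omega>. min (\<rho> \<omega>) s) T"
  unfolding bounded_stopping_def
proof (intro conjI allI impI ballI)
  fix t :: real assume t: "0 \<le> t"
  have "{\<omega> \<in> space M. min (\<rho> \<omega>) s \<le> t} = (if s \<le> t then space (F (ennreal t)) else {\<omega> \<in> space M. \<rho> \<omega> \<le> t})"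
    by (auto simp: min_le_iff_disj space_F)
  also have "\<dots> \<in> sets (F (ennreal t))"
    using \<rho> t by (auto simp: bounded_stopping_def simp del: space_F)
  finally show "{\<omega> \<in> space M. min (\<rho> \<omega>) s \<le> t} \<in> sets (F (ennreal t))" .
qed (use \<rho> s in \<open>auto simp: bounded_stopping_def min_le_iff_disj\<close>)

lemma has_bochner_integral_exp_martingale_stopped:
  assumes "bounded_stopping \<rho> T"
  shows "has_bochner_integral M (\<lambda>\<omega>. exp_martingale \<theta> (\<rho> \<omega>) \<omega>) 1"
  using assms by (intro exp_martingale_optional_stopping[of \<rho> T]) (auto simp: bounded_stopping_def)

text \<open>
  Optional stopping at \<open>\<rho>\<close> and at \<open>min \<rho> s\<close> gives the same mean, and the two stopped variables differ only where
  \<open>s \<le> \<rho>\<close>.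
\<close>

lemma expectation_exp_martingale_before_stopping:
  assumes \<rho>: "bounded_stopping \<rho> T" and s: "0 \<le> s"
  shows "(\<integral>\<omega>. of_bool (s \<le> \<rho> \<omega>) * exp_martingale \<theta> s \<omega> \<partial>M)
    = (\<integral>\<omega>. of_bool (s \<le> \<rho> \<omega>) * exp_martingale \<theta> (\<rho> \<omega>) \<omega> \<partial>M)"
proof -
  let ?N = "\<lambda>\<omega>. exp_martingale \<theta> (\<rho> \<omega>) \<omega>" and ?Ns = "exp_martingale \<theta> s"
  have [measurable]: "\<rho> \<in> borel_measurable M" by (rule bounded_stopping_measurable[OF \<rho>])
  have N: "has_bochner_integral M ?N 1" by (rule has_bochner_integral_exp_martingale_stopped[OF \<rho>])
  have Nmin: "has_bochner_integral M (\<lambda>\<omega>. exp_martingale \<theta> (min (\<rho> \<omega>) s) \<omega>) 1"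
    by (rule has_bochner_integral_exp_martingale_stopped[OF bounded_stopping_min[OF \<rho> s]])
  have A: "{\<omega> \<in> space M. s \<le> \<rho> \<omega>} \<in> sets M" by measurable
  have ind: "integrable M (\<lambda>\<omega>. of_bool (s \<le> \<rho> \<omega>) * V \<omega>)" if V: "integrable M V" for V :: "'a \<Rightarrow> real"
  proof -
    have "integrable M (\<lambda>\<omega>. indicator {\<omega> \<in> space M. s \<le> \<rho> \<omega>} \<omega> * V \<omega>)"
      using integrable_mult_indicator[OF A V] by simp
    moreover have "indicator {\<omega> \<in> space M. s \<le> \<rho> \<omega>} \<omega> * V \<omega> = of_bool (s \<le> \<rho> \<omega>) * V \<omega>" if "\<omega> \<in> space M" for \<omega>
      using that by (simp add: indicator_def)
    ultimately show ?thesis by (subst (asm) Bochner_Integration.integrable_cong[OF refl]) auto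
  qed
  have I: "integrable M (\<lambda>\<omega>. of_bool (s \<le> \<rho> \<omega>) * ?N \<omega>)" "integrable M (\<lambda>\<omega>. of_bool (s \<le> \<rho> \<omega>) * ?Ns \<omega>)"
    using N has_bochner_integral_exp_martingale[OF s, of \<theta>] by (auto intro!: ind simp: has_bochner_integral_iff)
  have "1 = (\<integral>\<omega>. exp_martingale \<theta> (min (\<rho> \<omega>) s) \<omega> \<partial>M)"
    using Nmin by (simp add: has_bochner_integral_iff)
  also have "\<dots> = (\<integral>\<omega>. ?N \<omega> + (of_bool (s \<le> \<rho> \<omega>) * ?Ns \<omega> - of_bool (s \<le> \<rho> \<omega>) * ?N \<omega>) \<partial>M)"
    by (intro Bochner_Integration.integral_cong) (auto simp: min_def)
  also have "\<dots> = 1 + ((\<integral>\<omega>. of_bool (s \<le> \<rho> \<omega>) * ?Ns \<omega> \<partial>M) - (\<integral>\<omega>. of_bool (s \<le> \<rho> \<omega>) * ?N \<omega> \<partial>M))"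
    using N I by (simp add: has_bochner_integral_iff)
  finally show ?thesis by simp
qed

lemma integral_discount_until_stopping:
  assumes \<delta>: "0 < \<delta>" and \<rho>: "bounded_stopping \<rho> T" and V: "integrable M V"
  shows "integrable (lborel \<Otimes>\<^sub>M M) (\<lambda>(s, \<omega>). of_bool (s \<le> \<rho> \<omega>) * (discount \<delta> s * V \<omega>))"
    and "(\<integral>(s, \<omega>). of_bool (s \<le> \<rho> \<omega>) * (discount \<delta> s * V \<omega>) \<partial>(lborel \<Otimes>\<^sub>M M))
      = ((\<integral>\<omega>. V \<omega> \<partial>M) - (\<integral>\<omega>. exp (- \<delta> * \<rho> \<omega>) * V \<omega> \<partial>M)) / \<delta>"
proof -
  interpret P: pair_sigma_finite lborel M by (rule pair_sigma_finite_time)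
  have [measurable]: "\<rho> \<in> borel_measurable M" by (rule bounded_stopping_measurable[OF \<rho>])
  have [measurable]: "V \<in> borel_measurable M" using V by simp
  show int: "integrable (lborel \<Otimes>\<^sub>M M) (\<lambda>(s, \<omega>). of_bool (s \<le> \<rho> \<omega>) * (discount \<delta> s * V \<omega>))"
    by (rule Bochner_Integration.integrable_bound[OF integrable_discount_times[OF \<delta> V]])
      (measurable, auto intro!: AE_I2)
  have "integrable M (\<lambda>\<omega>. exp (- \<delta> * \<rho> \<omega>) * V \<omega>)"
  proof (rule Bochner_Integration.integrable_bound[OF V])
    show "AE \<omega> in M. norm (exp (- \<delta> * \<rho> \<omega>) * V \<omega>) \<le> norm (V \<omega>)"
      using \<delta> \<rho> by (intro AE_I2) (auto simp: bounded_stopping_def abs_mult intro!: mult_left_le_one_le)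
  qed measurable
  note int' = this
  have "(\<integral>(s, \<omega>). of_bool (s \<le> \<rho> \<omega>) * (discount \<delta> s * V \<omega>) \<partial>(lborel \<Otimes>\<^sub>M M))
      = (\<integral>\<omega>. (\<integral>s. of_bool (s \<le> \<rho> \<omega>) * (discount \<delta> s * V \<omega>) \<partial>lborel) \<partial>M)"
    using P.integral_snd[OF int] by simp
  also have "\<dots> = (\<integral>\<omega>. (V \<omega> - exp (- \<delta> * \<rho> \<omega>) * V \<omega>) / \<delta> \<partial>M)"
  proof (rule Bochner_Integration.integral_cong[OF refl])
    fix \<omega> assume "\<omega> \<in> space M"
    then have "0 \<le> \<rho> \<omega>" using \<rho> by (auto simp: bounded_stopping_def)
    have "(\<integral>s. of_bool (s \<le> \<rho> \<omega>) * (discount \<delta> s * V \<omega>) \<partial>lborel) = (\<integral>s. (indicator {..\<rho> \<omega>} s * discount \<delta> s) * V \<omega> \<partial>lborel)"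
      by (intro Bochner_Integration.integral_cong) (auto simp: indicator_def)
    also have "\<dots> = (1 - exp (- \<delta> * \<rho> \<omega>)) / \<delta> * V \<omega>"
      using integral_discount_atMost[OF \<delta> \<open>0 \<le> \<rho> \<omega>\<close>] by simp
    finally show "(\<integral>s. of_bool (s \<le> \<rho> \<omega>) * (discount \<delta> s * V \<omega>) \<partial>lborel) = (V \<omega> - exp (- \<delta> * \<rho> \<omega>) * V \<omega>) / \<delta>"
      by (simp add: algebra_simps diff_divide_distrib)
  qed
  also have "\<dots> = ((\<integral>\<omega>. V \<omega> \<partial>M) - (\<integral>\<omega>. exp (- \<delta> * \<rho> \<omega>) * V \<omega> \<partial>M)) / \<delta>"
    using V int' by simp
  finally show "(\<integral>(s, \<omega>). of_bool (s \<le> \<rho> \<omega>) * (discount \<delta> s * V \<omega>) \<partial>(lborel \<Otimes>\<^sub>M M))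
      = ((\<integral>\<omega>. V \<omega> \<partial>M) - (\<integral>\<omega>. exp (- \<delta> * \<rho> \<omega>) * V \<omega> \<partial>M)) / \<delta>" .
qed

text \<open>
  At each time \<open>s\<close> the running martingale may be replaced by its value at \<open>\<rho>\<close> on the event \<open>s \<le> \<rho>\<close>. After
  exchanging the integrals, that value is constant in time and only the discount factor is left to integrate.
\<close>

lemma integral_discount_exp_martingale_until_stopping:
  assumes \<delta>: "0 < \<delta>" and \<rho>: "bounded_stopping \<rho> T"
  shows "(\<integral>(s, \<omega>). of_bool (s \<le> \<rho> \<omega>) * (discount \<delta> s * exp_martingale \<theta> (max 0 s) \<omega>) \<partial>(lborel \<Otimes>\<^sub>M M))
      = (1 - (\<integral>\<omega>. exp (- \<delta> * \<rho> \<omega>) * exp_martingale \<theta> (\<rho> \<omega>) \<omega> \<partial>M)) / \<delta>"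
proof -
  interpret P: pair_sigma_finite lborel M by (rule pair_sigma_finite_time)
  let ?N = "\<lambda>\<omega>. exp_martingale \<theta> (\<rho> \<omega>) \<omega>"
  have [measurable]: "\<rho> \<in> borel_measurable M" by (rule bounded_stopping_measurable[OF \<rho>])
  have N: "integrable M ?N" "(\<integral>\<omega>. ?N \<omega> \<partial>M) = 1"
    using has_bochner_integral_exp_martingale_stopped[OF \<rho>] by (auto simp: has_bochner_integral_iff)
  have int: "integrable (lborel \<Otimes>\<^sub>M M) (\<lambda>(s, \<omega>). of_bool (s \<le> \<rho> \<omega>) * (discount \<delta> s * exp_martingale \<theta> (max 0 s) \<omega>))"
    by (rule Bochner_Integration.integrable_bound[OF integrable_discount_exp_martingale[OF \<delta>, of \<theta>]])
      (measurable, auto intro!: AE_I2)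
  have "(\<integral>(s, \<omega>). of_bool (s \<le> \<rho> \<omega>) * (discount \<delta> s * exp_martingale \<theta> (max 0 s) \<omega>) \<partial>(lborel \<Otimes>\<^sub>M M))
      = (\<integral>s. (\<integral>\<omega>. of_bool (s \<le> \<rho> \<omega>) * (discount \<delta> s * exp_martingale \<theta> (max 0 s) \<omega>) \<partial>M) \<partial>lborel)"
    using P.integral_fst[OF int] by simp
  also have "\<dots> = (\<integral>s. (\<integral>\<omega>. of_bool (s \<le> \<rho> \<omega>) * (discount \<delta> s * ?N \<omega>) \<partial>M) \<partial>lborel)"
  proof (rule Bochner_Integration.integral_cong[OF refl])
    fix s
    show "(\<integral>\<omega>. of_bool (s \<le> \<rho> \<omega>) * (discount \<delta> s * exp_martingale \<theta> (max 0 s) \<omega>) \<partial>M)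
        = (\<integral>\<omega>. of_bool (s \<le> \<rho> \<omega>) * (discount \<delta> s * ?N \<omega>) \<partial>M)"
    proof (cases "0 \<le> s")
      case True
      then show ?thesis
        using expectation_exp_martingale_before_stopping[OF \<rho> True, of \<theta>]
        unfolding mult.left_commute[of _ "discount \<delta> s"] integral_mult_right_zero by (simp add: max_def)
    qed (simp add: discount_def)
  qed
  also have "\<dots> = (\<integral>(s, \<omega>). of_bool (s \<le> \<rho> \<omega>) * (discount \<delta> s * ?N \<omega>) \<partial>(lborel \<Otimes>\<^sub>M M))"
    using P.integral_fst[OF integral_discount_until_stopping(1)[OF \<delta> \<rho> N(1)]] by simp
  also have "\<dots> = (1 - (\<integral>\<omega>. exp (- \<delta> * \<rho> \<omega>) * ?N \<omega> \<partial>M)) / \<delta>"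
    unfolding integral_discount_until_stopping(2)[OF \<delta> \<rho> N(1)] N(2) ..
  finally show ?thesis .
qed

lemma geometric_path_discounted_square:
  "exp (- r * s) * (geometric_path W \<alpha> \<sigma> x s \<omega>)\<^sup>2
    = x\<^sup>2 * (exp (- (r - 2 * \<alpha> - \<sigma>\<^sup>2) * s) * exp_martingale (2 * \<sigma>) s \<omega>)"
proof -
  have "- r * s + 2 * ((\<alpha> - \<sigma>\<^sup>2 / 2) * s + \<sigma> * W s \<omega>)
      = - (r - 2 * \<alpha> - \<sigma>\<^sup>2) * s + ((2 * \<sigma>) * W s \<omega> - (2 * \<sigma>)\<^sup>2 / 2 * s)"
    by (simp add: field_simps power_mult_distrib)
  then show ?thesis
    unfolding geometric_path_def exp_martingale_def power_mult_distrib exp_double[symmetric]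
    by (simp only: mult.left_commute[of _ "x\<^sup>2"] exp_add[symmetric])
qed

lemma geometric_path_discounted_powr:
  assumes x: "0 < x" and D: "- (1/2) * \<sigma>\<^sup>2 * D\<^sup>2 + (\<sigma>\<^sup>2 / 2 - \<alpha>) * D + r = 0"
  shows "exp (- r * s) * geometric_path W \<alpha> \<sigma> x s \<omega> powr D = x powr D * exp_martingale (D * \<sigma>) s \<omega>"
proof -
  have r: "r = \<sigma>\<^sup>2 * D\<^sup>2 / 2 - (\<sigma>\<^sup>2 / 2 - \<alpha>) * D" using D by simp
  have "- r * s + D * ((\<alpha> - \<sigma>\<^sup>2 / 2) * s + \<sigma> * W s \<omega>) = (D * \<sigma>) * W s \<omega> - (D * \<sigma>)\<^sup>2 / 2 * s"
    unfolding r by (simp add: field_simps power_mult_distrib)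
  then show ?thesis
    unfolding geometric_path_def exp_martingale_def using x
    by (simp only: powr_mult exp_gt_zero exp_powr_real mult.left_commute[of _ "x powr D"] exp_add[symmetric]
        mult.commute[of _ D] less_imp_le)
qed

definition truncate :: "('a \<Rightarrow> ennreal) \<Rightarrow> nat \<Rightarrow> 'a \<Rightarrow> real" where
  "truncate \<tau> n \<omega> = enn2real (min (\<tau> \<omega>) (ennreal (real n)))"

lemma le_truncate_iff: "0 \<le> s \<Longrightarrow> s \<le> truncate \<tau> n \<omega> \<longleftrightarrow> ennreal s \<le> \<tau> \<omega> \<and> s \<le> real n"
proof -
  assume s: "0 \<le> s"
  have "min (\<tau> \<omega>) (ennreal (real n)) = ennreal (truncate \<tau> n \<omega>)"
    unfolding truncate_def by (rule ennreal_enn2real[symmetric]) (auto simp: min_less_iff_disj)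
  then have "ennreal s \<le> min (\<tau> \<omega>) (ennreal (real n)) \<longleftrightarrow> s \<le> truncate \<tau> n \<omega>"
    by (simp only:) (rule ennreal_le_iff, simp add: truncate_def)
  then show ?thesis using s by (simp add: ennreal_le_iff)
qed

lemma truncate_le_iff: "0 \<le> t \<Longrightarrow> truncate \<tau> n \<omega> \<le> t \<longleftrightarrow> \<tau> \<omega> \<le> ennreal t \<or> real n \<le> t"
proof -
  assume t: "0 \<le> t"
  have "min (\<tau> \<omega>) (ennreal (real n)) = ennreal (truncate \<tau> n \<omega>)"
    unfolding truncate_def by (rule ennreal_enn2real[symmetric]) (auto simp: min_less_iff_disj)
  then have "min (\<tau> \<omega>) (ennreal (real n)) \<le> ennreal t \<longleftrightarrow> truncate \<tau> n \<omega> \<le> t"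
    by (simp only:) (rule ennreal_le_iff[OF t])
  then show ?thesis using t by (simp add: min_le_iff_disj ennreal_le_iff)
qed

lemma bounded_stopping_truncate:
  assumes "stopping_time F \<tau>"
  shows "bounded_stopping (truncate \<tau> n) (real n)"
  unfolding bounded_stopping_def
proof (intro conjI allI impI ballI)
  fix t :: real assume t: "0 \<le> t"
  have "{\<omega> \<in> space M. truncate \<tau> n \<omega> \<le> t}
      = (if real n \<le> t then space (F (ennreal t)) else {\<omega> \<in> space (F (ennreal t)). \<tau> \<omega> \<le> ennreal t})"
    using t by (auto simp: truncate_le_iff space_F)
  also have "\<dots> \<in> sets (F (ennreal t))"
    using stopping_timeD[OF assms, of "ennreal t"] unfolding pred_def by auto
  finally show "{\<omega> \<in> space M. truncate \<tau> n \<omega> \<le> t} \<in> sets (F (ennreal t))" .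
next
  fix \<omega>
  show "0 \<le> truncate \<tau> n \<omega>" by (simp add: truncate_def)
  show "truncate \<tau> n \<omega> \<le> real n" by (simp add: truncate_le_iff)
qed

lemma stopping_time_measurable:
  assumes "stopping_time F \<tau>"
  shows "\<tau> \<in> borel_measurable M"
  by (rule measurable_stopping_time[OF assms]) (use subalgebra_F in \<open>auto simp: subalgebra_def\<close>)

context
  fixes \<alpha> \<sigma> r x \<gamma> K :: real
  assumes r: "0 < r" and ex: "r > \<sigma>\<^sup>2 + 2 * \<alpha>"
begin

private abbreviation (input) "\<delta> \<equiv> r - 2 * \<alpha> - \<sigma>\<^sup>2"
private abbreviation (input) "Z \<equiv> geometric_path W \<alpha> \<sigma> x"

text \<open>
  The discounted profit rate in terms of the exponential martingale: discounting \<open>X\<^sup>2\<close> at rate \<open>r\<close> is discounting the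
  martingale with parameter \<open>2 \<sigma>\<close> at rate \<open>\<delta>\<close>.
\<close>

definition running_profit :: "real \<times> 'a \<Rightarrow> real" where
  "running_profit = (\<lambda>(s, \<omega>). \<gamma>\<^sup>2 / 4 * x\<^sup>2 * (discount \<delta> s * exp_martingale (2 * \<sigma>) (max 0 s) \<omega>) - K * discount r s)"

lemma running_profit_integrable: "integrable (lborel \<Otimes>\<^sub>M M) running_profit"
proof -
  have "0 < \<delta>" using ex by simp
  from integrable_discount_exp_martingale[OF this, of "2 * \<sigma>"]
  have "integrable (lborel \<Otimes>\<^sub>M M) (\<lambda>p. \<gamma>\<^sup>2 / 4 * x\<^sup>2 * (case p of (s, \<omega>) \<Rightarrow> discount \<delta> s * exp_martingale (2 * \<sigma>) (max 0 s) \<omega>))"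
    by (rule integrable_mult_right)
  moreover have "integrable (lborel \<Otimes>\<^sub>M M) (\<lambda>p. K * (case p of (s, \<omega>) \<Rightarrow> discount r s * 1))"
    by (intro integrable_mult_right integrable_discount_times r) simp
  ultimately show ?thesis
    unfolding running_profit_def case_prod_beta' by (intro Bochner_Integration.integrable_diff) auto
qed

lemma stopped_payoff_eq:
  "stopped_payoff r \<gamma> K Z \<tau> \<omega> = (\<integral>s. of_bool (ennreal s \<le> \<tau> \<omega>) * running_profit (s, \<omega>) \<partial>lborel)"
  unfolding stopped_payoff_def set_lebesgue_integral_def
proof (rule Bochner_Integration.integral_cong[OF refl])
  fix s
  show "indicator {s. 0 \<le> s \<and> ennreal s \<le> \<tau> \<omega>} s *\<^sub>R (exp (- r * s) * profit \<gamma> K (Z s \<omega>))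
      = of_bool (ennreal s \<le> \<tau> \<omega>) * running_profit (s, \<omega>)"
  proof (cases "0 \<le> s")
    case True
    have "exp (- r * s) * profit \<gamma> K (Z s \<omega>) = \<gamma>\<^sup>2 / 4 * (exp (- r * s) * (Z s \<omega>)\<^sup>2) - K * exp (- r * s)"
      by (simp add: profit_def algebra_simps)
    also have "\<dots> = running_profit (s, \<omega>)"
      unfolding geometric_path_discounted_square running_profit_def using True by (simp add: discount_def)
    finally show ?thesis using True by (simp add: indicator_def)
  qed (simp add: running_profit_def discount_def)
qed

lemma expectation_stopped_payoff:
  assumes \<tau>[measurable]: "\<tau> \<in> borel_measurable M"
  shows "integrable (lborel \<Otimes>\<^sub>M M) (\<lambda>(s, \<omega>). of_bool (ennreal s \<le> \<tau> \<omega>) * running_profit (s, \<omega>))"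
    and "integral\<^sup>L M (stopped_payoff r \<gamma> K Z \<tau>)
      = (\<integral>(s, \<omega>). of_bool (ennreal s \<le> \<tau> \<omega>) * running_profit (s, \<omega>) \<partial>(lborel \<Otimes>\<^sub>M M))"
proof -
  interpret P: pair_sigma_finite lborel M by (rule pair_sigma_finite_time)
  have [measurable]: "running_profit \<in> borel_measurable (borel \<Otimes>\<^sub>M M)"
    using borel_measurable_integrable[OF running_profit_integrable] by simp
  show int: "integrable (lborel \<Otimes>\<^sub>M M) (\<lambda>(s, \<omega>). of_bool (ennreal s \<le> \<tau> \<omega>) * running_profit (s, \<omega>))"
    by (rule Bochner_Integration.integrable_bound[OF running_profit_integrable])
      (measurable, auto intro!: AE_I2)
  show "integral\<^sup>L M (stopped_payoff r \<gamma> K Z \<tau>)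
      = (\<integral>(s, \<omega>). of_bool (ennreal s \<le> \<tau> \<omega>) * running_profit (s, \<omega>) \<partial>(lborel \<Otimes>\<^sub>M M))"
    using P.integral_snd[OF int] unfolding stopped_payoff_eq[abs_def] .
qed

text \<open>
  Profit up to \<open>\<rho>\<close> is the value of never stopping minus the discounted value of never stopping from the state at \<open>\<rho>\<close>.
\<close>

lemma expectation_profit_until_truncate:
  fixes n :: nat
  assumes \<tau>: "stopping_time F \<tau>"
  defines "\<rho> \<equiv> truncate \<tau> n"
  shows "(\<integral>(s, \<omega>). of_bool (s \<le> \<rho> \<omega>) * running_profit (s, \<omega>) \<partial>(lborel \<Otimes>\<^sub>M M))
    = \<gamma>\<^sup>2 / (4 * \<delta>) * x\<^sup>2 - K / r
      + (K / r * (\<integral>\<omega>. exp (- r * \<rho> \<omega>) \<partial>M) - \<gamma>\<^sup>2 / (4 * \<delta>) * (\<integral>\<omega>. exp (- r * \<rho> \<omega>) * (Z (\<rho> \<omega>) \<omega>)\<^sup>2 \<partial>M))"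
proof -
  have \<rho>: "bounded_stopping \<rho> (real n)" unfolding \<rho>_def by (rule bounded_stopping_truncate[OF \<tau>])
  have [measurable]: "\<rho> \<in> borel_measurable M" by (rule bounded_stopping_measurable[OF \<rho>])
  have \<delta>: "0 < \<delta>" using ex by simp
  let ?A = "\<lambda>(s, \<omega>). of_bool (s \<le> \<rho> \<omega>) * (discount \<delta> s * exp_martingale (2 * \<sigma>) (max 0 s) \<omega>)"
  let ?B = "\<lambda>(s, \<omega>). of_bool (s \<le> \<rho> \<omega>) * (discount r s * (1::real))"
  have iA: "integrable (lborel \<Otimes>\<^sub>M M) ?A"
    by (rule Bochner_Integration.integrable_bound[OF integrable_discount_exp_martingale[OF \<delta>, of "2 * \<sigma>"]])
      (measurable, auto intro!: AE_I2)
  have iB: "integrable (lborel \<Otimes>\<^sub>M M) ?B"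
    by (rule integral_discount_until_stopping(1)[OF r \<rho>]) simp
  have "(\<integral>(s, \<omega>). of_bool (s \<le> \<rho> \<omega>) * running_profit (s, \<omega>) \<partial>(lborel \<Otimes>\<^sub>M M))
      = (\<integral>p. \<gamma>\<^sup>2 / 4 * x\<^sup>2 * ?A p - K * ?B p \<partial>(lborel \<Otimes>\<^sub>M M))"
    unfolding running_profit_def by (intro Bochner_Integration.integral_cong) (auto simp: algebra_simps)
  also have "\<dots> = \<gamma>\<^sup>2 / 4 * x\<^sup>2 * integral\<^sup>L (lborel \<Otimes>\<^sub>M M) ?A - K * integral\<^sup>L (lborel \<Otimes>\<^sub>M M) ?B"
    by (subst Bochner_Integration.integral_diff[OF integrable_mult_right[OF iA] integrable_mult_right[OF iB]])
      (simp only: integral_mult_right_zero)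
  also have "integral\<^sup>L (lborel \<Otimes>\<^sub>M M) ?A = (1 - (\<integral>\<omega>. exp (- \<delta> * \<rho> \<omega>) * exp_martingale (2 * \<sigma>) (\<rho> \<omega>) \<omega> \<partial>M)) / \<delta>"
    by (rule integral_discount_exp_martingale_until_stopping[OF \<delta> \<rho>])
  also have "integral\<^sup>L (lborel \<Otimes>\<^sub>M M) ?B = (1 - (\<integral>\<omega>. exp (- r * \<rho> \<omega>) \<partial>M)) / r"
    using integral_discount_until_stopping(2)[OF r \<rho>, of "\<lambda>_. 1"] prob_space by simp
  finally have "(\<integral>(s, \<omega>). of_bool (s \<le> \<rho> \<omega>) * running_profit (s, \<omega>) \<partial>(lborel \<Otimes>\<^sub>M M))
      = \<gamma>\<^sup>2 / 4 * x\<^sup>2 * ((1 - (\<integral>\<omega>. exp (- \<delta> * \<rho> \<omega>) * exp_martingale (2 * \<sigma>) (\<rho> \<omega>) \<omega> \<partial>M)) / \<delta>)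
        - K * ((1 - (\<integral>\<omega>. exp (- r * \<rho> \<omega>) \<partial>M)) / r)" .
  moreover have "(\<integral>\<omega>. exp (- r * \<rho> \<omega>) * (Z (\<rho> \<omega>) \<omega>)\<^sup>2 \<partial>M)
      = x\<^sup>2 * (\<integral>\<omega>. exp (- \<delta> * \<rho> \<omega>) * exp_martingale (2 * \<sigma>) (\<rho> \<omega>) \<omega> \<partial>M)"
    unfolding geometric_path_discounted_square by simp
  moreover have rearrange: "\<gamma>\<^sup>2 / 4 * X * ((1 - e) / d) - K * ((1 - f) / r)
      = \<gamma>\<^sup>2 / (4 * d) * X - K / r + (K / r * f - \<gamma>\<^sup>2 / (4 * d) * (X * e))" if "0 < d" for X e f d :: real
    using that r by (simp add: field_simps)
  ultimately show ?thesis by (simp only: rearrange[OF \<delta>])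
qed

text \<open>
  The running profit is integrable over all times, so truncating the stopping time is harmless.
\<close>

lemma stopped_payoff_limit:
  assumes \<tau>: "stopping_time F \<tau>"
  shows "(\<lambda>n. \<integral>(s, \<omega>). of_bool (s \<le> truncate \<tau> n \<omega>) * running_profit (s, \<omega>) \<partial>(lborel \<Otimes>\<^sub>M M))
    \<longlonglongrightarrow> integral\<^sup>L M (stopped_payoff r \<gamma> K Z \<tau>)"
proof -
  have [measurable]: "\<tau> \<in> borel_measurable M" by (rule stopping_time_measurable[OF \<tau>])
  have [measurable]: "truncate \<tau> n \<in> borel_measurable M" for n
    by (rule bounded_stopping_measurable[OF bounded_stopping_truncate[OF \<tau>]])
  have [measurable]: "running_profit \<in> borel_measurable (borel \<Otimes>\<^sub>M M)"
    using borel_measurable_integrable[OF running_profit_integrable] by simp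
  show ?thesis
    unfolding expectation_stopped_payoff(2)[OF \<open>\<tau> \<in> borel_measurable M\<close>]
  proof (rule integral_dominated_convergence[where w="\<lambda>p. norm (running_profit p)"])
    show "integrable (lborel \<Otimes>\<^sub>M M) (\<lambda>p. norm (running_profit p))"
      by (intro integrable_norm running_profit_integrable)
    show "AE p in lborel \<Otimes>\<^sub>M M. (\<lambda>n. case p of (s, \<omega>) \<Rightarrow> of_bool (s \<le> truncate \<tau> n \<omega>) * running_profit (s, \<omega>))
        \<longlonglongrightarrow> (case p of (s, \<omega>) \<Rightarrow> of_bool (ennreal s \<le> \<tau> \<omega>) * running_profit (s, \<omega>))"
    proof (rule AE_I2)
      fix p :: "real \<times> 'a"
      obtain s \<omega> where p: "p = (s, \<omega>)" by (cases p)
      obtain N where N: "s \<le> real N" using real_arch_simple by blast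
      have "of_bool (s \<le> truncate \<tau> n \<omega>) * running_profit (s, \<omega>) = of_bool (ennreal s \<le> \<tau> \<omega>) * running_profit (s, \<omega>)"
        if "n \<ge> N" for n
      proof (cases "0 \<le> s")
        case True
        have "s \<le> real n" using N that by linarith
        then show ?thesis using True by (simp add: le_truncate_iff)
      qed (simp add: running_profit_def discount_def)
      then show "(\<lambda>n. case p of (s, \<omega>) \<Rightarrow> of_bool (s \<le> truncate \<tau> n \<omega>) * running_profit (s, \<omega>))
        \<longlonglongrightarrow> (case p of (s, \<omega>) \<Rightarrow> of_bool (ennreal s \<le> \<tau> \<omega>) * running_profit (s, \<omega>))"
        unfolding p prod.case by (intro tendsto_eventually eventually_sequentiallyI)
    qed
  qed (measurable, auto intro!: AE_I2)
qed

end

end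

section \<open>Hitting times\<close>

definition hitting_time :: "(real \<Rightarrow> 'a \<Rightarrow> real) \<Rightarrow> real \<Rightarrow> 'a \<Rightarrow> ennreal" where
  "hitting_time V b \<omega> = (INF s\<in>{s. 0 \<le> s \<and> V s \<omega> \<le> b}. ennreal s)"

lemma above_before_hitting_time:
  assumes "0 \<le> s" "ennreal s < hitting_time V b \<omega>"
  shows "b < V s \<omega>"
proof (rule ccontr)
  assume "\<not> b < V s \<omega>"
  then have "hitting_time V b \<omega> \<le> ennreal s"
    unfolding hitting_time_def using assms(1) by (intro INF_lower) auto
  then show False using assms(2) by simp
qed

text \<open>
  The set of times at which the path lies below the level is closed, so it contains its infimum.
\<close>

lemma hitting_time_le_iff:
  assumes V: "continuous_on {0..} (\<lambda>s. V s \<omega>)" and t: "0 \<le> t"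
  shows "hitting_time V b \<omega> \<le> ennreal t \<longleftrightarrow> (\<exists>s\<in>{0..t}. V s \<omega> \<le> b)"
proof
  assume "\<exists>s\<in>{0..t}. V s \<omega> \<le> b"
  then obtain s where s: "0 \<le> s" "s \<le> t" "V s \<omega> \<le> b" by auto
  then have "hitting_time V b \<omega> \<le> ennreal s"
    unfolding hitting_time_def by (intro INF_lower) auto
  also have "\<dots> \<le> ennreal t" using s by (intro ennreal_leI)
  finally show "hitting_time V b \<omega> \<le> ennreal t" .
next
  assume le: "hitting_time V b \<omega> \<le> ennreal t"
  let ?S = "{s \<in> {0..}. V s \<omega> \<le> b}"
  have S_eq: "?S = {s. 0 \<le> s \<and> V s \<omega> \<le> b}" by auto
  have closed: "closed ?S"
    using continuous_closed_preimage[OF V closed_atLeast, of "{..b}"] by (simp add: vimage_def Int_def)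
  have "?S \<noteq> {}"
  proof
    assume "?S = {}"
    then have "hitting_time V b \<omega> = \<infinity>" unfolding hitting_time_def S_eq[symmetric] by simp
    then show False using le by (simp add: top_unique)
  qed
  moreover have bdd: "bdd_below ?S" by (rule bdd_belowI[of _ 0]) auto
  ultimately have m: "Inf ?S \<in> ?S" using closed by (intro closed_contains_Inf)
  have "ennreal (Inf ?S) \<le> hitting_time V b \<omega>"
    unfolding hitting_time_def S_eq[symmetric]
    using bdd by (intro INF_greatest ennreal_leI cInf_lower) auto
  then have "ennreal (Inf ?S) \<le> ennreal t" using le by simp
  then have "Inf ?S \<le> t" using t by (simp add: ennreal_le_iff)
  then show "\<exists>s\<in>{0..t}. V s \<omega> \<le> b" using m by (intro bexI[of _ "Inf ?S"]) auto
qed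

text \<open>
  Expresses the passage below a level until time \<open>t\<close> by countably many values up to \<open>t\<close>, so that the event belongs to
  the past at \<open>t\<close> itself and no time after \<open>t\<close> is consulted.
\<close>

lemma ex_le_iff_rational_approx:
  fixes u :: "real \<Rightarrow> real"
  assumes u: "continuous_on {0..t} u" and t: "0 \<le> t"
  shows "(\<exists>s\<in>{0..t}. u s \<le> b) \<longleftrightarrow> (\<forall>N::nat. \<exists>q\<in>\<rat> \<inter> {0..t}. u q < b + 1 / Suc N)"
proof
  assume "\<exists>s\<in>{0..t}. u s \<le> b"
  then obtain s where s: "0 \<le> s" "s \<le> t" "u s \<le> b" by auto
  obtain q where q: "\<And>n. q n \<in> \<rat>" "\<And>n. 0 \<le> q n" "\<And>n. q n \<le> s" "q \<longlonglongrightarrow> s"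
    using rational_approximation_from_below[OF s(1)] by blast
  have lim: "(\<lambda>n. u (q n)) \<longlonglongrightarrow> u s"
    by (rule continuous_on_tendsto_sequence[OF u _ _ q(4)]) (use q(2) order_trans[OF q(3) s(2)] s in auto)
  show "\<forall>N::nat. \<exists>q\<in>\<rat> \<inter> {0..t}. u q < b + 1 / Suc N"
  proof
    fix N :: nat
    have "0 < 1 / real (Suc N)" by simp
    then have "u s < b + 1 / Suc N" using s(3) by linarith
    from order_tendstoD(2)[OF lim this] obtain n where "u (q n) < b + 1 / Suc N"
      by (auto simp: eventually_sequentially)
    then show "\<exists>q\<in>\<rat> \<inter> {0..t}. u q < b + 1 / Suc N"
      using q(1,2) order_trans[OF q(3) s(2)] by (intro bexI[of _ "q n"]) auto
  qed
next
  assume approx: "\<forall>N::nat. \<exists>q\<in>\<rat> \<inter> {0..t}. u q < b + 1 / Suc N"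
  obtain s where s: "s \<in> {0..t}" "\<And>q. q \<in> {0..t} \<Longrightarrow> u s \<le> u q"
    using continuous_attains_inf[of "{0..t}" u] u t by auto
  have "u s \<le> b + inverse (real (Suc N))" for N
  proof -
    obtain q where "q \<in> {0..t}" "u q < b + 1 / Suc N" using approx by blast
    then show ?thesis using s(2)[of q] by (simp add: inverse_eq_divide)
  qed
  moreover have "(\<lambda>N. b + inverse (real (Suc N))) \<longlonglongrightarrow> b + 0"
    by (intro tendsto_add tendsto_const LIMSEQ_inverse_real_of_nat)
  ultimately have "u s \<le> b + 0" by (intro LIMSEQ_le_const) auto
  then show "\<exists>s\<in>{0..t}. u s \<le> b" using s(1) by auto
qed

lemma at_hitting_time:
  assumes V: "continuous_on {0..} (\<lambda>s. V s \<omega>)" and V0: "b \<le> V 0 \<omega>" and \<rho>: "0 \<le> \<rho>"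
    and \<tau>: "hitting_time V b \<omega> = ennreal \<rho>"
  shows "V \<rho> \<omega> = b"
proof (rule antisym)
  have before: "b < V s \<omega>" if "0 \<le> s" "s < \<rho>" for s
    using that above_before_hitting_time[of s V b \<omega>] \<tau> by (simp add: ennreal_less_iff)
  obtain s where s: "0 \<le> s" "s \<le> \<rho>" "V s \<omega> \<le> b"
    using hitting_time_le_iff[of V \<omega> \<rho> b] V \<rho> \<tau> by auto
  then have "s = \<rho>" using before[of s] by fastforce
  then show "V \<rho> \<omega> \<le> b" using s by simp
  show "b \<le> V \<rho> \<omega>"
  proof (cases "\<rho> = 0")
    case False
    then have \<rho>: "0 < \<rho>" using \<rho> by simp
    define q where "q n = \<rho> - \<rho> * inverse (real (Suc n))" for n
    have q: "0 \<le> q n" "q n < \<rho>" for n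
      using \<rho> by (auto simp: q_def field_simps)
    have "q \<longlonglongrightarrow> \<rho> - \<rho> * 0"
      unfolding q_def by (intro tendsto_diff tendsto_mult tendsto_const LIMSEQ_inverse_real_of_nat)
    then have q_lim: "q \<longlonglongrightarrow> \<rho>" by simp
    have "(\<lambda>n. V (q n) \<omega>) \<longlonglongrightarrow> V \<rho> \<omega>"
      by (rule continuous_on_tendsto_sequence[OF V _ _ q_lim]) (use q \<rho> in auto)
    then show ?thesis by (rule LIMSEQ_le_const) (use before[OF q] in \<open>auto intro: less_imp_le\<close>)
  qed (use V0 in simp)
qed

context brownian_motion
begin

lemma stopping_time_hitting_time:
  assumes VF: "\<And>s. 0 \<le> s \<Longrightarrow> V s \<in> borel_measurable (F (ennreal s))"
    and V: "\<And>\<omega>. \<omega> \<in> space M \<Longrightarrow> continuous_on {0..} (\<lambda>s. V s \<omega>)"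
  shows "stopping_time F (hitting_time V b)"
proof
  fix t :: ennreal
  show "Measurable.pred (F t) (\<lambda>\<omega>. hitting_time V b \<omega> \<le> t)"
  proof (cases t)
    case (real t')
    have "Measurable.pred (F t) (\<lambda>\<omega>. \<forall>N::nat. \<exists>q\<in>\<rat> \<inter> {0..t'}. V q \<omega> < b + 1 / Suc N)"
    proof (intro pred_intros_countable(1) measurable_pred_countable(2))
      show "countable (\<rat> \<inter> {0..t'})" by (rule countable_subset[OF _ countable_rat]) auto
      fix N :: nat and q assume "q \<in> \<rat> \<inter> {0..t'}"
      then have [measurable]: "V q \<in> borel_measurable (F t)"
        unfolding real by (intro measurable_F_mono[OF VF]) (auto intro: ennreal_leI)
      show "Measurable.pred (F t) (\<lambda>\<omega>. V q \<omega> < b + 1 / Suc N)" by measurable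
    qed
    also have "?this \<longleftrightarrow> Measurable.pred (F t) (\<lambda>\<omega>. hitting_time V b \<omega> \<le> t)"
    proof (rule measurable_cong)
      fix \<omega> assume "\<omega> \<in> space (F t)"
      then have \<omega>: "continuous_on {0..} (\<lambda>s. V s \<omega>)" using V by (simp add: space_F)
      then have "continuous_on {0..t'} (\<lambda>s. V s \<omega>)" by (rule continuous_on_subset) auto
      then show "(\<forall>N::nat. \<exists>q\<in>\<rat> \<inter> {0..t'}. V q \<omega> < b + 1 / Suc N) = (hitting_time V b \<omega> \<le> t)"
        unfolding real hitting_time_le_iff[where V=V and \<omega>=\<omega>, OF \<omega> real(1)]
        using ex_le_iff_rational_approx[of t' "\<lambda>s. V s \<omega>" b] real(1) by simp
    qed
    finally show ?thesis .
  qed simp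
qed

end

section \<open>The two bounds on the expected profit\<close>

text \<open>
  With \<open>l = ln (y / y0)\<close> all three powers are exponentials of multiples of \<open>l\<close>, and \<open>exp t \<ge> 1 + t\<close> bounds each by its
  tangent at \<open>l = 0\<close>. The linear terms cancel by the slope condition.
\<close>

lemma exponential_sum_tangent:
  fixes p q w k D1 D2 u v y y0 :: real
  assumes nonneg: "0 \<le> p" "0 \<le> q" "0 \<le> w" and y: "0 < y" "0 < y0"
    and val: "p + q + w = k" and slope: "D1 * p + D2 * q + 2 * w = 0"
  shows "k - w * (y / y0)\<^sup>2 \<le> p * (y / y0) powr D1 + q * (y / y0) powr D2"
proof -
  define l where "l = ln (y / y0)"
  have pw: "(y / y0) powr D = exp (D * l)" for D using y by (simp add: powr_def l_def)
  have sq: "(y / y0)\<^sup>2 = exp (2 * l)"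
    using y unfolding exp_double by (simp add: l_def)
  have "k = p + q + w + l * (D1 * p + D2 * q + 2 * w)" using val slope by simp
  also have "\<dots> = p * (1 + D1 * l) + q * (1 + D2 * l) + w * (1 + 2 * l)" by (simp add: algebra_simps)
  also have "\<dots> \<le> p * exp (D1 * l) + q * exp (D2 * l) + w * exp (2 * l)"
    using nonneg by (intro add_mono mult_left_mono exp_ge_add_one_self)
  finally show ?thesis unfolding pw sq by simp
qed

context brownian_motion
begin

lemma geometric_path_continuous:
  "\<omega> \<in> space M \<Longrightarrow> continuous_on {0..} (\<lambda>t. geometric_path W \<alpha> \<sigma> x t \<omega>)"
  unfolding geometric_path_def by (intro continuous_intros W_continuous)

lemma geometric_path_pos: "0 < x \<Longrightarrow> 0 < geometric_path W \<alpha> \<sigma> x t \<omega>"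
  by (simp add: geometric_path_def)

lemma has_bochner_integral_geometric_path_powr:
  assumes x: "0 < x" and y0: "0 < y0" and D: "- (1/2) * \<sigma>\<^sup>2 * D\<^sup>2 + (\<sigma>\<^sup>2 / 2 - \<alpha>) * D + r = 0"
    and \<rho>: "bounded_stopping \<rho> T"
  shows "has_bochner_integral M
    (\<lambda>\<omega>. exp (- r * \<rho> \<omega>) * (geometric_path W \<alpha> \<sigma> x (\<rho> \<omega>) \<omega> / y0) powr D) ((x / y0) powr D)"
proof -
  have "has_bochner_integral M
      (\<lambda>\<omega>. (x powr D / y0 powr D) * exp_martingale (D * \<sigma>) (\<rho> \<omega>) \<omega>) ((x powr D / y0 powr D) * 1)"
    by (intro has_bochner_integral_mult_right has_bochner_integral_exp_martingale_stopped[OF \<rho>])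
  moreover have "exp (- r * \<rho> \<omega>) * (geometric_path W \<alpha> \<sigma> x (\<rho> \<omega>) \<omega> / y0) powr D
      = (x powr D / y0 powr D) * exp_martingale (D * \<sigma>) (\<rho> \<omega>) \<omega>" for \<omega>
    using geometric_path_discounted_powr[OF x D, of "\<rho> \<omega>" \<omega>] geometric_path_pos[OF x, of \<alpha> \<sigma> "\<rho> \<omega>" \<omega>] y0 x
    by (simp add: powr_divide)
  ultimately show ?thesis using x y0 by (simp add: powr_divide)
qed

lemma integrable_geometric_path_square_stopped:
  assumes \<rho>: "bounded_stopping \<rho> T" and ex: "r > \<sigma>\<^sup>2 + 2 * \<alpha>"
  shows "integrable M (\<lambda>\<omega>. exp (- r * \<rho> \<omega>) * (geometric_path W \<alpha> \<sigma> x (\<rho> \<omega>) \<omega>)\<^sup>2)"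
proof -
  have [measurable]: "\<rho> \<in> borel_measurable M" by (rule bounded_stopping_measurable[OF \<rho>])
  have N: "integrable M (\<lambda>\<omega>. exp_martingale (2 * \<sigma>) (\<rho> \<omega>) \<omega>)"
    using has_bochner_integral_exp_martingale_stopped[OF \<rho>] by (simp add: has_bochner_integral_iff)
  have "integrable M (\<lambda>\<omega>. exp (- (r - 2 * \<alpha> - \<sigma>\<^sup>2) * \<rho> \<omega>) * exp_martingale (2 * \<sigma>) (\<rho> \<omega>) \<omega>)"
  proof (rule Bochner_Integration.integrable_bound[OF N])
    have "exp (- (r - 2 * \<alpha> - \<sigma>\<^sup>2) * \<rho> \<omega>) \<le> 1" if "\<omega> \<in> space M" for \<omega>
    proof -
      have "0 \<le> (r - 2 * \<alpha> - \<sigma>\<^sup>2) * \<rho> \<omega>"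
        using ex \<rho> that by (intro mult_nonneg_nonneg) (auto simp: bounded_stopping_def)
      then show ?thesis by (simp only: mult_minus_left exp_le_one_iff neg_le_0_iff_le)
    qed
    then show "AE \<omega> in M. norm (exp (- (r - 2 * \<alpha> - \<sigma>\<^sup>2) * \<rho> \<omega>) * exp_martingale (2 * \<sigma>) (\<rho> \<omega>) \<omega>)
        \<le> norm (exp_martingale (2 * \<sigma>) (\<rho> \<omega>) \<omega>)"
      by (intro AE_I2) (simp add: abs_mult mult_left_le_one_le)
  qed (use borel_measurable_integrable[OF N] in measurable)
  then show ?thesis
    unfolding geometric_path_discounted_square by simp
qed

lemma integrable_exp_stopped:
  assumes \<rho>: "bounded_stopping \<rho> T" and r: "0 < r"
  shows "integrable M (\<lambda>\<omega>. exp (- r * \<rho> \<omega>))"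
proof (rule integrable_const_bound[where B=1])
  have [measurable]: "\<rho> \<in> borel_measurable M" by (rule bounded_stopping_measurable[OF \<rho>])
  show "(\<lambda>\<omega>. exp (- r * \<rho> \<omega>)) \<in> borel_measurable M" by measurable
  show "AE \<omega> in M. norm (exp (- r * \<rho> \<omega>)) \<le> 1"
    using \<rho> r by (intro AE_I2) (auto simp: bounded_stopping_def)
qed

text \<open>
  The coefficients \<open>p\<close> and \<open>q\<close> describe, relative to the point of tangency \<open>y0\<close>, a combination of the powers \<open>D1\<close>
  and \<open>D2\<close> that touches \<open>K / r - c y\<^sup>2\<close> at \<open>y0\<close>. The tangent point is left open because it is \<open>x\<close> or the threshold,
  depending on the starting point.
\<close>

lemma expectation_payoff_le:
  assumes x: "0 < x" and r: "0 < r" and ex: "r > \<sigma>\<^sup>2 + 2 * \<alpha>" and y0: "0 < y0"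
    and D1: "- (1/2) * \<sigma>\<^sup>2 * D1\<^sup>2 + (\<sigma>\<^sup>2 / 2 - \<alpha>) * D1 + r = 0"
    and D2: "- (1/2) * \<sigma>\<^sup>2 * D2\<^sup>2 + (\<sigma>\<^sup>2 / 2 - \<alpha>) * D2 + r = 0"
    and c: "c = \<gamma>\<^sup>2 / (4 * (r - 2 * \<alpha> - \<sigma>\<^sup>2))"
    and nonneg: "0 \<le> p" "0 \<le> q"
    and val: "p + q + c * y0\<^sup>2 = K / r" and slope: "D1 * p + D2 * q + 2 * (c * y0\<^sup>2) = 0"
    and \<tau>: "stopping_time F \<tau>"
  shows "integral\<^sup>L M (stopped_payoff r \<gamma> K (geometric_path W \<alpha> \<sigma> x) \<tau>)
    \<le> c * x\<^sup>2 - K / r + (p * (x / y0) powr D1 + q * (x / y0) powr D2)"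
proof (rule LIMSEQ_le_const2[OF stopped_payoff_limit[OF r ex \<tau>]], intro exI allI impI)
  fix n
  let ?\<rho> = "truncate \<tau> n" and ?Z = "geometric_path W \<alpha> \<sigma> x"
  have \<rho>: "bounded_stopping ?\<rho> (real n)" by (rule bounded_stopping_truncate[OF \<tau>])
  have c0: "0 \<le> c" using ex by (simp add: c)
  note I1 = integrable_exp_stopped[OF \<rho> r] and I2 = integrable_geometric_path_square_stopped[OF \<rho> ex, of x]
  let ?h = "\<lambda>\<omega>. p * (exp (- r * ?\<rho> \<omega>) * (?Z (?\<rho> \<omega>) \<omega> / y0) powr D1)
      + q * (exp (- r * ?\<rho> \<omega>) * (?Z (?\<rho> \<omega>) \<omega> / y0) powr D2)"
  have h: "has_bochner_integral M ?h (p * (x / y0) powr D1 + q * (x / y0) powr D2)"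
    by (intro has_bochner_integral_add has_bochner_integral_mult_right
        has_bochner_integral_geometric_path_powr[OF x y0 _ \<rho>] D1 D2)
  have "K / r * (\<integral>\<omega>. exp (- r * ?\<rho> \<omega>) \<partial>M) - c * (\<integral>\<omega>. exp (- r * ?\<rho> \<omega>) * (?Z (?\<rho> \<omega>) \<omega>)\<^sup>2 \<partial>M)
      = (\<integral>\<omega>. K / r * exp (- r * ?\<rho> \<omega>) - c * (exp (- r * ?\<rho> \<omega>) * (?Z (?\<rho> \<omega>) \<omega>)\<^sup>2) \<partial>M)"
    by (subst Bochner_Integration.integral_diff[OF integrable_mult_right[OF I1] integrable_mult_right[OF I2]])
      (simp only: integral_mult_right_zero)
  also have "\<dots> \<le> (\<integral>\<omega>. ?h \<omega> \<partial>M)"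
  proof (rule integral_mono)
    show "integrable M (\<lambda>\<omega>. K / r * exp (- r * ?\<rho> \<omega>) - c * (exp (- r * ?\<rho> \<omega>) * (?Z (?\<rho> \<omega>) \<omega>)\<^sup>2))"
      by (intro Bochner_Integration.integrable_diff integrable_mult_right I1 I2)
    show "integrable M ?h" by (rule integrable.intros[OF h])
    fix \<omega>
    have "K / r - (c * y0\<^sup>2) * (?Z (?\<rho> \<omega>) \<omega> / y0)\<^sup>2
        \<le> p * (?Z (?\<rho> \<omega>) \<omega> / y0) powr D1 + q * (?Z (?\<rho> \<omega>) \<omega> / y0) powr D2"
      by (rule exponential_sum_tangent) (use nonneg c0 geometric_path_pos[OF x] y0 val slope in auto)
    then have "K / r - c * (?Z (?\<rho> \<omega>) \<omega>)\<^sup>2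
        \<le> p * (?Z (?\<rho> \<omega>) \<omega> / y0) powr D1 + q * (?Z (?\<rho> \<omega>) \<omega> / y0) powr D2"
      using y0 by (simp add: power_divide)
    from mult_left_mono[OF this, of "exp (- r * ?\<rho> \<omega>)"]
    show "K / r * exp (- r * ?\<rho> \<omega>) - c * (exp (- r * ?\<rho> \<omega>) * (?Z (?\<rho> \<omega>) \<omega>)\<^sup>2) \<le> ?h \<omega>"
      by (simp add: algebra_simps)
  qed
  also have "\<dots> = p * (x / y0) powr D1 + q * (x / y0) powr D2"
    by (rule has_bochner_integral_integral_eq[OF h])
  finally show "(\<integral>(s, \<omega>). of_bool (s \<le> ?\<rho> \<omega>) * running_profit \<alpha> \<sigma> r x \<gamma> K (s, \<omega>) \<partial>(lborel \<Otimes>\<^sub>M M))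
      \<le> c * x\<^sup>2 - K / r + (p * (x / y0) powr D1 + q * (x / y0) powr D2)"
    unfolding expectation_profit_until_truncate[OF r ex \<tau>] c by simp
qed

text \<open>
  At the hitting time of \<open>b\<close> the power \<open>q (y / b) powr D2\<close> agrees with \<open>K / r - c y\<^sup>2\<close>. If the level is not reached
  before \<open>n\<close>, the state exceeds \<open>b\<close>, so the power is at most \<open>q\<close> because \<open>D2 < 0\<close>; the error at time \<open>n\<close> is then at most
  \<open>exp (- r n) (q + c (Z n)\<^sup>2)\<close>, whose mean tends to \<open>0\<close>.
\<close>

lemma expectation_payoff_hitting_time_ge:
  assumes r: "0 < r" and ex: "r > \<sigma>\<^sup>2 + 2 * \<alpha>" and b: "0 < b" "b \<le> x"
    and D2: "D2 < 0" "- (1/2) * \<sigma>\<^sup>2 * D2\<^sup>2 + (\<sigma>\<^sup>2 / 2 - \<alpha>) * D2 + r = 0"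
    and c: "c = \<gamma>\<^sup>2 / (4 * (r - 2 * \<alpha> - \<sigma>\<^sup>2))" and K: "0 \<le> K"
    and q: "0 \<le> q" and val: "q + c * b\<^sup>2 = K / r"
  shows "c * x\<^sup>2 - K / r + q * (x / b) powr D2
    \<le> integral\<^sup>L M (stopped_payoff r \<gamma> K (geometric_path W \<alpha> \<sigma> x) (hitting_time (geometric_path W \<alpha> \<sigma> x) b))"
proof -
  let ?Z = "geometric_path W \<alpha> \<sigma> x"
  let ?\<tau> = "hitting_time ?Z b"
  have x: "0 < x" using b by simp
  have c0: "0 \<le> c" using ex by (simp add: c)
  have \<tau>: "stopping_time F ?\<tau>"
    by (rule stopping_time_hitting_time) (rule geometric_path_adapted geometric_path_continuous; assumption)+
  have AE0: "AE \<omega> in M. ?Z 0 \<omega> = x"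
    using W_0 by eventually_elim (simp add: geometric_path_def)
  have bound: "c * x\<^sup>2 - K / r + q * (x / b) powr D2
      - (exp (- r * real n) * q + c * (x\<^sup>2 * exp (- (r - 2 * \<alpha> - \<sigma>\<^sup>2) * real n)))
      \<le> (\<integral>(s, \<omega>). of_bool (s \<le> truncate ?\<tau> n \<omega>) * running_profit \<alpha> \<sigma> r x \<gamma> K (s, \<omega>) \<partial>(lborel \<Otimes>\<^sub>M M))" for n
  proof -
    let ?\<rho> = "truncate ?\<tau> n"
    have \<rho>: "bounded_stopping ?\<rho> (real n)" by (rule bounded_stopping_truncate[OF \<tau>])
    note I1 = integrable_exp_stopped[OF \<rho> r] and I2 = integrable_geometric_path_square_stopped[OF \<rho> ex, of x]
    have h: "has_bochner_integral M (\<lambda>\<omega>. q * (exp (- r * ?\<rho> \<omega>) * (?Z (?\<rho> \<omega>) \<omega> / b) powr D2)) (q * (x / b) powr D2)"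
      by (intro has_bochner_integral_mult_right has_bochner_integral_geometric_path_powr[OF x b(1) _ \<rho>] D2)
    have "has_bochner_integral M (\<lambda>\<omega>. exp (- r * real n) * (?Z (real n) \<omega>)\<^sup>2)
        (exp (- r * real n) * (x\<^sup>2 * exp ((2 * \<alpha> + \<sigma>\<^sup>2) * real n)))"
      by (intro has_bochner_integral_mult_right has_bochner_integral_geometric_path_square) simp
    moreover have "exp (- r * real n) * (x\<^sup>2 * exp ((2 * \<alpha> + \<sigma>\<^sup>2) * real n)) = x\<^sup>2 * exp (- (r - 2 * \<alpha> - \<sigma>\<^sup>2) * real n)"
      by (simp add: mult.left_commute exp_add[symmetric] algebra_simps)
    ultimately have e: "has_bochner_integral M (\<lambda>\<omega>. exp (- r * real n) * (?Z (real n) \<omega>)\<^sup>2)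
        (x\<^sup>2 * exp (- (r - 2 * \<alpha> - \<sigma>\<^sup>2) * real n))" by (simp only:)
    have one: "has_bochner_integral M (\<lambda>\<omega>. exp (- r * real n) * q) (exp (- r * real n) * q)"
      by (simp add: has_bochner_integral_iff prob_space)
    let ?g = "\<lambda>\<omega>. K / r * exp (- r * ?\<rho> \<omega>) - c * (exp (- r * ?\<rho> \<omega>) * (?Z (?\<rho> \<omega>) \<omega>)\<^sup>2)"
    let ?l = "\<lambda>\<omega>. q * (exp (- r * ?\<rho> \<omega>) * (?Z (?\<rho> \<omega>) \<omega> / b) powr D2)
        - (exp (- r * real n) * q + c * (exp (- r * real n) * (?Z (real n) \<omega>)\<^sup>2))"
    have l: "has_bochner_integral M ?l (q * (x / b) powr D2
        - (exp (- r * real n) * q + c * (x\<^sup>2 * exp (- (r - 2 * \<alpha> - \<sigma>\<^sup>2) * real n))))"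
      by (intro has_bochner_integral_diff has_bochner_integral_add has_bochner_integral_mult_right[of c] h e one)
    note has_bochner_integral_integral_eq[OF l, symmetric]
    also have "(\<integral>\<omega>. ?l \<omega> \<partial>M) \<le> (\<integral>\<omega>. ?g \<omega> \<partial>M)"
    proof (rule integral_mono_AE)
      show "integrable M ?l" by (rule integrable.intros[OF l])
      show "integrable M ?g" by (intro Bochner_Integration.integrable_diff integrable_mult_right I1 I2)
      show "AE \<omega> in M. ?l \<omega> \<le> ?g \<omega>"
        using AE0 AE_space
      proof eventually_elim
        case (elim \<omega>)
        have cont: "continuous_on {0..} (\<lambda>s. ?Z s \<omega>)" by (rule geometric_path_continuous[OF elim(2)])
        show ?case
        proof (cases "?\<tau> \<omega> \<le> ennreal (real n)")
          case True
          then have "?\<tau> \<omega> = ennreal (?\<rho> \<omega>)"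
            unfolding truncate_def by (auto simp: min_absorb1 intro!: ennreal_enn2real[symmetric] intro: le_less_trans)
          then have "?Z (?\<rho> \<omega>) \<omega> = b"
            using elim(1) b \<rho> elim(2)
            by (intro at_hitting_time[of ?Z \<omega>] cont) (auto simp: bounded_stopping_def)
          then have "?g \<omega> = exp (- r * ?\<rho> \<omega>) * q"
            using val by (simp add: algebra_simps flip: val)
          moreover have "0 \<le> exp (- r * real n) * q + c * (exp (- r * real n) * (?Z (real n) \<omega>)\<^sup>2)"
            using q c0 by simp
          ultimately show ?thesis using \<open>?Z (?\<rho> \<omega>) \<omega> = b\<close> b(1) by simp
        next
          case False
          then have lt: "ennreal (real n) < ?\<tau> \<omega>" by simp
          then have \<rho>n: "?\<rho> \<omega> = real n" unfolding truncate_def by (simp add: min_absorb2 less_imp_le)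
          have "b < ?Z (real n) \<omega>" by (rule above_before_hitting_time[OF _ lt]) simp
          then have "(?Z (real n) \<omega> / b) powr D2 \<le> 1 powr D2"
            using b(1) D2(1) by (intro powr_mono2') auto
          then have "q * (exp (- r * real n) * (?Z (real n) \<omega> / b) powr D2) \<le> exp (- r * real n) * q"
            using q by (simp add: mult_le_cancel_left1 mult.left_commute[of q] mult_left_le)
          moreover have "0 \<le> K / r * exp (- r * real n)" using K r by simp
          ultimately show ?thesis unfolding \<rho>n by linarith
        qed
      qed
    qed
    also have "(\<integral>\<omega>. ?g \<omega> \<partial>M) = K / r * (\<integral>\<omega>. exp (- r * ?\<rho> \<omega>) \<partial>M) - c * (\<integral>\<omega>. exp (- r * ?\<rho> \<omega>) * (?Z (?\<rho> \<omega>) \<omega>)\<^sup>2 \<partial>M)"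
      by (subst Bochner_Integration.integral_diff[OF integrable_mult_right[OF I1] integrable_mult_right[OF I2]])
        (simp only: integral_mult_right_zero)
    finally show ?thesis
      unfolding expectation_profit_until_truncate[OF r ex \<tau>] c[symmetric] by linarith
  qed
  \<comment> \<open>The truncation errors decay because both \<open>r\<close> and \<open>r - 2 \<alpha> - \<sigma>\<^sup>2\<close> are positive.\<close>
  have decay: "(\<lambda>n. exp (- a * real n)) \<longlonglongrightarrow> 0" if "0 < a" for a :: real
  proof -
    have "(\<lambda>n. exp (- a) ^ n) \<longlonglongrightarrow> 0" using that by (intro LIMSEQ_power_zero) simp
    then show ?thesis by (simp add: exp_of_nat_mult[symmetric] mult.commute)
  qed
  have "(\<lambda>n. c * x\<^sup>2 - K / r + q * (x / b) powr D2
      - (exp (- r * real n) * q + c * (x\<^sup>2 * exp (- (r - 2 * \<alpha> - \<sigma>\<^sup>2) * real n))))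
      \<longlonglongrightarrow> c * x\<^sup>2 - K / r + q * (x / b) powr D2 - (0 * q + c * (x\<^sup>2 * 0))"
    using r ex by (intro tendsto_diff tendsto_add tendsto_mult tendsto_const decay) auto
  then have lim: "(\<lambda>n. c * x\<^sup>2 - K / r + q * (x / b) powr D2
      - (exp (- r * real n) * q + c * (x\<^sup>2 * exp (- (r - 2 * \<alpha> - \<sigma>\<^sup>2) * real n))))
      \<longlonglongrightarrow> c * x\<^sup>2 - K / r + q * (x / b) powr D2" by simp
  show ?thesis
    by (rule LIMSEQ_le[OF lim stopped_payoff_limit[OF r ex \<tau>]]) (use bound in auto)
qed

end

lemma borel_measurable_stopped_payoff:
  assumes V: "\<And>s. 0 \<le> s \<Longrightarrow> V s \<in> borel_measurable M"
    and Vc: "\<And>\<omega>. \<omega> \<in> space M \<Longrightarrow> continuous_on {0..} (\<lambda>s. V s \<omega>)"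
    and \<tau>[measurable]: "\<tau> \<in> borel_measurable M"
  shows "stopped_payoff r \<gamma> K V \<tau> \<in> borel_measurable M"
proof -
  have "(\<lambda>(s, \<omega>). V (max 0 s) \<omega>) \<in> borel_measurable (borel \<Otimes>\<^sub>M M)"
    by (rule borel_measurable_continuous_process[OF V Vc])
  from measurable_compose[OF measurable_pair_swap' this]
  have [measurable]: "(\<lambda>p. V (max 0 (snd p)) (fst p)) \<in> borel_measurable (M \<Otimes>\<^sub>M lborel)"
    by (simp add: case_prod_beta')
  have "(\<lambda>\<omega>. \<integral>s. of_bool (ennreal s \<le> \<tau> \<omega>) * (discount r s * (\<gamma>\<^sup>2 * (V (max 0 s) \<omega>)\<^sup>2 / 4 - K)) \<partial>lborel) \<in> borel_measurable M"
    by measurable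
  moreover have "stopped_payoff r \<gamma> K V \<tau> \<omega>
      = (\<integral>s. of_bool (ennreal s \<le> \<tau> \<omega>) * (discount r s * (\<gamma>\<^sup>2 * (V (max 0 s) \<omega>)\<^sup>2 / 4 - K)) \<partial>lborel)" for \<omega>
    unfolding stopped_payoff_def set_lebesgue_integral_def
    by (intro Bochner_Integration.integral_cong) (auto simp: indicator_def discount_def profit_def max_def)
  ultimately show ?thesis by (simp cong: measurable_cong)
qed

lemma stopped_payoff_zero_time: "stopped_payoff r \<gamma> K V (\<lambda>_. 0) \<omega> = 0"
  unfolding stopped_payoff_def set_lebesgue_integral_def
proof (rule integral_eq_zero_AE)
  show "AE s in lborel. indicator {s. 0 \<le> s \<and> ennreal s \<le> 0} s *\<^sub>R (exp (- r * s) * profit \<gamma> K (V s \<omega>)) = 0"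
    using AE_lborel_singleton[of 0] by eventually_elim (auto simp: indicator_def)
qed

lemma stopped_payoff_zero_path_nonpos:
  assumes "0 \<le> K" and V: "\<And>s. 0 \<le> s \<Longrightarrow> V s \<omega> = 0"
  shows "stopped_payoff r \<gamma> K V \<tau> \<omega> \<le> 0"
proof -
  have "0 \<le> (\<integral>s. - (indicator {s. 0 \<le> s \<and> ennreal s \<le> \<tau> \<omega>} s *\<^sub>R (exp (- r * s) * profit \<gamma> K (V s \<omega>))) \<partial>lborel)"
    using assms by (intro integral_nonneg_AE AE_I2) (auto simp: indicator_def profit_def)
  then show ?thesis unfolding stopped_payoff_def set_lebesgue_integral_def by simp
qed

section \<open>Threshold and value function\<close>

lemma threshold_identities:
  fixes \<alpha> \<sigma> \<gamma> r K D2 :: real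
  assumes "\<gamma> > 0" "r > 0" "K > 0" "r > \<sigma>\<^sup>2 + 2 * \<alpha>" "D2 < 0"
  defines "b \<equiv> threshold \<alpha> \<sigma> \<gamma> r K D2" and "c \<equiv> \<gamma>\<^sup>2 / (4 * (r - 2 * \<alpha> - \<sigma>\<^sup>2))"
    and "q \<equiv> 2 / (2 - D2) * (K / r)"
  shows "0 < b" "0 < c" "0 \<le> q"
    and "c * b\<^sup>2 = - D2 / (2 - D2) * (K / r)"
    and "q + c * b\<^sup>2 = K / r" and "D2 * q + 2 * (c * b\<^sup>2) = 0"
proof -
  have d: "0 < r - 2 * \<alpha> - \<sigma>\<^sup>2" using assms by simp
  have pos: "0 < - D2 / (2 - D2) * (K / r) * (4 * (r - 2 * \<alpha> - \<sigma>\<^sup>2) / \<gamma>\<^sup>2)"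
    using assms d by (intro mult_pos_pos divide_pos_pos) auto
  then show "0 < b" by (simp add: b_def threshold_def)
  show "0 < c" using assms(1) d by (simp add: c_def)
  show "0 \<le> q" using assms by (simp add: q_def)
  have "b\<^sup>2 = - D2 / (2 - D2) * (K / r) * (4 * (r - 2 * \<alpha> - \<sigma>\<^sup>2) / \<gamma>\<^sup>2)"
    unfolding b_def threshold_def using pos by (intro real_sqrt_pow2) simp
  then show cb: "c * b\<^sup>2 = - D2 / (2 - D2) * (K / r)"
    unfolding c_def using assms(1) d by simp
  have "2 - D2 \<noteq> 0" using assms(5) by simp
  then show "q + c * b\<^sup>2 = K / r"
    unfolding cb q_def distrib_right[symmetric] add_divide_distrib[symmetric] by simp
  show "D2 * q + 2 * (c * b\<^sup>2) = 0"
    unfolding cb q_def by simp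
qed

lemma v_inf_eq:
  fixes \<alpha> \<sigma> \<gamma> r K D1 D2 x :: real
  assumes "0 < threshold \<alpha> \<sigma> \<gamma> r K D2" "0 < x"
  shows "v_inf \<alpha> \<sigma> \<gamma> r K D1 D2 x = \<gamma>\<^sup>2 / (4 * (r - 2 * \<alpha> - \<sigma>\<^sup>2)) * x\<^sup>2 - K / r
    + 2 / (2 - D2) * (K / r) * (x / threshold \<alpha> \<sigma> \<gamma> r K D2) powr D2"
  using assms by (simp add: v_inf_def coeff1_def coeff2_def powr_divide powr_minus_divide)

text \<open>
  The two equations determine \<open>p\<close> and \<open>q\<close>. Positivity of \<open>p\<close> is the condition \<open>c x\<^sup>2 (2 - D2) \<le> - D2 k\<close>, that is
  \<open>x \<le> b\<close>.
\<close>

lemma tangent_coefficients: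
  fixes c k x b D1 D2 :: real
  assumes D: "0 < D1" "D2 < 0" and c: "0 < c" and k: "0 < k" and x: "0 < x" "x < b"
    and cb: "c * b\<^sup>2 = - D2 / (2 - D2) * k"
  obtains p q where "0 \<le> p" "0 \<le> q" "p + q + c * x\<^sup>2 = k" "D1 * p + D2 * q + 2 * (c * x\<^sup>2) = 0"
proof
  define w where "w = c * x\<^sup>2"
  let ?p = "(- 2 * w - D2 * (k - w)) / (D1 - D2)" and ?q = "(D1 * (k - w) + 2 * w) / (D1 - D2)"
  have DD: "0 < D1 - D2" "0 < 2 - D2" using D by auto
  have "x\<^sup>2 \<le> b\<^sup>2" using x by (intro power_mono) auto
  then have "w \<le> - D2 / (2 - D2) * k" unfolding w_def cb[symmetric] using c by (intro mult_left_mono) auto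
  then have wb: "w * (2 - D2) \<le> - D2 * k" using DD(2) by (simp add: field_simps)
  have w0: "0 \<le> w" using c by (simp add: w_def)
  have wk: "w \<le> k"
  proof -
    have "w * (2 - D2) \<le> k * (2 - D2)" using wb k by (simp add: algebra_simps)
    then show ?thesis using DD(2) by (simp add: mult_le_cancel_right)
  qed
  show "0 \<le> ?p" using wb DD(1) by (intro divide_nonneg_pos) (simp_all add: algebra_simps)
  show "0 \<le> ?q" using wk w0 D(1) DD(1) by (intro divide_nonneg_pos add_nonneg_nonneg mult_nonneg_nonneg) auto
  have "?p + ?q = (D1 - D2) * (k - w) / (D1 - D2)"
    unfolding add_divide_distrib[symmetric] by (simp add: algebra_simps)
  then show "?p + ?q + c * x\<^sup>2 = k" using DD(1) by (simp add: w_def)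
  have "D1 * ?p + D2 * ?q = (D1 - D2) * (- 2 * w) / (D1 - D2)"
    unfolding times_divide_eq_right add_divide_distrib[symmetric] by (simp add: algebra_simps)
  then show "D1 * ?p + D2 * ?q + 2 * (c * x\<^sup>2) = 0" using DD(1) by (simp add: w_def)
qed

theorem theorem1:
  fixes M :: "'a measure" and F :: "ennreal \<Rightarrow> 'a measure"
    and W X :: "real \<Rightarrow> 'a \<Rightarrow> real"
    and \<alpha> \<sigma> \<gamma> r K D1 D2 x :: real
  assumes "\<sigma> > 0" and "\<gamma> > 0" and "r > 0" and "K > 0"
    and "r > \<sigma>\<^sup>2 + 2 * \<alpha>"
    and "x \<ge> 0"
    and "geometric_brownian_motion M F W \<alpha> \<sigma> x X"
    and "D1 > 0" and "- (1/2) * \<sigma>\<^sup>2 * D1\<^sup>2 + (\<sigma>\<^sup>2 / 2 - \<alpha>) * D1 + r = 0"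
    and "D2 < 0" and "- (1/2) * \<sigma>\<^sup>2 * D2\<^sup>2 + (\<sigma>\<^sup>2 / 2 - \<alpha>) * D2 + r = 0"
  shows "value_function M F r \<gamma> K X =
    ereal (if x \<ge> threshold \<alpha> \<sigma> \<gamma> r K D2 then v_inf \<alpha> \<sigma> \<gamma> r K D1 D2 x else 0)"
proof -
  interpret geometric_brownian_motion M F W \<alpha> \<sigma> x X by (rule assms(7))
  define Z where "Z = geometric_path W \<alpha> \<sigma> x"
  define b where "b = threshold \<alpha> \<sigma> \<gamma> r K D2"
  define c where "c = \<gamma>\<^sup>2 / (4 * (r - 2 * \<alpha> - \<sigma>\<^sup>2))"
  define q where "q = 2 / (2 - D2) * (K / r)"
  define v where "v = (if x \<ge> b then v_inf \<alpha> \<sigma> \<gamma> r K D1 D2 x else 0)"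
  note b = threshold_identities[OF assms(2-5,10), folded b_def c_def q_def]
  let ?E = "\<lambda>\<tau>. integral\<^sup>L M (stopped_payoff r \<gamma> K Z \<tau>)"
  have X_Z: "integral\<^sup>L M (stopped_payoff r \<gamma> K X \<tau>) = ?E \<tau>" if \<tau>: "stopping_time F \<tau>" for \<tau>
  proof (rule integral_cong_AE)
    have [measurable]: "\<tau> \<in> borel_measurable M" by (rule stopping_time_measurable[OF \<tau>])
    show "stopped_payoff r \<gamma> K X \<tau> \<in> borel_measurable M"
      by (rule borel_measurable_stopped_payoff) (use measurable_F[OF X_adapted] X_continuous in auto)
    show "stopped_payoff r \<gamma> K Z \<tau> \<in> borel_measurable M"
      unfolding Z_def
      by (rule borel_measurable_stopped_payoff)
        (use measurable_F[OF geometric_path_adapted] geometric_path_continuous in auto)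
    show "AE \<omega> in M. stopped_payoff r \<gamma> K X \<tau> \<omega> = stopped_payoff r \<gamma> K Z \<tau> \<omega>"
      using AE_X_eq_geometric_path
    proof eventually_elim
      case (elim \<omega>)
      then show ?case
        unfolding stopped_payoff_def Z_def by (intro set_lebesgue_integral_cong) auto
    qed
  qed
  have upper: "?E \<tau> \<le> v" if \<tau>: "stopping_time F \<tau>" for \<tau>
  proof (cases "x = 0")
    case True
    have "stopped_payoff r \<gamma> K Z \<tau> \<omega> \<le> 0" for \<omega>
      by (rule stopped_payoff_zero_path_nonpos) (use assms(4) True in \<open>auto simp: Z_def geometric_path_def\<close>)
    then have "0 \<le> (\<integral>\<omega>. - stopped_payoff r \<gamma> K Z \<tau> \<omega> \<partial>M)"
      by (intro integral_nonneg_AE AE_I2) simp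
    then show ?thesis using True b(1) by (simp add: v_def)
  next
    case False
    then have x: "0 < x" using assms(6) by simp
    note le = expectation_payoff_le[OF x assms(3,5) _ assms(9,11) c_def _ _ _ _ \<tau>, folded Z_def, of _ _ _ K]
    show ?thesis
    proof (cases "x \<ge> b")
      case True
      have "?E \<tau> \<le> c * x\<^sup>2 - K / r + (0 * (x / b) powr D1 + q * (x / b) powr D2)"
        by (rule le) (use b in auto)
      then show ?thesis
        using True v_inf_eq[of \<alpha> \<sigma> \<gamma> r K D2 x D1] b(1) x by (simp add: v_def b_def c_def q_def)
    next
      case False
      obtain p' q' where pq: "0 \<le> p'" "0 \<le> q'" "p' + q' + c * x\<^sup>2 = K / r" "D1 * p' + D2 * q' + 2 * (c * x\<^sup>2) = 0"
        using tangent_coefficients[OF assms(8,10) b(2) _ x _ b(4)] False assms(3,4) by auto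
      have "?E \<tau> \<le> c * x\<^sup>2 - K / r + (p' * (x / x) powr D1 + q' * (x / x) powr D2)"
        by (rule le) (use x pq in auto)
      also have "\<dots> = 0" using x pq(3) by simp
      finally show ?thesis using False by (simp add: v_def)
    qed
  qed
  have lower: "\<exists>\<tau>. stopping_time F \<tau> \<and> v \<le> ?E \<tau>"
  proof (cases "x \<ge> b")
    case True
    have "stopping_time F (hitting_time Z b)"
      unfolding Z_def
      by (rule stopping_time_hitting_time) (rule geometric_path_adapted geometric_path_continuous; assumption)+
    moreover have "v \<le> ?E (hitting_time Z b)"
      using expectation_payoff_hitting_time_ge[OF assms(3,5) b(1) True assms(10,11) c_def _ b(3,5), folded Z_def] assms(4)
        v_inf_eq[of \<alpha> \<sigma> \<gamma> r K D2 x D1] b(1) True by (simp add: v_def b_def c_def q_def)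
    ultimately show ?thesis by blast
  next
    case False
    have "?E (\<lambda>_. 0) = 0"
      by (intro integral_eq_zero_AE AE_I2) (rule stopped_payoff_zero_time)
    then show ?thesis using False stopping_time_const by (intro exI[of _ "\<lambda>_. 0"]) (simp add: v_def)
  qed
  have "value_function M F r \<gamma> K X = ereal v"
    unfolding value_function_def
  proof (rule antisym)
    show "(SUP \<tau>\<in>{\<tau>. stopping_time F \<tau>}. ereal (integral\<^sup>L M (stopped_payoff r \<gamma> K X \<tau>))) \<le> ereal v"
      by (rule SUP_least) (use X_Z upper in auto)
    obtain \<tau> where \<tau>: "stopping_time F \<tau>" "v \<le> ?E \<tau>" using lower by blast
    then show "ereal v \<le> (SUP \<tau>\<in>{\<tau>. stopping_time F \<tau>}. ereal (integral\<^sup>L M (stopped_payoff r \<gamma> K X \<tau>)))"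
      by (intro SUP_upper2[of \<tau>]) (auto simp: X_Z)
  qed
  then show ?thesis by (simp only: v_def b_def)
qed

end
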